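(* Suppose that $q:[0,T]\to Q$ is a modified cubic polynomial. Then for any $\tau\in[0,T]$, there are only finitely many points of $[0,T]$ which are biconjugate to $\tau$ along $q$.
   Context: $Q$ is a complete connected Riemannian manifold with metric $\langle\cdot,\cdot\rangle$, Levi-Civita connection $\nabla$, and curvature endomorphism $R(X,Y)Z = \nabla_X\nabla_Y Z - \nabla_Y\nabla_X Z - \nabla_{[X,Y]}Z$; $\frac{D}{dt}$ is the covariant derivative along a curve; $T>0$. $V:Q\to\mathbb{R}$ is smooth and non-negative, with gradient $\operatorname{grad}V$. A modified cubic polynomial is a smooth curve $q$ satisfying $\frac{D^3\dot q}{dt^3}+R\big(\frac{D\dot q}{dt},\dot q\big)\dot q+\operatorname{grad}V(q(t))=0$. Define \begin{align*} F(X,Y) &= (\nabla^2_Y R)(X,Y)Y + (\nabla_X R)(\nabla_Y Y,Y)Y + R(R(X,Y)Y,Y)Y + R(X,\nabla^2_Y Y)Y \\ &\quad + 2\big[(\nabla_Y R)(\nabla_Y X,Y)Y + (\nabla_Y R)(X,\nabla_Y Y)Y + R(\nabla^2_Y X,Y)Y\big] \\ &\quad + 3\big[(\nabla_Y R)(X,Y)\nabla_Y Y + R(X,Y)\nabla^2_Y Y + R(X,\nabla_Y Y)\nabla_Y Y\big] + 4R(\nabla_Y X,Y)\nabla_Y Y , \end{align*} where in $F(X,\dot q)$ derivatives in the direction $\dot q$ are covariant derivatives along $q$: $\nabla_{\dot q}X=\frac{DX}{dt}$, $\nabla^2_{\dot q}X=\frac{D^2X}{dt^2}$, $\nabla_{\dot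 q}\dot q=\frac{D\dot q}{dt}$, $\nabla^2_{\dot q}\dot q=\frac{D^2\dot q}{dt^2}$, and $\nabla^2_{\dot q}R$ is the second covariant derivative of $R$ along $q$. A modified bi-Jacobi field along $q$ is a (smooth) vector field $X$ along $q$ with $\frac{D^4}{dt^4}X+F(X,\dot q)+\nabla_X\operatorname{grad}V(q)\equiv0$ on $[0,T]$. Two points $t_1,t_2\in[0,T]$ are biconjugate along $q$ if there is a non-zero modified bi-Jacobi field $X$ along $q$ with $X(t_1)=X(t_2)=0$ and $\frac{D}{dt}X(t_1)=\frac{D}{dt}X(t_2)=0$. *)

theory Defs
  imports "HOL-Analysis.Analysis"
begin

text \<open>The derivatives are taken within \<open>S\<close>, so that the notion applies to open sets as well as
  to relatively open subsets of a compact interval (one-sided derivatives at the end points). It is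
  only used for sets in which derivatives within the set are unique.\<close>

fun Ck_on :: "nat \<Rightarrow> 'a::real_normed_vector set \<Rightarrow> ('a \<Rightarrow> 'b::real_normed_vector) \<Rightarrow> bool" where
  "Ck_on 0 S f \<longleftrightarrow> continuous_on S f"
| "Ck_on (Suc k) S f \<longleftrightarrow>
     (\<forall>x\<in>S. f differentiable (at x within S)) \<and>
     (\<forall>v. Ck_on k S (\<lambda>x. frechet_derivative f (at x within S) v))"

definition smooth_on :: "'a::real_normed_vector set \<Rightarrow> ('a \<Rightarrow> 'b::real_normed_vector) \<Rightarrow> bool" where
  "smooth_on S f \<longleftrightarrow> (\<forall>k. Ck_on k S f)"

text \<open>A manifold is a whole Hausdorff, second countable type \<open>'q\<close>, modelled on the Euclidean
  space \<open>'e\<close>. A chart is a pair of its domain and its coordinate map (whose values outside the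
  domain are irrelevant). A tangent vector at a point is the family of its coordinate vectors in all
  the charts of the atlas around that point, related by the differentials of the coordinate
  changes; it is zero at all other charts, so that equality of tangent vectors is equality of
  functions.\<close>

type_synonym ('q, 'e) chart = "'q set \<times> ('q \<Rightarrow> 'e)"
type_synonym ('q, 'e) tvec = "('q, 'e) chart \<Rightarrow> 'e"

abbreviation chart_dom :: "('q, 'e) chart \<Rightarrow> 'q set" where
  "chart_dom \<equiv> fst"

abbreviation chart_map :: "('q, 'e) chart \<Rightarrow> 'q \<Rightarrow> 'e" where
  "chart_map \<equiv> snd"

definition chart_inv :: "('q, 'e) chart \<Rightarrow> 'e \<Rightarrow> 'q" where
  "chart_inv c = inv_into (chart_dom c) (chart_map c)"

definition transition :: "('q, 'e) chart \<Rightarrow> ('q, 'e) chart \<Rightarrow> 'e \<Rightarrow> 'e" where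
  "transition c c' = chart_map c' \<circ> chart_inv c"

locale smooth_manifold =
  fixes A :: "('q::{t2_space, second_countable_topology}, 'e::euclidean_space) chart set"
  assumes open_chart_dom: "c \<in> A \<Longrightarrow> open (chart_dom c)"
    and open_chart_image: "c \<in> A \<Longrightarrow> open (chart_map c ` chart_dom c)"
    and chart_homeomorphism: "c \<in> A \<Longrightarrow>
      homeomorphism (chart_dom c) (chart_map c ` chart_dom c) (chart_map c) (chart_inv c)"
    and charts_cover: "(\<Union>c\<in>A. chart_dom c) = UNIV"
    and transition_smooth: "c \<in> A \<Longrightarrow> c' \<in> A \<Longrightarrow>
      smooth_on (chart_map c ` (chart_dom c \<inter> chart_dom c')) (transition c c')"
begin

definition charts_at :: "'q \<Rightarrow> ('q, 'e) chart set" where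
  "charts_at p = {c \<in> A. p \<in> chart_dom c}"

definition tangent_space :: "'q \<Rightarrow> ('q, 'e) tvec set" where
  "tangent_space p = {v.
     (\<forall>c. c \<notin> charts_at p \<longrightarrow> v c = 0) \<and>
     (\<forall>c\<in>charts_at p. \<forall>c'\<in>charts_at p.
        v c' = frechet_derivative (transition c c') (at (chart_map c p)) (v c))}"

text \<open>The tangent vector at \<open>p\<close> with coordinate vector \<open>u\<close> in the chart \<open>c\<close>. For fixed \<open>c\<close>, \<open>u\<close>
  and varying \<open>p\<close> it is the vector field on the domain of \<open>c\<close> with constant coordinates \<open>u\<close>.\<close>

definition tvec_of :: "('q, 'e) chart \<Rightarrow> 'e \<Rightarrow> 'q \<Rightarrow> ('q, 'e) tvec" where
  "tvec_of c u p = (\<lambda>c'. if c' \<in> charts_at p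
     then frechet_derivative (transition c c') (at (chart_map c p)) u else 0)"

definition smooth_function :: "('q \<Rightarrow> real) \<Rightarrow> bool" where
  "smooth_function f \<longleftrightarrow> (\<forall>c\<in>A. smooth_on (chart_map c ` chart_dom c) (f \<circ> chart_inv c))"

definition smooth_curve :: "real set \<Rightarrow> (real \<Rightarrow> 'q) \<Rightarrow> bool" where
  "smooth_curve I q \<longleftrightarrow> continuous_on I q \<and>
     (\<forall>c\<in>A. smooth_on {t \<in> I. q t \<in> chart_dom c} (chart_map c \<circ> q))"

definition velocity :: "real set \<Rightarrow> (real \<Rightarrow> 'q) \<Rightarrow> real \<Rightarrow> ('q, 'e) tvec" where
  "velocity I q t = (\<lambda>c. if c \<in> charts_at (q t)
     then vector_derivative (chart_map c \<circ> q) (at t within I) else 0)"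

definition smooth_field_along :: "real set \<Rightarrow> (real \<Rightarrow> 'q) \<Rightarrow> (real \<Rightarrow> ('q, 'e) tvec) \<Rightarrow> bool" where
  "smooth_field_along I q X \<longleftrightarrow>
     (\<forall>t\<in>I. X t \<in> tangent_space (q t)) \<and>
     (\<forall>c\<in>A. smooth_on {t \<in> I. q t \<in> chart_dom c} (\<lambda>t. X t c))"

text \<open>\<open>dir_deriv X Y\<close> is the derivative of the coordinates of the vector field \<open>Y\<close> in the direction
  \<open>X\<close>; by itself it is not a vector field.\<close>

definition dir_deriv :: "('q \<Rightarrow> ('q, 'e) tvec) \<Rightarrow> ('q \<Rightarrow> ('q, 'e) tvec) \<Rightarrow> 'q \<Rightarrow> ('q, 'e) tvec" where
  "dir_deriv X Y p = (\<lambda>c. if c \<in> charts_at p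
     then frechet_derivative (\<lambda>x. Y (chart_inv c x) c) (at (chart_map c p)) (X p c) else 0)"

definition lie_bracket :: "('q \<Rightarrow> ('q, 'e) tvec) \<Rightarrow> ('q \<Rightarrow> ('q, 'e) tvec) \<Rightarrow> 'q \<Rightarrow> ('q, 'e) tvec" where
  "lie_bracket X Y p = (\<lambda>c. dir_deriv X Y p c - dir_deriv Y X p c)"

lemma open_chart_map_image:
  assumes "c \<in> A" "open W"
  shows "open (chart_map c ` (chart_dom c \<inter> W))"
proof -
  have "openin (top_of_set (chart_map c ` chart_dom c)) (chart_map c ` (chart_dom c \<inter> W))"
    by (rule homeomorphism_imp_open_map[OF chart_homeomorphism]) (use assms in \<open>auto simp: openin_open\<close>)
  then show ?thesis
    using open_chart_image[OF assms(1)] openin_open_trans by blast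
qed

lemma chart_inv_map: "c \<in> charts_at p \<Longrightarrow> chart_inv c (chart_map c p) = p"
  using chart_homeomorphism[of c] unfolding charts_at_def homeomorphism_def by auto

lemma transition_has_derivative:
  assumes "c \<in> charts_at p" "c' \<in> charts_at p"
  shows "(transition c c' has_derivative frechet_derivative (transition c c') (at (chart_map c p)))
    (at (chart_map c p))"
proof -
  let ?S = "chart_map c ` (chart_dom c \<inter> chart_dom c')"
  have c: "c \<in> A" "c' \<in> A" and x: "chart_map c p \<in> ?S"
    using assms by (auto simp: charts_at_def)
  have "Ck_on (Suc 0) ?S (transition c c')"
    using transition_smooth[OF c] unfolding smooth_on_def by blast
  then have "transition c c' differentiable (at (chart_map c p) within ?S)"
    using x by auto
  then show ?thesis
    using at_within_open[OF x open_chart_map_image[OF c(1) open_chart_dom[OF c(2)]]]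
    by (simp add: frechet_derivative_works)
qed

lemma transition_derivative_compose:
  assumes "c \<in> charts_at p" "c' \<in> charts_at p" "c'' \<in> charts_at p"
  shows "frechet_derivative (transition c' c'') (at (chart_map c' p))
      (frechet_derivative (transition c c') (at (chart_map c p)) u) =
    frechet_derivative (transition c c'') (at (chart_map c p)) u"
proof -
  let ?S = "chart_map c ` (chart_dom c \<inter> chart_dom c')"
  have c: "c \<in> A" "c' \<in> A" and x: "chart_map c p \<in> ?S"
    using assms by (auto simp: charts_at_def)
  have tp: "transition c c' (chart_map c p) = chart_map c' p"
    by (simp add: transition_def chart_inv_map[OF assms(1)])
  have "((transition c' c'' \<circ> transition c c') has_derivative
      (frechet_derivative (transition c' c'') (at (chart_map c' p)) \<circ>
       frechet_derivative (transition c c') (at (chart_map c p)))) (at (chart_map c p))"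
    using diff_chain_at[OF transition_has_derivative[OF assms(1,2)],
        of "transition c' c''"] transition_has_derivative[OF assms(2,3)] tp by simp
  moreover have "(transition c' c'' \<circ> transition c c') y = transition c c'' y" if "y \<in> ?S" for y
  proof -
    from that obtain r where r: "r \<in> chart_dom c" "r \<in> chart_dom c'" "y = chart_map c r" by auto
    then have "c \<in> charts_at r" "c' \<in> charts_at r" using c by (auto simp: charts_at_def)
    then show ?thesis using r by (simp add: transition_def chart_inv_map)
  qed
  ultimately have "(transition c c'' has_derivative
      (frechet_derivative (transition c' c'') (at (chart_map c' p)) \<circ>
       frechet_derivative (transition c c') (at (chart_map c p)))) (at (chart_map c p))"
    using has_derivative_transform_within_open[OF _ open_chart_map_image[OF c(1) open_chart_dom[OF c(2)]] x]
    by blast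
  from has_derivative_unique[OF this transition_has_derivative[OF assms(1,3)]]
  show ?thesis by (metis comp_apply)
qed

lemma transition_derivative_same:
  assumes "c \<in> charts_at p"
  shows "frechet_derivative (transition c c) (at (chart_map c p)) u = u"
proof -
  let ?S = "chart_map c ` chart_dom c"
  have c: "c \<in> A" and x: "chart_map c p \<in> ?S"
    using assms by (auto simp: charts_at_def)
  have "y = transition c c y" if "y \<in> ?S" for y
    using that c by (auto simp: transition_def charts_at_def chart_inv_map)
  then have "(transition c c has_derivative (\<lambda>h. h)) (at (chart_map c p))"
    using has_derivative_transform_within_open[OF has_derivative_ident open_chart_image[OF c] x]
    by blast
  from has_derivative_unique[OF this transition_has_derivative[OF assms assms]]
  show ?thesis by metis
qed

lemma tvec_of_tangent: "c \<in> charts_at p \<Longrightarrow> tvec_of c u p \<in> tangent_space p"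
  by (auto simp: tangent_space_def tvec_of_def transition_derivative_compose)

lemma tvec_of_chart: "c \<in> charts_at p \<Longrightarrow> tvec_of c u p c = u"
  by (simp add: tvec_of_def transition_derivative_same)

lemma tvec_of_linear:
  assumes "c \<in> charts_at p"
  shows "tvec_of c (a *\<^sub>R u + b *\<^sub>R v) p = (\<lambda>c'. a *\<^sub>R tvec_of c u p c' + b *\<^sub>R tvec_of c v p c')"
proof
  fix c'
  show "tvec_of c (a *\<^sub>R u + b *\<^sub>R v) p c' = a *\<^sub>R tvec_of c u p c' + b *\<^sub>R tvec_of c v p c'"
  proof (cases "c' \<in> charts_at p")
    case True
    interpret linear "frechet_derivative (transition c c') (at (chart_map c p))"
      using transition_has_derivative[OF assms True] by (rule has_derivative_linear)
    show ?thesis using True by (simp add: tvec_of_def add scale)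
  qed (simp add: tvec_of_def)
qed

end

locale riemannian_manifold = smooth_manifold A
  for A :: "('q::{t2_space, second_countable_topology}, 'e::euclidean_space) chart set" +
  fixes g :: "'q \<Rightarrow> ('q, 'e) tvec \<Rightarrow> ('q, 'e) tvec \<Rightarrow> real"
  assumes metric_linear: "\<lbrakk>u \<in> tangent_space p; v \<in> tangent_space p; w \<in> tangent_space p\<rbrakk> \<Longrightarrow>
      g p (\<lambda>c. a *\<^sub>R u c + b *\<^sub>R v c) w = a * g p u w + b * g p v w"
    and metric_sym: "\<lbrakk>u \<in> tangent_space p; v \<in> tangent_space p\<rbrakk> \<Longrightarrow> g p u v = g p v u"
    and metric_pos: "\<lbrakk>u \<in> tangent_space p; u \<noteq> (\<lambda>c. 0)\<rbrakk> \<Longrightarrow> g p u u > 0"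
    and metric_smooth: "c \<in> A \<Longrightarrow> smooth_on (chart_map c ` chart_dom c)
      (\<lambda>x. g (chart_inv c x) (tvec_of c \<xi> (chart_inv c x)) (tvec_of c \<eta> (chart_inv c x)))"
begin

definition local_metric :: "('q, 'e) chart \<Rightarrow> 'e \<Rightarrow> 'e \<Rightarrow> 'e \<Rightarrow> real" where
  "local_metric c x u v =
     g (chart_inv c x) (tvec_of c u (chart_inv c x)) (tvec_of c v (chart_inv c x))"

text \<open>The Levi-Civita connection acts in the chart \<open>c\<close> by \<open>\<nabla>\<^sub>X Y = DY(X) + \<Gamma>(X, Y)\<close>, where at each
  point \<open>\<Gamma>\<close> is the unique bilinear map for which \<open>\<nabla>\<close> is torsion free (\<open>\<Gamma>\<close> is symmetric) and
  compatible with the metric, see \<open>levi_civita_form_ex1\<close> below.\<close>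

definition is_levi_civita_form :: "('q, 'e) chart \<Rightarrow> 'e \<Rightarrow> ('e \<Rightarrow> 'e \<Rightarrow> 'e) \<Rightarrow> bool" where
  "is_levi_civita_form c x \<Gamma> \<longleftrightarrow> bilinear \<Gamma> \<and> (\<forall>u v. \<Gamma> u v = \<Gamma> v u) \<and>
     (\<forall>u v w. frechet_derivative (\<lambda>y. local_metric c y v w) (at x) u =
        local_metric c x (\<Gamma> u v) w + local_metric c x v (\<Gamma> u w))"

definition christoffel :: "('q, 'e) chart \<Rightarrow> 'e \<Rightarrow> 'e \<Rightarrow> 'e \<Rightarrow> 'e" where
  "christoffel c x = (THE \<Gamma>. is_levi_civita_form c x \<Gamma>)"

lemma
  assumes "c \<in> A" "x \<in> chart_map c ` chart_dom c"
  shows local_metric_bilinear: "bilinear (local_metric c x)"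
    and local_metric_sym: "local_metric c x u v = local_metric c x v u"
    and local_metric_pos: "u \<noteq> 0 \<Longrightarrow> local_metric c x u u > 0"
proof -
  let ?p = "chart_inv c x"
  have c: "c \<in> charts_at ?p"
    using assms chart_homeomorphism[OF assms(1)] by (auto simp: charts_at_def homeomorphism_def)
  show sym: "local_metric c x u v = local_metric c x v u" for u v
    unfolding local_metric_def by (intro metric_sym tvec_of_tangent c)
  have *: "local_metric c x (a *\<^sub>R u + b *\<^sub>R v) w =
      a * local_metric c x u w + b * local_metric c x v w" for a b u v w
    unfolding local_metric_def tvec_of_linear[OF c] by (intro metric_linear tvec_of_tangent c)
  have "linear (\<lambda>u. local_metric c x u w)" for w
    using *[of 1 _ 1 _ w] *[of _ _ 0 0 w] by (intro linearI) auto
  moreover from this have "linear (\<lambda>w. local_metric c x u w)" for u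
    by (subst sym)
  ultimately show "bilinear (local_metric c x)"
    unfolding bilinear_def by blast
  show "local_metric c x u u > 0" if "u \<noteq> 0"
    unfolding local_metric_def
    by (intro metric_pos tvec_of_tangent c) (metis that tvec_of_chart[OF c])
qed

lemma local_metric_differentiable:
  assumes "c \<in> A" "x \<in> chart_map c ` chart_dom c"
  shows "(\<lambda>y. local_metric c y u v) differentiable (at x)"
proof -
  have "Ck_on (Suc 0) (chart_map c ` chart_dom c) (\<lambda>y. local_metric c y u v)"
    using metric_smooth[OF assms(1)] unfolding smooth_on_def local_metric_def by blast
  then show ?thesis
    using assms(2) at_within_open[OF assms(2) open_chart_image[OF assms(1)]] by auto
qed

lemma local_metric_riesz:
  assumes "c \<in> A" "x \<in> chart_map c ` chart_dom c" "linear L"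
  shows "\<exists>!z. \<forall>w. local_metric c x z w = L w"
proof -
  define m where "m = local_metric c x"
  have bil: "bilinear m" and pos: "\<And>u. u \<noteq> 0 \<Longrightarrow> m u u > 0"
    unfolding m_def using local_metric_bilinear local_metric_pos assms by blast+
  define f where "f z = (\<Sum>b\<in>Basis. m z b *\<^sub>R b)" for z
  have "linear f"
    unfolding f_def by (intro linearI)
      (simp_all add: bilinear_ladd[OF bil] bilinear_lmul[OF bil] scaleR_add_left sum.distrib scaleR_sum_right)
  have eq: "m z w = M w" if "linear M" "\<And>b. b \<in> Basis \<Longrightarrow> m z b = M b" for z w M
    using linear_eq_stdbasis[of "m z" M] bil that by (auto simp: bilinear_def)
  have "z = 0" if "f z = 0" for z
  proof -
    have "m z b = 0" if "b \<in> Basis" for b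
      using \<open>f z = 0\<close> inner_sum_left_Basis[OF that, of "m z"] by (simp add: f_def)
    then have "m z z = 0" using eq[of "\<lambda>_. 0" z z] linear_zero by auto
    then show ?thesis using pos[of z] by auto
  qed
  then have "inj f" using \<open>linear f\<close> linear_injective_0 by blast
  then have "surj f" using \<open>linear f\<close> linear_injective_imp_surjective by blast
  then obtain z where z: "f z = (\<Sum>b\<in>Basis. L b *\<^sub>R b)" by (metis surj_def)
  have "m z b = L b" if "b \<in> Basis" for b
    using arg_cong[OF z, of "\<lambda>y. y \<bullet> b"] inner_sum_left_Basis[OF that] by (simp add: f_def)
  then have ex: "\<forall>w. m z w = L w" using eq[OF \<open>linear L\<close>] by blast
  show ?thesis
  proof (rule ex1I[of _ z])
    show "\<forall>w. local_metric c x z w = L w" using ex by (simp add: m_def)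
    fix z' assume "\<forall>w. local_metric c x z' w = L w"
    then have "m (z' - z) (z' - z) = 0"
      using ex bilinear_lsub[OF bil] by (simp add: m_def)
    then show "z' = z" using pos[of "z' - z"] by auto
  qed
qed

lemma levi_civita_form_ex1:
  assumes "c \<in> A" "x \<in> chart_map c ` chart_dom c"
  shows "\<exists>!\<Gamma>. is_levi_civita_form c x \<Gamma>"
proof -
  define m where "m = local_metric c x"
  define d where "d u v w = frechet_derivative (\<lambda>y. local_metric c y v w) (at x) u" for u v w
  have bil: "bilinear m" and sym: "\<And>u v. m u v = m v u"
    unfolding m_def using local_metric_bilinear local_metric_sym assms by blast+
  have der: "((\<lambda>y. local_metric c y v w) has_derivative (\<lambda>u. d u v w)) (at x)" for v w
    using local_metric_differentiable[OF assms] unfolding d_def frechet_derivative_works by metis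
  have S: "x \<in> chart_map c ` chart_dom c" "open (chart_map c ` chart_dom c)"
    using assms open_chart_image by auto
  have lin1: "d (a *\<^sub>R u + b *\<^sub>R u') v w = a * d u v w + b * d u' v w" for a b u u' v w
  proof -
    interpret linear "\<lambda>u. d u v w" using der by (rule has_derivative_linear)
    show ?thesis by (simp add: add scale)
  qed
  have lin2: "d u (a *\<^sub>R v + b *\<^sub>R v') w = a * d u v w + b * d u v' w" for a b u v v' w
  proof -
    have "((\<lambda>y. a * local_metric c y v w + b * local_metric c y v' w)
        has_derivative (\<lambda>u. a * d u v w + b * d u v' w)) (at x)"
      by (intro derivative_intros der)
    then have "((\<lambda>y. local_metric c y (a *\<^sub>R v + b *\<^sub>R v') w)
        has_derivative (\<lambda>u. a * d u v w + b * d u v' w)) (at x)"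
    proof (rule has_derivative_transform_within_open[OF _ S(2,1)])
      fix y assume "y \<in> chart_map c ` chart_dom c"
      note b = local_metric_bilinear[OF assms(1) this]
      show "a * local_metric c y v w + b * local_metric c y v' w =
          local_metric c y (a *\<^sub>R v + b *\<^sub>R v') w"
        by (simp add: bilinear_ladd[OF b] bilinear_lmul[OF b])
    qed
    from has_derivative_unique[OF der this] show ?thesis by metis
  qed
  have dsym: "d u v w = d u w v" for u v w
    using has_derivative_unique[OF der has_derivative_transform_within_open[OF der S(2,1)],
        of v w w v] local_metric_sym[OF assms(1)] by metis
  have lin3: "d u w (a *\<^sub>R v + b *\<^sub>R v') = a * d u w v + b * d u w v'" for a b u v v' w
    using lin2 dsym by metis
  define K where "K u v w = (d u v w + d v u w - d w u v) / 2" for u v w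
  have linK: "linear (K u v)" for u v
    using lin1[of 1 _ 1] lin2[of _ 1 _ 1] lin3[of _ _ 1 _ 1]
      lin1[of _ _ 0 0] lin2[of _ _ _ 0 0] lin3[of _ _ _ _ 0 0]
    by (intro linearI) (simp_all add: K_def algebra_simps diff_divide_distrib add_divide_distrib)
  have ex1: "\<exists>!z. \<forall>w. m z w = K u v w" for u v
    unfolding m_def by (rule local_metric_riesz[OF assms linK])
  define G where "G u v = (THE z. \<forall>w. m z w = K u v w)" for u v
  have G: "m (G u v) w = K u v w" for u v w
    using theI'[OF ex1[of u v]] unfolding G_def by blast
  have Gu: "z = G u v" if "\<And>w. m z w = K u v w" for z u v
    using ex1[of u v] G that by blast
  have symG: "G u v = G v u" for u v
    by (rule Gu) (simp add: G K_def dsym)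
  have "a *\<^sub>R G u v + b *\<^sub>R G u' v = G (a *\<^sub>R u + b *\<^sub>R u') v" for a b u u' v
    by (rule Gu) (simp add: bilinear_ladd[OF bil] bilinear_lmul[OF bil] G K_def lin1 lin2 algebra_simps
        diff_divide_distrib add_divide_distrib)
  note * = this
  have linG: "linear (\<lambda>u. G u v)" for v
    using *[of 1 _ v 1] *[of _ _ v 0 0] by (intro linearI) simp_all
  moreover have "linear (\<lambda>v. G u v)" for u
    by (subst symG) (rule linG)
  ultimately have "bilinear G"
    unfolding bilinear_def by blast
  moreover have "d u v w = m (G u v) w + m v (G u w)" for u v w
    by (simp add: sym[of v] G K_def dsym[of v] dsym[of w] dsym[of u w v] field_simps)
  ultimately have exG: "is_levi_civita_form c x G"
    using symG unfolding is_levi_civita_form_def m_def d_def by blast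
  moreover have "H = G" if H: "is_levi_civita_form c x H" for H
  proof (intro ext Gu)
    fix u v w
    have "H u v = H v u" "H u w = H w u" "H v w = H w v"
      and "\<And>u v w. d u v w = m (H u v) w + m v (H u w)"
      using H unfolding is_levi_civita_form_def m_def d_def by blast+
    then show "m (H u v) w = K u v w"
      by (simp add: K_def sym[of u] sym[of v])
  qed
  ultimately show ?thesis by blast
qed

definition nabla :: "('q \<Rightarrow> ('q, 'e) tvec) \<Rightarrow> ('q \<Rightarrow> ('q, 'e) tvec) \<Rightarrow> 'q \<Rightarrow> ('q, 'e) tvec" where
  "nabla X Y p = (\<lambda>c. if c \<in> charts_at p
     then dir_deriv X Y p c + christoffel c (chart_map c p) (X p c) (Y p c) else 0)"

definition cov_deriv_along ::
  "real set \<Rightarrow> (real \<Rightarrow> 'q) \<Rightarrow> (real \<Rightarrow> ('q, 'e) tvec) \<Rightarrow> real \<Rightarrow> ('q, 'e) tvec" where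
  "cov_deriv_along I q X t = (\<lambda>c. if c \<in> charts_at (q t)
     then vector_derivative (\<lambda>s. X s c) (at t within I) +
       christoffel c (chart_map c (q t)) (velocity I q t c) (X t c) else 0)"

definition geodesically_complete :: bool where
  "geodesically_complete \<longleftrightarrow> (\<forall>p. \<forall>v\<in>tangent_space p. \<exists>\<gamma>. smooth_curve UNIV \<gamma> \<and>
     \<gamma> 0 = p \<and> velocity UNIV \<gamma> 0 = v \<and>
     (\<forall>t. cov_deriv_along UNIV \<gamma> (velocity UNIV \<gamma>) t = (\<lambda>c. 0)))"

definition grad :: "('q \<Rightarrow> real) \<Rightarrow> 'q \<Rightarrow> ('q, 'e) tvec" where
  "grad f p = (THE z. z \<in> tangent_space p \<and>
     (\<forall>w\<in>tangent_space p. \<forall>c\<in>charts_at p.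
        g p z w = frechet_derivative (f \<circ> chart_inv c) (at (chart_map c p)) (w c)))"

definition curvature_fields :: "('q \<Rightarrow> ('q, 'e) tvec) \<Rightarrow> ('q \<Rightarrow> ('q, 'e) tvec) \<Rightarrow>
    ('q \<Rightarrow> ('q, 'e) tvec) \<Rightarrow> 'q \<Rightarrow> ('q, 'e) tvec" where
  "curvature_fields X Y Z p = (\<lambda>c.
     nabla X (nabla Y Z) p c - nabla Y (nabla X Z) p c - nabla (lie_bracket X Y) Z p c)"

text \<open>The following operations are tensorial: their values at a point depend only on the values
  of the vector fields there. To evaluate them on given tangent vectors in the chart \<open>c\<close>, the
  tangent vectors are extended to fields with constant coordinates in \<open>c\<close>.\<close>

definition curvature :: "'q \<Rightarrow> ('q, 'e) tvec \<Rightarrow> ('q, 'e) tvec \<Rightarrow> ('q, 'e) tvec \<Rightarrow> ('q, 'e) tvec" where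
  "curvature p u v w = (\<lambda>c.
     curvature_fields (tvec_of c (u c)) (tvec_of c (v c)) (tvec_of c (w c)) p c)"

text \<open>\<open>nabla_curvature p a u v w\<close> is \<open>(\<nabla>\<^sub>a R)(u, v) w\<close> at \<open>p\<close>.\<close>

definition nabla_curvature :: "'q \<Rightarrow> ('q, 'e) tvec \<Rightarrow>
    ('q, 'e) tvec \<Rightarrow> ('q, 'e) tvec \<Rightarrow> ('q, 'e) tvec \<Rightarrow> ('q, 'e) tvec" where
  "nabla_curvature p a u v w = (\<lambda>c.
     let N = tvec_of c (a c); U = tvec_of c (u c); V = tvec_of c (v c); W = tvec_of c (w c) in
       nabla N (\<lambda>r. curvature r (U r) (V r) (W r)) p c
       - curvature p (nabla N U p) (V p) (W p) c
       - curvature p (U p) (nabla N V p) (W p) c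
       - curvature p (U p) (V p) (nabla N W p) c)"

text \<open>The covariant derivative along \<open>q\<close> of a tensor \<open>S\<close> along \<open>q\<close> of the type of the curvature.\<close>

definition cov_deriv_tensor_along :: "real set \<Rightarrow> (real \<Rightarrow> 'q) \<Rightarrow>
    (real \<Rightarrow> ('q, 'e) tvec \<Rightarrow> ('q, 'e) tvec \<Rightarrow> ('q, 'e) tvec \<Rightarrow> ('q, 'e) tvec) \<Rightarrow>
    real \<Rightarrow> ('q, 'e) tvec \<Rightarrow> ('q, 'e) tvec \<Rightarrow> ('q, 'e) tvec \<Rightarrow> ('q, 'e) tvec" where
  "cov_deriv_tensor_along I q S t u v w = (\<lambda>c.
     let D = cov_deriv_along I q;
         U = (\<lambda>s. tvec_of c (u c) (q s));
         V = (\<lambda>s. tvec_of c (v c) (q s));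
         W = (\<lambda>s. tvec_of c (w c) (q s)) in
       D (\<lambda>s. S s (U s) (V s) (W s)) t c
       - S t (D U t) (V t) (W t) c
       - S t (U t) (D V t) (W t) c
       - S t (U t) (V t) (D W t) c)"

definition modified_cubic_polynomial :: "('q \<Rightarrow> real) \<Rightarrow> real \<Rightarrow> (real \<Rightarrow> 'q) \<Rightarrow> bool" where
  "modified_cubic_polynomial V T q \<longleftrightarrow>
     (let D = cov_deriv_along {0..T} q; Y = velocity {0..T} q in
       smooth_curve {0..T} q \<and>
       (\<forall>t\<in>{0..T}. \<forall>c. (D ^^ 3) Y t c + curvature (q t) (D Y t) (Y t) (Y t) c + grad V (q t) c = 0))"

definition bi_jacobi_F :: "real set \<Rightarrow> (real \<Rightarrow> 'q) \<Rightarrow> (real \<Rightarrow> ('q, 'e) tvec) \<Rightarrow>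
    real \<Rightarrow> ('q, 'e) tvec" where
  "bi_jacobi_F I q X t = (\<lambda>c.
     let D = cov_deriv_along I q;
         R = (\<lambda>s. curvature (q s));
         R0 = R t; R1 = cov_deriv_tensor_along I q R t;
         R2 = cov_deriv_tensor_along I q (cov_deriv_tensor_along I q R) t;
         x = X t; x1 = D X t; x2 = (D ^^ 2) X t;
         y = velocity I q t; y1 = D (velocity I q) t; y2 = (D ^^ 2) (velocity I q) t in
       R2 x y y c + nabla_curvature (q t) x y1 y y c + R0 (R0 x y y) y y c + R0 x y2 y c
       + 2 *\<^sub>R (R1 x1 y y c + R1 x y1 y c + R0 x2 y y c)
       + 3 *\<^sub>R (R1 x y y1 c + R0 x y y2 c + R0 x y1 y1 c)
       + 4 *\<^sub>R R0 x1 y y1 c)"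

text \<open>\<open>\<nabla>\<^sub>X grad V\<close> is tensorial in \<open>X\<close>, so any extension of the tangent vector \<open>X t\<close> may be used.\<close>

definition modified_bi_jacobi_field ::
  "('q \<Rightarrow> real) \<Rightarrow> real \<Rightarrow> (real \<Rightarrow> 'q) \<Rightarrow> (real \<Rightarrow> ('q, 'e) tvec) \<Rightarrow> bool" where
  "modified_bi_jacobi_field V T q X \<longleftrightarrow>
     smooth_field_along {0..T} q X \<and>
     (\<forall>t\<in>{0..T}. \<forall>c. (cov_deriv_along {0..T} q ^^ 4) X t c + bi_jacobi_F {0..T} q X t c
        + nabla (\<lambda>_. X t) (grad V) (q t) c = 0)"

definition biconjugate :: "('q \<Rightarrow> real) \<Rightarrow> real \<Rightarrow> (real \<Rightarrow> 'q) \<Rightarrow> real \<Rightarrow> real \<Rightarrow> bool" where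
  "biconjugate V T q t1 t2 \<longleftrightarrow> t1 \<in> {0..T} \<and> t2 \<in> {0..T} \<and>
     (\<exists>X. modified_bi_jacobi_field V T q X \<and> (\<exists>t\<in>{0..T}. X t \<noteq> (\<lambda>c. 0)) \<and>
       X t1 = (\<lambda>c. 0) \<and> X t2 = (\<lambda>c. 0) \<and>
       cov_deriv_along {0..T} q X t1 = (\<lambda>c. 0) \<and> cov_deriv_along {0..T} q X t2 = (\<lambda>c. 0))"

end

end

theory Submission
  imports Defs
begin

text \<open>Consider the energy \<open>\<integral> |D q'/dt|\<^sup>2 / 2 + V(q) dt\<close>. Its gradient at a curve \<open>q\<close> is the left hand
  side of the equation of a modified cubic polynomial, and the modified bi-Jacobi operator \<open>L\<close> is the
  covariant derivative of that gradient, so a Hessian: \<open>L\<close> is formally self-adjoint. Concretely,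
  with \<open>U = D\<^sup>2X + R(X, q')q'\<close> and \<open>W = D U + R(X, q')D q'\<close> (the first variations of \<open>D q'\<close> and
  \<open>D\<^sup>2q'\<close>), the Bianchi identities give

  \<open>\<langle>L X, Z\<rangle> = I(X, Z) + d/dt P(X, Z)\<close>, where
  \<open>P(X, Z) = \<langle>W, Z\<rangle> - \<langle>U, D Z\<rangle> + \<langle>R(D q', q')X, Z\<rangle> / 2\<close>

  and \<open>I\<close> is a symmetric form in the 2-jets with leading term \<open>\<langle>D\<^sup>2X, D\<^sup>2Z\<rangle>\<close> (lemmas
  \<open>index_form_sym\<close>, \<open>boundary_form_deriv\<close>). Two consequences are used. For two bi-Jacobi fields
  \<open>P(X, Z) - P(Z, X)\<close> is constant, so it vanishes identically for fields with a common double zero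
  \<open>\<tau>\<close>. And if \<open>Z\<close> has a double zero at \<open>e\<close>, then \<open>\<integral> I(X, Z)\<close> over \<open>[c, e]\<close> is \<open>P(X, Z)(c)\<close>.

  Suppose that infinitely many times \<open>t\<^sub>k\<close> are biconjugate to \<open>\<tau>\<close>, with fields \<open>X\<^sub>k\<close>. They accumulate
  at some \<open>t\<^sub>0\<close>; take a chart around \<open>q(t\<^sub>0)\<close> and a short interval \<open>[c, d]\<close> around \<open>t\<^sub>0\<close> that contains
  more than \<open>2 dim Q\<close> of the \<open>t\<^sub>k\<close>. Some nontrivial combination \<open>\<Sum> a\<^sub>k X\<^sub>k\<close> has a double zero at
  \<open>c\<close>. Cut off each \<open>X\<^sub>k\<close> after \<open>t\<^sub>k\<close>, and let \<open>w\<close> be the combination of the truncated fields. By the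
  two consequences the integral of \<open>I(w, w)\<close> over \<open>[c, d]\<close> equals \<open>P\<close> evaluated on the combination
  at \<open>c\<close>, which is zero. But on a short interval the Poincare inequality makes this integral
  positive unless \<open>w = 0\<close>, because \<open>I\<close> is positive definite in the highest derivative. So \<open>w = 0\<close>;
  just before the last \<open>t\<^sub>k\<close> with \<open>a\<^sub>k \<noteq> 0\<close> only \<open>X\<^sub>k\<close> contributes to \<open>w\<close>, so \<open>X\<^sub>k\<close> vanishes on an
  interval, and then everywhere by uniqueness for linear ordinary differential equations.

  The identities are proved in coordinates, where \<open>D\<close>, \<open>R\<close> and \<open>\<nabla>R\<close> are expressed by Christoffel
  symbols. Only the form \<open>P\<close> has to be carried from \<open>\<tau>\<close> to \<open>t\<^sub>0\<close> across different charts, so the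
  only transformation rules needed are those of the Christoffel symbols (\<open>christoffel_transform\<close>)
  and of the curvature (\<open>curvature_transform\<close>). The final argument is \<open>finite_biconjugate\<close>.\<close>

section \<open>Calculus of smooth functions\<close>

text \<open>This condition makes derivatives within \<open>S\<close> unique. It covers the two kinds of
  sets on which derivatives are taken here: open sets, and relatively open subsets of a compact
  interval.\<close>

definition derivative_domain :: "'a::euclidean_space set \<Rightarrow> bool" where
  "derivative_domain S \<longleftrightarrow>
     (\<forall>x\<in>S. \<forall>i\<in>Basis. \<forall>e>0. \<exists>d. 0 < \<bar>d\<bar> \<and> \<bar>d\<bar> < e \<and> x + d *\<^sub>R i \<in> S)"

lemma derivative_domain_open:
  assumes "open S" shows "derivative_domain S"
  unfolding derivative_domain_def
proof (intro ballI allI impI)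
  fix x e :: real and y i :: 'a
  assume y: "y \<in> S" and i: "i \<in> Basis" and e: "0 < e"
  obtain r where r: "r > 0" "ball y r \<subseteq> S"
    using assms y open_contains_ball by blast
  define d where "d = min (r/2) (e/2)"
  have "y + d *\<^sub>R i \<in> ball y r"
    using r e i by (simp add: dist_norm d_def)
  then show "\<exists>d. 0 < \<bar>d\<bar> \<and> \<bar>d\<bar> < e \<and> y + d *\<^sub>R i \<in> S"
    using r e by (intro exI[of _ d]) (auto simp: d_def)
qed

lemma has_derivative_within_unique:
  assumes "derivative_domain S" "x \<in> S"
    "(f has_derivative f') (at x within S)" "(f has_derivative f'') (at x within S)"
  shows "f' = f''"
  using frechet_derivative_unique_within[OF assms(3,4)] assms(1,2)
  unfolding derivative_domain_def by blast

lemma frechet_derivative_eqI: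
  assumes "derivative_domain S" "x \<in> S" "(f has_derivative f') (at x within S)"
  shows "frechet_derivative f (at x within S) = f'"
  using has_derivative_within_unique[OF assms(1,2) _ assms(3)] assms(3)
  by (metis differentiable_def frechet_derivative_works)

lemma frechet_derivative_cong_within:
  assumes "\<And>y. y \<in> S \<Longrightarrow> f y = g y" "x \<in> S"
  shows "frechet_derivative f (at x within S) = frechet_derivative g (at x within S)"
proof -
  have "(f has_derivative f') (at x within S) \<longleftrightarrow> (g has_derivative f') (at x within S)" for f'
    using assms by (metis has_derivative_transform)
  then show ?thesis by (simp add: frechet_derivative_def)
qed

lemma Ck_on_cong:
  assumes "\<And>x. x \<in> S \<Longrightarrow> f x = g x"
  shows "Ck_on k S f \<longleftrightarrow> Ck_on k S g"
  using assms
proof (induction k arbitrary: f g)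
  case 0
  then show ?case using continuous_on_cong by force
next
  case (Suc k)
  have "f differentiable (at x within S) \<longleftrightarrow> g differentiable (at x within S)" if "x \<in> S" for x
    using Suc.prems that unfolding differentiable_def by (metis has_derivative_transform)
  moreover have "Ck_on k S (\<lambda>x. frechet_derivative f (at x within S) v) \<longleftrightarrow>
      Ck_on k S (\<lambda>x. frechet_derivative g (at x within S) v)" for v
    by (rule Suc.IH) (simp add: frechet_derivative_cong_within[OF Suc.prems])
  ultimately show ?case by simp
qed

lemma Ck_on_SucD: "Ck_on (Suc k) S f \<Longrightarrow> Ck_on k S f"
proof (induction k arbitrary: f)
  case 0
  then show ?case
    by (auto simp: continuous_on_eq_continuous_within intro: differentiable_imp_continuous_within)
next
  case (Suc k)
  then show ?case by (metis Ck_on.simps(2))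
qed

lemma Ck_on_SucI:
  assumes "derivative_domain S" "\<And>x. x \<in> S \<Longrightarrow> (f has_derivative f' x) (at x within S)"
    "\<And>v. Ck_on k S (\<lambda>x. f' x v)"
  shows "Ck_on (Suc k) S f"
proof -
  have "Ck_on k S (\<lambda>x. frechet_derivative f (at x within S) v) \<longleftrightarrow> Ck_on k S (\<lambda>x. f' x v)" for v
    by (rule Ck_on_cong) (simp add: frechet_derivative_eqI[OF assms(1) _ assms(2)])
  then show ?thesis using assms(2,3) by (auto simp: differentiable_def)
qed

lemma Ck_on_SucE:
  assumes "Ck_on (Suc k) S f"
  shows "\<exists>f'. (\<forall>x\<in>S. (f has_derivative f' x) (at x within S)) \<and> (\<forall>v. Ck_on k S (\<lambda>x. f' x v))"
  using assms by (intro exI[of _ "\<lambda>x. frechet_derivative f (at x within S)"])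
    (auto simp: frechet_derivative_works)

lemma Ck_on_const:
  assumes "derivative_domain S" shows "Ck_on k S (\<lambda>x. c)"
proof (induction k arbitrary: c)
  case (Suc k)
  show ?case by (rule Ck_on_SucI[OF assms, of _ "\<lambda>_ _. 0"]) (auto intro: Suc)
qed simp

lemma Ck_on_bounded_linear:
  assumes "derivative_domain S" "bounded_linear L" "Ck_on k S f"
  shows "Ck_on k S (\<lambda>x. L (f x))"
  using assms(3)
proof (induction k arbitrary: f)
  case 0
  then show ?case by (simp add: bounded_linear.continuous_on[OF assms(2)])
next
  case (Suc k)
  obtain f' where f': "\<And>x. x \<in> S \<Longrightarrow> (f has_derivative f' x) (at x within S)"
    "\<And>v. Ck_on k S (\<lambda>x. f' x v)" using Ck_on_SucE[OF Suc.prems] by blast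
  show ?case
    by (rule Ck_on_SucI[OF assms(1), of _ "\<lambda>x v. L (f' x v)"])
      (auto intro!: bounded_linear.has_derivative[OF assms(2)] f' Suc.IH)
qed

lemma Ck_on_add:
  assumes "derivative_domain S" "Ck_on k S f" "Ck_on k S g"
  shows "Ck_on k S (\<lambda>x. f x + g x)"
  using assms(2,3)
proof (induction k arbitrary: f g)
  case 0
  then show ?case by (auto intro: continuous_on_add)
next
  case (Suc k)
  obtain f' where f': "\<And>x. x \<in> S \<Longrightarrow> (f has_derivative f' x) (at x within S)"
    "\<And>v. Ck_on k S (\<lambda>x. f' x v)" using Ck_on_SucE[OF Suc.prems(1)] by blast
  obtain g' where g': "\<And>x. x \<in> S \<Longrightarrow> (g has_derivative g' x) (at x within S)"
    "\<And>v. Ck_on k S (\<lambda>x. g' x v)" using Ck_on_SucE[OF Suc.prems(2)] by blast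
  show ?case
    by (rule Ck_on_SucI[OF assms(1), of _ "\<lambda>x v. f' x v + g' x v"])
      (auto intro!: has_derivative_add f' g' Suc.IH)
qed

lemma Ck_on_bounded_bilinear:
  assumes "derivative_domain S" "bounded_bilinear B" "Ck_on k S f" "Ck_on k S g"
  shows "Ck_on k S (\<lambda>x. B (f x) (g x))"
  using assms(3,4)
proof (induction k arbitrary: f g)
  case 0
  then show ?case by (simp add: bounded_bilinear.continuous_on[OF assms(2)])
next
  case (Suc k)
  obtain f' where f': "\<And>x. x \<in> S \<Longrightarrow> (f has_derivative f' x) (at x within S)"
    "\<And>v. Ck_on k S (\<lambda>x. f' x v)" using Ck_on_SucE[OF Suc.prems(1)] by blast
  obtain g' where g': "\<And>x. x \<in> S \<Longrightarrow> (g has_derivative g' x) (at x within S)"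
    "\<And>v. Ck_on k S (\<lambda>x. g' x v)" using Ck_on_SucE[OF Suc.prems(2)] by blast
  show ?case
    by (rule Ck_on_SucI[OF assms(1), of _ "\<lambda>x v. B (f x) (g' x v) + B (f' x v) (g x)"])
      (auto intro!: bounded_bilinear.FDERIV[OF assms(2)] f' g' Ck_on_add[OF assms(1)] Suc.IH
        Ck_on_SucD[OF Suc.prems(1)] Ck_on_SucD[OF Suc.prems(2)])
qed

lemma Ck_on_sum:
  assumes "derivative_domain S" "\<And>i. i \<in> I \<Longrightarrow> Ck_on k S (f i)"
  shows "Ck_on k S (\<lambda>x. \<Sum>i\<in>I. f i x)"
  using assms(2)
  by (induction I rule: infinite_finite_induct)
    (auto simp: Ck_on_const[OF assms(1)] intro!: Ck_on_add[OF assms(1)])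

lemma Ck_on_inverse:
  fixes f :: "_ \<Rightarrow> real"
  assumes "derivative_domain S" "\<And>x. x \<in> S \<Longrightarrow> f x \<noteq> 0" "Ck_on k S f"
  shows "Ck_on k S (\<lambda>x. inverse (f x))"
  using assms(3)
proof (induction k)
  case 0
  then show ?case using assms(2) by (auto intro: continuous_on_inverse)
next
  case (Suc k)
  obtain f' where f': "\<And>x. x \<in> S \<Longrightarrow> (f has_derivative f' x) (at x within S)"
    "\<And>v. Ck_on k S (\<lambda>x. f' x v)" using Ck_on_SucE[OF Suc.prems(1)] by blast
  note inv = Suc.IH[OF Ck_on_SucD[OF Suc.prems]]
  note mult = Ck_on_bounded_bilinear[OF assms(1) bounded_bilinear_mult]
  have "Ck_on k S (\<lambda>x. - (inverse (f x) * f' x v * inverse (f x)))" for v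
    by (intro Ck_on_bounded_linear[OF assms(1) bounded_linear_minus[OF bounded_linear_ident]]
        mult inv f')
  then show ?case
    using Ck_on_SucI[OF assms(1), of "\<lambda>x. inverse (f x)"
        "\<lambda>x v. - (inverse (f x) * f' x v * inverse (f x))" k]
      Deriv.has_derivative_inverse[OF assms(2) f'(1)] by blast
qed

text \<open>The derivative of the composition is expanded in the standard basis, so that only directional
  derivatives of \<open>f\<close> occur: these have the same type as \<open>f\<close>, which the induction needs.\<close>

lemma Ck_on_compose:
  fixes x :: "'a::euclidean_space \<Rightarrow> 'c::euclidean_space"
  assumes "derivative_domain S" "Ck_on k U f" "Ck_on k S x" "x ` S \<subseteq> U"
  shows "Ck_on k S (\<lambda>t. f (x t))"
  using assms(2,3)
proof (induction k arbitrary: f)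
  case 0
  then show ?case using assms(4) by (auto intro: continuous_on_compose2)
next
  case (Suc k)
  obtain f' where f': "\<And>x. x \<in> U \<Longrightarrow> (f has_derivative f' x) (at x within U)"
    "\<And>v. Ck_on k U (\<lambda>x. f' x v)" using Ck_on_SucE[OF Suc.prems(1)] by blast
  obtain x' where x': "\<And>t. t \<in> S \<Longrightarrow> (x has_derivative x' t) (at t within S)"
    "\<And>v. Ck_on k S (\<lambda>t. x' t v)" using Ck_on_SucE[OF Suc.prems(2)] by blast
  let ?d = "\<lambda>t v. \<Sum>i\<in>Basis. (x' t v \<bullet> i) *\<^sub>R f' (x t) i"
  have "((\<lambda>t. f (x t)) has_derivative ?d t) (at t within S)" if t: "t \<in> S" for t
  proof -
    have xt: "x t \<in> U" using assms(4) t by blast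
    have "((\<lambda>t. f (x t)) has_derivative (\<lambda>v. f' (x t) (x' t v))) (at t within S)"
      using diff_chain_within[OF x'(1)[OF t] has_derivative_subset[OF f'(1)[OF xt] assms(4)]]
      by (simp add: o_def)
    moreover have "f' (x t) w = (\<Sum>i\<in>Basis. (w \<bullet> i) *\<^sub>R f' (x t) i)" for w
    proof -
      interpret linear "f' (x t)" using f'(1)[OF xt] by (rule has_derivative_linear)
      show ?thesis by (subst euclidean_representation[symmetric]) (simp add: sum scale)
    qed
    then have "(\<lambda>v. f' (x t) (x' t v)) = ?d t" by (rule ext)
    ultimately show ?thesis by simp
  qed
  moreover have "Ck_on k S (\<lambda>t. ?d t v)" for v
    by (intro Ck_on_sum[OF assms(1)] Ck_on_bounded_bilinear[OF assms(1) bounded_bilinear_scaleR]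
        Ck_on_bounded_linear[OF assms(1) bounded_linear_inner_left] x'(2)
        Suc.IH[OF f'(2) Ck_on_SucD[OF Suc.prems(2)]])
  ultimately show ?case by (rule Ck_on_SucI[OF assms(1)])
qed

context
  fixes S :: "'a::euclidean_space set"
  assumes S: "derivative_domain S"
begin

lemma smooth_on_const: "smooth_on S (\<lambda>x. c)"
  by (simp add: smooth_on_def Ck_on_const[OF S])

lemma smooth_on_bounded_linear: "bounded_linear L \<Longrightarrow> smooth_on S f \<Longrightarrow> smooth_on S (\<lambda>x. L (f x))"
  by (simp add: smooth_on_def Ck_on_bounded_linear[OF S])

lemma smooth_on_add: "smooth_on S f \<Longrightarrow> smooth_on S g \<Longrightarrow> smooth_on S (\<lambda>x. f x + g x)"
  by (simp add: smooth_on_def Ck_on_add[OF S])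

lemma smooth_on_bounded_bilinear:
  "bounded_bilinear B \<Longrightarrow> smooth_on S f \<Longrightarrow> smooth_on S g \<Longrightarrow> smooth_on S (\<lambda>x. B (f x) (g x))"
  by (simp add: smooth_on_def Ck_on_bounded_bilinear[OF S])

lemma smooth_on_sum: "(\<And>i. i \<in> I \<Longrightarrow> smooth_on S (f i)) \<Longrightarrow> smooth_on S (\<lambda>x. \<Sum>i\<in>I. f i x)"
  by (simp add: smooth_on_def Ck_on_sum[OF S])

lemma smooth_on_divide:
  fixes f g :: "'a \<Rightarrow> real"
  shows "smooth_on S f \<Longrightarrow> smooth_on S g \<Longrightarrow> (\<And>x. x \<in> S \<Longrightarrow> g x \<noteq> 0) \<Longrightarrow> smooth_on S (\<lambda>x. f x / g x)"
  unfolding divide_inverse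
  by (intro smooth_on_bounded_bilinear[OF bounded_bilinear_mult])
    (auto simp: smooth_on_def Ck_on_inverse[OF S])

lemma smooth_on_compose:
  fixes x :: "'a \<Rightarrow> 'c::euclidean_space"
  shows "smooth_on U f \<Longrightarrow> smooth_on S x \<Longrightarrow> x ` S \<subseteq> U \<Longrightarrow> smooth_on S (\<lambda>t. f (x t))"
  unfolding smooth_on_def using Ck_on_compose[OF S] by blast

lemma smooth_on_cong: "(\<And>x. x \<in> S \<Longrightarrow> f x = g x) \<Longrightarrow> smooth_on S f \<longleftrightarrow> smooth_on S g"
  using Ck_on_cong unfolding smooth_on_def by metis

lemma smooth_on_scaleR:
  "smooth_on S a \<Longrightarrow> smooth_on S f \<Longrightarrow> smooth_on S (\<lambda>x. a x *\<^sub>R f x)"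
  by (rule smooth_on_bounded_bilinear[OF bounded_bilinear_scaleR])

lemma smooth_on_minus: "smooth_on S f \<Longrightarrow> smooth_on S (\<lambda>x. - f x)"
  by (rule smooth_on_bounded_linear[OF bounded_linear_minus[OF bounded_linear_ident]])

lemma smooth_on_diff: "smooth_on S f \<Longrightarrow> smooth_on S g \<Longrightarrow> smooth_on S (\<lambda>x. f x - g x)"
  using smooth_on_add[of f "\<lambda>x. - g x"] smooth_on_minus[of g] by simp

text \<open>Tensor fields are handled as families of multilinear maps whose values at constant arguments
  depend smoothly on the parameter. This lemma, applied to one argument at a time, passes to
  arguments that vary with the parameter; \<open>has_derivative_linear_apply\<close> is the product rule that goes
  with it.\<close>

lemma smooth_on_linear_apply:
  fixes a :: "'a \<Rightarrow> 'c::euclidean_space"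
  assumes "\<And>x. x \<in> S \<Longrightarrow> linear (L x)" "\<And>u. smooth_on S (\<lambda>x. L x u)" "smooth_on S a"
  shows "smooth_on S (\<lambda>x. L x (a x))"
proof -
  have "L x (a x) = (\<Sum>i\<in>Basis. (a x \<bullet> i) *\<^sub>R L x i)" if "x \<in> S" for x
  proof -
    interpret linear "L x" using assms(1)[OF that] .
    show ?thesis by (subst euclidean_representation[symmetric]) (simp add: sum scale)
  qed
  moreover have "smooth_on S (\<lambda>x. \<Sum>i\<in>Basis. (a x \<bullet> i) *\<^sub>R L x i)"
    by (intro smooth_on_sum smooth_on_scaleR smooth_on_bounded_linear[OF bounded_linear_inner_left]
        assms)
  ultimately show ?thesis using smooth_on_cong by (metis (no_types, lifting))
qed

lemma smooth_on_frechet_derivative: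
  "smooth_on S f \<Longrightarrow> smooth_on S (\<lambda>x. frechet_derivative f (at x within S) v)"
  unfolding smooth_on_def by (metis Ck_on.simps(2))

lemma smooth_on_has_derivative:
  "smooth_on S f \<Longrightarrow> x \<in> S \<Longrightarrow>
    (f has_derivative frechet_derivative f (at x within S)) (at x within S)"
  unfolding smooth_on_def by (metis Ck_on.simps(2) frechet_derivative_works)

end

lemma smooth_on_imp_continuous_on: "smooth_on S f \<Longrightarrow> continuous_on S f"
  unfolding smooth_on_def by (metis Ck_on.simps(1))

lemma smooth_on_open_derivative:
  fixes U :: "'a::euclidean_space set"
  assumes "open U" "smooth_on U f"
  shows "smooth_on U (\<lambda>x. frechet_derivative f (at x) v)"
    and "x \<in> U \<Longrightarrow> (f has_derivative frechet_derivative f (at x)) (at x)"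
proof -
  have *: "at x within U = at x" if "x \<in> U" for x
    using at_within_open[OF that assms(1)] .
  have "smooth_on U (\<lambda>x. frechet_derivative f (at x within U) v)"
    by (rule smooth_on_frechet_derivative[OF derivative_domain_open[OF assms(1)] assms(2)])
  then show "smooth_on U (\<lambda>x. frechet_derivative f (at x) v)"
    by (rule smooth_on_cong[OF derivative_domain_open[OF assms(1)], THEN iffD1, rotated])
      (simp only: *)
  show "x \<in> U \<Longrightarrow> (f has_derivative frechet_derivative f (at x)) (at x)"
    using smooth_on_has_derivative[OF derivative_domain_open[OF assms(1)] assms(2)] * by metis
qed

lemma has_derivative_linear_apply:
  fixes a :: "'a::euclidean_space \<Rightarrow> 'c::euclidean_space"
  assumes S: "derivative_domain S" "x \<in> S" and L: "\<And>y. y \<in> S \<Longrightarrow> linear (L y)"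
    and L': "\<And>u. ((\<lambda>y. L y u) has_derivative (\<lambda>h. L' h u)) (at x within S)"
    and a: "(a has_derivative a') (at x within S)"
  shows "((\<lambda>y. L y (a y)) has_derivative (\<lambda>h. L' h (a x) + L x (a' h))) (at x within S)"
proof -
  have rep: "L y w = (\<Sum>i\<in>Basis. (w \<bullet> i) *\<^sub>R L y i)" if "y \<in> S" for y w
  proof -
    interpret linear "L y" using L[OF that] .
    show ?thesis by (subst euclidean_representation[symmetric]) (simp add: sum scale)
  qed
  have rep': "L' h w = (\<Sum>i\<in>Basis. (w \<bullet> i) *\<^sub>R L' h i)" for h w
  proof -
    have "((\<lambda>y. \<Sum>i\<in>Basis. (w \<bullet> i) *\<^sub>R L y i) has_derivative
        (\<lambda>h. \<Sum>i\<in>Basis. (w \<bullet> i) *\<^sub>R L' h i)) (at x within S)"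
      by (intro has_derivative_sum has_derivative_scaleR_right L')
    then have "((\<lambda>y. L y w) has_derivative (\<lambda>h. \<Sum>i\<in>Basis. (w \<bullet> i) *\<^sub>R L' h i)) (at x within S)"
      using rep by (rule has_derivative_transform[OF S(2), rotated])
    from has_derivative_within_unique[OF S L' this] show ?thesis by (rule fun_cong)
  qed
  have "((\<lambda>y. \<Sum>i\<in>Basis. (a y \<bullet> i) *\<^sub>R L y i) has_derivative
      (\<lambda>h. \<Sum>i\<in>Basis. (a x \<bullet> i) *\<^sub>R L' h i + (a' h \<bullet> i) *\<^sub>R L x i)) (at x within S)"
    by (intro has_derivative_sum has_derivative_scaleR has_derivative_inner_left a L')
  then have "((\<lambda>y. L y (a y)) has_derivative
      (\<lambda>h. \<Sum>i\<in>Basis. (a x \<bullet> i) *\<^sub>R L' h i + (a' h \<bullet> i) *\<^sub>R L x i)) (at x within S)"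
    using rep by (rule has_derivative_transform[OF S(2), rotated])
  moreover have "(\<Sum>i\<in>Basis. (a x \<bullet> i) *\<^sub>R L' h i + (a' h \<bullet> i) *\<^sub>R L x i) = L' h (a x) + L x (a' h)"
    for h
    by (subst rep', subst rep[OF S(2)]) (simp add: sum.distrib)
  ultimately show ?thesis by simp
qed

section \<open>Product rules and the symmetry of second derivatives\<close>

lemma has_derivative_bilinear_apply:
  fixes a :: "'a::euclidean_space \<Rightarrow> 'c::euclidean_space" and b :: "'a \<Rightarrow> 'd::euclidean_space"
  assumes S: "derivative_domain S" "x \<in> S" and B: "\<And>y. y \<in> S \<Longrightarrow> bilinear (B y)"
    and B': "\<And>u v. ((\<lambda>y. B y u v) has_derivative (\<lambda>h. B' h u v)) (at x within S)"
    and a: "(a has_derivative a') (at x within S)" and b: "(b has_derivative b') (at x within S)"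
  shows "((\<lambda>y. B y (a y) (b y)) has_derivative
    (\<lambda>h. B' h (a x) (b x) + B x (a' h) (b x) + B x (a x) (b' h))) (at x within S)"
proof -
  have "((\<lambda>y. B y (a y) v) has_derivative (\<lambda>h. B' h (a x) v + B x (a' h) v)) (at x within S)" for v
    by (rule has_derivative_linear_apply[OF S _ B' a]) (use B in \<open>simp add: bilinear_def\<close>)
  from has_derivative_linear_apply[where L = "\<lambda>y. B y (a y)", OF S _ this b] show ?thesis
    using B by (simp add: bilinear_def)
qed

definition trilinear :: "('a::real_vector \<Rightarrow> 'b::real_vector \<Rightarrow> 'c::real_vector \<Rightarrow> 'd::real_vector) \<Rightarrow> bool" where
  "trilinear F \<longleftrightarrow> (\<forall>u. bilinear (F u)) \<and> (\<forall>v w. linear (\<lambda>u. F u v w))"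

lemma has_derivative_trilinear_apply:
  fixes a b c :: "'a::euclidean_space \<Rightarrow> 'c::euclidean_space"
  assumes S: "derivative_domain S" "x \<in> S" and B: "\<And>y. y \<in> S \<Longrightarrow> trilinear (B y)"
    and B': "\<And>u v w. ((\<lambda>y. B y u v w) has_derivative (\<lambda>h. B' h u v w)) (at x within S)"
    and a: "(a has_derivative a') (at x within S)" and b: "(b has_derivative b') (at x within S)"
    and c: "(c has_derivative c') (at x within S)"
  shows "((\<lambda>y. B y (a y) (b y) (c y)) has_derivative
    (\<lambda>h. B' h (a x) (b x) (c x) + B x (a' h) (b x) (c x) + B x (a x) (b' h) (c x)
       + B x (a x) (b x) (c' h))) (at x within S)"
proof -
  have "((\<lambda>y. B y (a y) v w) has_derivative (\<lambda>h. B' h (a x) v w + B x (a' h) v w)) (at x within S)" for v w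
    by (rule has_derivative_linear_apply[OF S _ B' a]) (use B in \<open>simp add: trilinear_def\<close>)
  from has_derivative_bilinear_apply[where B = "\<lambda>y. B y (a y)", OF S _ this b c] show ?thesis
    using B by (simp add: trilinear_def)
qed

lemma has_derivative_along_line:
  fixes f :: "'a::euclidean_space \<Rightarrow> real"
  assumes "(f has_derivative f') (at (x + s *\<^sub>R u))"
  shows "((\<lambda>s. f (x + s *\<^sub>R u)) has_real_derivative f' u) (at s)"
proof -
  interpret linear f' using assms by (rule has_derivative_linear)
  have "((\<lambda>s. x + s *\<^sub>R u) has_derivative (\<lambda>h. h *\<^sub>R u)) (at s)"
    by (auto intro!: derivative_eq_intros)
  from has_derivative_compose[OF this, of f f'] assms
  show ?thesis by (simp add: has_field_derivative_def scale mult_commute_abs)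
qed

text \<open>The second difference is symmetric in \<open>u\<close> and \<open>v\<close>. Applying the mean value theorem in the
  direction \<open>u\<close> and then in the direction \<open>v\<close> turns it into a mixed derivative at a nearby point, so
  comparing the two orders at ever smaller scales proves the symmetry of second derivatives.\<close>

lemma second_difference_mvt:
  fixes f :: "'a::euclidean_space \<Rightarrow> real"
  assumes U: "open U" and f: "smooth_on U f" and r: "ball x r \<subseteq> U"
    and h: "0 < h" "h * (norm u + norm v) < r"
  shows "\<exists>y\<in>ball x r. f (x + h *\<^sub>R u + h *\<^sub>R v) - f (x + h *\<^sub>R u) - f (x + h *\<^sub>R v) + f x
    = h * h * frechet_derivative (\<lambda>z. frechet_derivative f (at z) u) (at y) v"
proof -
  let ?A = "\<lambda>z. frechet_derivative f (at z) u"
  have ball: "x + s *\<^sub>R u + t *\<^sub>R v \<in> ball x r" if "0 \<le> s" "s \<le> h" "0 \<le> t" "t \<le> h" for s t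
  proof -
    have "norm (s *\<^sub>R u + t *\<^sub>R v) \<le> s * norm u + t * norm v"
      using norm_triangle_ineq[of "s *\<^sub>R u" "t *\<^sub>R v"] that by simp
    also have "\<dots> \<le> h * norm u + h * norm v"
      using that by (intro add_mono mult_right_mono) auto
    finally have "norm (s *\<^sub>R u + t *\<^sub>R v) < r" using h(2) by (simp add: distrib_left)
    moreover have "dist x (x + s *\<^sub>R u + t *\<^sub>R v) = norm (s *\<^sub>R u + t *\<^sub>R v)"
      by (metis add.assoc add_diff_cancel_left' dist_commute dist_norm)
    ultimately show ?thesis by simp
  qed
  have d: "(f has_derivative frechet_derivative f (at z)) (at z)"
    and dA: "(?A has_derivative frechet_derivative ?A (at z)) (at z)" if "z \<in> ball x r" for z
    using smooth_on_open_derivative[OF U f] smooth_on_open_derivative(2)[OF U] that r by blast+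
  have "DERIV (\<lambda>s. f (x + h *\<^sub>R v + s *\<^sub>R u) - f (x + s *\<^sub>R u)) s
      :> ?A (x + h *\<^sub>R v + s *\<^sub>R u) - ?A (x + s *\<^sub>R u)" if "0 \<le> s" "s \<le> h" for s
  proof -
    have e: "x + h *\<^sub>R v + s *\<^sub>R u = x + s *\<^sub>R u + h *\<^sub>R v" by (simp add: algebra_simps)
    have "x + h *\<^sub>R v + s *\<^sub>R u \<in> ball x r"
      unfolding e using ball[of s h] that h(1) by (simp del: mem_ball)
    moreover have "x + s *\<^sub>R u \<in> ball x r" using ball[of s 0] that h(1) by simp
    ultimately show ?thesis by (intro DERIV_diff has_derivative_along_line[OF d])
  qed
  then have "\<exists>s>0. s < h \<and>
    (f (x + h *\<^sub>R v + h *\<^sub>R u) - f (x + h *\<^sub>R u)) - (f (x + h *\<^sub>R v + 0 *\<^sub>R u) - f (x + 0 *\<^sub>R u)) =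
      (h - 0) * (?A (x + h *\<^sub>R v + s *\<^sub>R u) - ?A (x + s *\<^sub>R u))"
    by (rule MVT2[OF h(1)])
  then obtain s where s: "0 < s" "s < h"
    "(f (x + h *\<^sub>R v + h *\<^sub>R u) - f (x + h *\<^sub>R u)) - (f (x + h *\<^sub>R v + 0 *\<^sub>R u) - f (x + 0 *\<^sub>R u)) =
      (h - 0) * (?A (x + h *\<^sub>R v + s *\<^sub>R u) - ?A (x + s *\<^sub>R u))"
    by (elim exE conjE)
  have "DERIV (\<lambda>t. ?A (x + s *\<^sub>R u + t *\<^sub>R v)) t
      :> frechet_derivative ?A (at (x + s *\<^sub>R u + t *\<^sub>R v)) v" if "0 \<le> t" "t \<le> h" for t
    using ball[of s t] that s by (intro has_derivative_along_line dA) (simp del: mem_ball)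
  then have "\<exists>t>0. t < h \<and>
    ?A (x + s *\<^sub>R u + h *\<^sub>R v) - ?A (x + s *\<^sub>R u + 0 *\<^sub>R v) =
      (h - 0) * frechet_derivative ?A (at (x + s *\<^sub>R u + t *\<^sub>R v)) v"
    by (rule MVT2[OF h(1)])
  then obtain t where t: "0 < t" "t < h"
    "?A (x + s *\<^sub>R u + h *\<^sub>R v) - ?A (x + s *\<^sub>R u + 0 *\<^sub>R v) =
      (h - 0) * frechet_derivative ?A (at (x + s *\<^sub>R u + t *\<^sub>R v)) v"
    by (elim exE conjE)
  show ?thesis
  proof (intro bexI)
    show "x + s *\<^sub>R u + t *\<^sub>R v \<in> ball x r" using ball s t by simp
    have e: "x + h *\<^sub>R v + a *\<^sub>R u = x + a *\<^sub>R u + h *\<^sub>R v" for a by (simp add: algebra_simps)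
    show "f (x + h *\<^sub>R u + h *\<^sub>R v) - f (x + h *\<^sub>R u) - f (x + h *\<^sub>R v) + f x
      = h * h * frechet_derivative ?A (at (x + s *\<^sub>R u + t *\<^sub>R v)) v"
      using s(3) t(3) by (simp add: e)
  qed
qed

lemma isCont_iff_norm:
  "isCont f x \<longleftrightarrow> (\<forall>e>0. \<exists>r>0. \<forall>y. norm (y - x) < r \<longrightarrow> norm (f y - f x) < e)"
  unfolding continuous_at_eps_delta by (simp add: dist_norm)

lemma second_derivative_sym_real:
  fixes f :: "'a::euclidean_space \<Rightarrow> real"
  assumes U: "open U" and f: "smooth_on U f" and x: "x \<in> U"
  shows "frechet_derivative (\<lambda>y. frechet_derivative f (at y) u) (at x) v
    = frechet_derivative (\<lambda>y. frechet_derivative f (at y) v) (at x) u"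
proof -
  let ?A = "\<lambda>u v x. frechet_derivative (\<lambda>y. frechet_derivative f (at y) u) (at x) v"
  have near: "\<exists>r>0. \<forall>y\<in>ball x r. \<bar>?A u v y - ?A u v x\<bar> < e" if e: "e > 0" for u v e
  proof -
    have "continuous_on U (?A u v)"
      by (rule smooth_on_imp_continuous_on[OF smooth_on_open_derivative(1)[OF U
            smooth_on_open_derivative(1)[OF U f]]])
    then have "isCont (?A u v) x" using U x by (simp add: continuous_on_eq_continuous_at)
    then obtain r where "r > 0" "\<forall>y. norm (y - x) < r \<longrightarrow> norm (?A u v y - ?A u v x) < e"
      using e unfolding isCont_iff_norm by blast
    then show ?thesis by (intro exI[of _ r]) (simp add: dist_norm norm_minus_commute)
  qed
  have "\<bar>?A u v x - ?A v u x\<bar> \<le> e" if "e > 0" for e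
  proof -
    have e2: "e / 2 > 0" using that by simp
    from near[OF e2, of u v] obtain r1 where r1: "r1 > 0" "\<forall>y\<in>ball x r1. \<bar>?A u v y - ?A u v x\<bar> < e/2"
      by (elim exE conjE)
    from near[OF e2, of v u] obtain r2 where r2: "r2 > 0" "\<forall>y\<in>ball x r2. \<bar>?A v u y - ?A v u x\<bar> < e/2"
      by (elim exE conjE)
    obtain r3 where r3: "r3 > 0" "ball x r3 \<subseteq> U"
      using U x open_contains_ball by blast
    define r where "r = min r1 (min r2 r3)"
    have r: "r > 0" "ball x r \<subseteq> U" "r \<le> r1" "r \<le> r2" using r1 r2 r3 by (auto simp: r_def)
    define h where "h = r / (norm u + norm v + 1) / 2"
    have pos: "norm u + norm v + 1 > 0" using norm_ge_zero[of u] norm_ge_zero[of v] by linarith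
    have h: "h > 0" using r pos by (simp add: h_def)
    have "h * (norm u + norm v) \<le> h * (norm u + norm v + 1)" using h by simp
    also have "\<dots> = r / 2" unfolding h_def using pos by (metis less_numeral_extra(3)
          nonzero_eq_divide_eq times_divide_eq_left)
    finally have hr: "h * (norm u + norm v) < r" using r by simp
    have hr': "h * (norm v + norm u) < r" using hr by (simp only: add.commute)
    from second_difference_mvt[OF U f r(2) h hr]
    obtain y where y: "y \<in> ball x r" "f (x + h *\<^sub>R u + h *\<^sub>R v) - f (x + h *\<^sub>R u) - f (x + h *\<^sub>R v) + f x
      = h * h * ?A u v y" by (elim bexE)
    from second_difference_mvt[OF U f r(2) h hr']
    obtain z where z: "z \<in> ball x r" "f (x + h *\<^sub>R v + h *\<^sub>R u) - f (x + h *\<^sub>R v) - f (x + h *\<^sub>R u) + f x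
      = h * h * ?A v u z" by (elim bexE)
    have e: "x + h *\<^sub>R v + h *\<^sub>R u = x + h *\<^sub>R u + h *\<^sub>R v" by (simp add: algebra_simps)
    have "h * h * ?A u v y = h * h * ?A v u z" using y(2) z(2)[unfolded e] by linarith
    then have "?A u v y = ?A v u z" using h by (simp only: mult_cancel_left) simp
    moreover have "\<bar>?A u v y - ?A u v x\<bar> < e/2" "\<bar>?A v u z - ?A v u x\<bar> < e/2"
      using r1(2) r2(2) y(1) z(1) r subset_ball[of r r1 x] subset_ball[of r r2 x] by blast+
    ultimately show ?thesis by linarith
  qed
  then show ?thesis using field_le_epsilon[of "\<bar>?A u v x - ?A v u x\<bar>" 0] by simp
qed

lemma frechet_derivative_inner_left:
  assumes "f differentiable (at x)"
  shows "frechet_derivative (\<lambda>y. f y \<bullet> b) (at x) u = frechet_derivative f (at x) u \<bullet> b"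
  using frechet_derivative_at[OF has_derivative_inner_left[OF
    assms[unfolded frechet_derivative_works]], of b] by metis

lemma second_derivative_sym:
  fixes f :: "'a::euclidean_space \<Rightarrow> 'b::euclidean_space"
  assumes U: "open U" and f: "smooth_on U f" and x: "x \<in> U"
  shows "frechet_derivative (\<lambda>y. frechet_derivative f (at y) u) (at x) v
    = frechet_derivative (\<lambda>y. frechet_derivative f (at y) v) (at x) u"
proof (rule euclidean_eqI)
  fix b :: 'b
  have S: "derivative_domain U" by (rule derivative_domain_open[OF U])
  have diff: "g differentiable (at y)" if "smooth_on U g" "y \<in> U" for y and g :: "'a \<Rightarrow> 'b"
    using smooth_on_open_derivative(2)[OF U that] by (rule differentiableI)
  have *: "frechet_derivative (\<lambda>y. frechet_derivative f (at y) u) (at x) v \<bullet> b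
    = frechet_derivative (\<lambda>y. frechet_derivative (\<lambda>z. f z \<bullet> b) (at y) u) (at x) v" for u v
  proof -
    have "frechet_derivative (\<lambda>y. frechet_derivative (\<lambda>z. f z \<bullet> b) (at y) u) (at x within U)
        = frechet_derivative (\<lambda>y. frechet_derivative f (at y) u \<bullet> b) (at x within U)"
      by (rule frechet_derivative_cong_within[OF _ x])
        (simp add: frechet_derivative_inner_left diff f)
    then show ?thesis
      by (simp add: at_within_open[OF x U] frechet_derivative_inner_left
          diff[OF smooth_on_open_derivative(1)[OF U f] x])
  qed
  show "frechet_derivative (\<lambda>y. frechet_derivative f (at y) u) (at x) v \<bullet> b
    = frechet_derivative (\<lambda>y. frechet_derivative f (at y) v) (at x) u \<bullet> b"
    unfolding * by (rule second_derivative_sym_real[OF U _ x])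
      (rule smooth_on_bounded_linear[OF S bounded_linear_inner_left f])
qed

section \<open>Curvature identities in coordinates\<close>

lemma has_derivative_linear_family:
  assumes S: "derivative_domain S" "x \<in> S" and L: "\<And>y. y \<in> S \<Longrightarrow> linear (L y)"
    and L': "\<And>u. ((\<lambda>y. L y u) has_derivative (\<lambda>h. L' h u)) (at x within S)"
  shows "linear (L' h)"
proof (rule linearI)
  fix u v c
  have "((\<lambda>y. L y (u + v)) has_derivative (\<lambda>h. L' h u + L' h v)) (at x within S)"
    by (rule has_derivative_transform[OF S(2) _ has_derivative_add[OF L' L']])
      (simp add: linear_add[OF L])
  from has_derivative_within_unique[OF S L' this] show "L' h (u + v) = L' h u + L' h v"
    by (rule fun_cong)
  have "((\<lambda>y. L y (c *\<^sub>R u)) has_derivative (\<lambda>h. c *\<^sub>R L' h u)) (at x within S)"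
    by (rule has_derivative_transform[OF S(2) _ has_derivative_scaleR_right[OF L']])
      (simp add: linear_scale[OF L])
  from has_derivative_within_unique[OF S L' this] show "L' h (c *\<^sub>R u) = c *\<^sub>R L' h u"
    by (rule fun_cong)
qed

lemma bilinear_linear_right: "bilinear B \<Longrightarrow> linear (B u)"
  and bilinear_linear_left: "bilinear B \<Longrightarrow> linear (\<lambda>u. B u v)"
  by (simp_all add: bilinear_def)

lemmas bilinear_expand = bilinear_ladd bilinear_radd bilinear_lsub bilinear_rsub bilinear_lneg
  bilinear_rneg bilinear_lmul bilinear_rmul bilinear_lzero bilinear_rzero

lemma trilinear_bilinear: "trilinear F \<Longrightarrow> bilinear (F u)"
  by (simp add: trilinear_def)

lemma trilinear_linear: "trilinear F \<Longrightarrow> linear (\<lambda>u. F u v w)"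
  by (simp add: trilinear_def)

text \<open>The symmetry in the two pairs is a linear consequence of the other three: add up the four cyclic
  identities in which one of the arguments is kept last.\<close>

lemma curvature_pair_symmetry:
  fixes \<rho> :: "'a \<Rightarrow> 'a \<Rightarrow> 'a \<Rightarrow> 'a \<Rightarrow> real"
  assumes antisym: "\<And>a b c d. \<rho> a b c d = - \<rho> b a c d" and skew: "\<And>a b c d. \<rho> a b c d = - \<rho> a b d c"
    and cyclic: "\<And>a b c d. \<rho> a b c d + \<rho> b c a d + \<rho> c a b d = 0"
  shows "\<rho> a b c d = \<rho> c d a b"
  using cyclic[of a b c d] cyclic[of b c d a] cyclic[of c d a b] cyclic[of d a b c]
    antisym[of a b c d] antisym[of a b d c] antisym[of b c a d] antisym[of b c d a]
    antisym[of c a b d] antisym[of c a d b] antisym[of c d b a] antisym[of c d a b]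
    antisym[of d b c a] antisym[of d b a c] antisym[of d a b c] antisym[of d a c b]
    skew[of a b c d] skew[of b a c d] skew[of b c a d] skew[of c b a d]
    skew[of c a b d] skew[of a c b d] skew[of c d a b] skew[of d c a b]
    skew[of d a b c] skew[of a d b c] skew[of b d a c] skew[of d b a c]
  by linarith

text \<open>A Riemannian metric on an open set of \<open>'e\<close>, and the Christoffel symbols of its Levi-Civita
  connection, which are characterized by symmetry and compatibility with the metric.\<close>

locale coordinate_metric =
  fixes U :: "'e::euclidean_space set" and m :: "'e \<Rightarrow> 'e \<Rightarrow> 'e \<Rightarrow> real"
    and G :: "'e \<Rightarrow> 'e \<Rightarrow> 'e \<Rightarrow> 'e"
  assumes U: "open U"
    and m_bilinear: "x \<in> U \<Longrightarrow> bilinear (m x)"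
    and m_sym: "x \<in> U \<Longrightarrow> m x u v = m x v u"
    and m_pos: "x \<in> U \<Longrightarrow> u \<noteq> 0 \<Longrightarrow> m x u u > 0"
    and m_smooth: "smooth_on U (\<lambda>x. m x u v)"
    and G_bilinear: "x \<in> U \<Longrightarrow> bilinear (G x)"
    and G_sym: "x \<in> U \<Longrightarrow> G x u v = G x v u"
    and G_smooth: "smooth_on U (\<lambda>x. G x u v)"
    and G_compat: "x \<in> U \<Longrightarrow>
      frechet_derivative (\<lambda>y. m y v w) (at x) u = m x (G x u v) w + m x v (G x u w)"
begin

definition dG where "dG x a u v = frechet_derivative (\<lambda>y. G y u v) (at x) a"
definition ddG where "ddG x b a u v = frechet_derivative (\<lambda>y. dG y a u v) (at x) b"
definition R where "R x u v w = dG x u v w - dG x v u w + G x u (G x v w) - G x v (G x u w)"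
definition dR where "dR x a u v w = frechet_derivative (\<lambda>y. R y u v w) (at x) a"

text \<open>\<open>nablaR x a u v w\<close> is \<open>(\<nabla>\<^sub>a R)(u, v)w\<close>; the direction comes first in all of the derivatives.\<close>

definition nablaR where "nablaR x a u v w = dR x a u v w + G x a (R x u v w)
  - R x (G x a u) v w - R x u (G x a v) w - R x u v (G x a w)"

lemma dom: "derivative_domain U" by (rule derivative_domain_open[OF U])

lemma within_U: "x \<in> U \<Longrightarrow> at x within U = at x" by (rule at_within_open[OF _ U])

lemma smooth_derivative: "smooth_on U f \<Longrightarrow> smooth_on U (\<lambda>x. frechet_derivative f (at x) v)"
  and smooth_has_derivative: "smooth_on U f \<Longrightarrow> x \<in> U \<Longrightarrow> (f has_derivative frechet_derivative f (at x)) (at x)"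
  using smooth_on_open_derivative[OF U] by blast+

lemma dG_smooth: "smooth_on U (\<lambda>x. dG x a u v)"
  unfolding dG_def by (rule smooth_derivative[OF G_smooth])

lemma G_deriv: "x \<in> U \<Longrightarrow> ((\<lambda>y. G y u v) has_derivative (\<lambda>a. dG x a u v)) (at x)"
  unfolding dG_def by (rule smooth_has_derivative[OF G_smooth])

lemma dG_deriv: "x \<in> U \<Longrightarrow> ((\<lambda>y. dG y a u v) has_derivative (\<lambda>b. ddG x b a u v)) (at x)"
  unfolding ddG_def by (rule smooth_has_derivative[OF dG_smooth])

lemma dG_bilinear: "x \<in> U \<Longrightarrow> bilinear (dG x a)"
  unfolding bilinear_def
proof (intro conjI allI)
  assume x: "x \<in> U"
  show "linear (dG x a u)" for u
    by (rule has_derivative_linear_family[OF dom x, of "\<lambda>y. G y u"])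
      (auto simp: within_U x intro!: G_deriv bilinear_linear_right G_bilinear)
  show "linear (\<lambda>u. dG x a u v)" for v
    by (rule has_derivative_linear_family[OF dom x, of "\<lambda>y u. G y u v" "\<lambda>a u. dG x a u v"])
      (auto simp: within_U x intro!: G_deriv bilinear_linear_left G_bilinear)
qed

lemma dG_linear: "x \<in> U \<Longrightarrow> linear (\<lambda>a. dG x a u v)"
  by (rule has_derivative_linear[OF G_deriv])

lemma dG_sym:
  assumes x: "x \<in> U" shows "dG x a u v = dG x a v u"
proof -
  have "frechet_derivative (\<lambda>y. G y u v) (at x within U) = frechet_derivative (\<lambda>y. G y v u) (at x within U)"
    by (rule frechet_derivative_cong_within[OF G_sym x])
  then show ?thesis by (simp add: dG_def within_U x)
qed

lemma ddG_sym: "x \<in> U \<Longrightarrow> ddG x a b u v = ddG x b a u v"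
  unfolding ddG_def dG_def by (rule second_derivative_sym[OF U G_smooth])

lemmas G_expand = bilinear_expand[OF G_bilinear]
lemmas dG_expand = bilinear_expand[OF dG_bilinear] linear_add[OF dG_linear] linear_diff[OF dG_linear]
  linear_scale[OF dG_linear]
lemmas m_expand = bilinear_expand[OF m_bilinear]

lemma R_trilinear: "x \<in> U \<Longrightarrow> trilinear (R x)"
  unfolding trilinear_def bilinear_def
  by (intro conjI allI; rule linearI; simp add: R_def G_expand dG_expand algebra_simps)

lemmas R_expand = bilinear_expand[OF trilinear_bilinear[OF R_trilinear]]
  linear_add[OF trilinear_linear[OF R_trilinear]] linear_diff[OF trilinear_linear[OF R_trilinear]]
  linear_scale[OF trilinear_linear[OF R_trilinear]] linear_neg[OF trilinear_linear[OF R_trilinear]]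

lemma R_antisym: "R x u v w = - R x v u w"
  by (simp add: R_def)

lemma R_bianchi: "x \<in> U \<Longrightarrow> R x u v w + R x v w u + R x w u v = 0"
  by (simp add: R_def dG_sym[of x _ v u] dG_sym[of x _ w u] dG_sym[of x _ w v]
      G_sym[of x v u] G_sym[of x w u] G_sym[of x w v] algebra_simps)

lemma G_apply_smooth:
  "smooth_on U a \<Longrightarrow> smooth_on U (\<lambda>x. G x u (a x))"
  by (rule smooth_on_linear_apply[OF dom])
    (auto intro: bilinear_linear_right G_bilinear G_smooth)

lemma R_smooth: "smooth_on U (\<lambda>x. R x u v w)"
  unfolding R_def
  by (intro smooth_on_diff[OF dom] smooth_on_add[OF dom] G_apply_smooth dG_smooth G_smooth)

lemma R_deriv: "x \<in> U \<Longrightarrow> ((\<lambda>y. R y u v w) has_derivative (\<lambda>a. dR x a u v w)) (at x)"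
  unfolding dR_def by (rule smooth_has_derivative[OF R_smooth])

lemma dR_trilinear: 
  assumes x: "x \<in> U" shows "trilinear (dR x a)"
  unfolding trilinear_def bilinear_def
proof (intro conjI allI)
  have t: "trilinear (R y)" if "y \<in> U" for y using R_trilinear[OF that] .
  note l = t[unfolded trilinear_def bilinear_def]
  show "linear (dR x a u v)" for u v
    by (rule has_derivative_linear_family[OF dom x, of "\<lambda>y. R y u v"])
      (use l in \<open>auto simp: within_U x intro!: R_deriv\<close>)
  show "linear (\<lambda>v. dR x a u v w)" for u w
    by (rule has_derivative_linear_family[OF dom x, of "\<lambda>y v. R y u v w" "\<lambda>a v. dR x a u v w"])
      (use l in \<open>auto simp: within_U x intro!: R_deriv\<close>)
  show "linear (\<lambda>u. dR x a u v w)" for v w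
    by (rule has_derivative_linear_family[OF dom x, of "\<lambda>y u. R y u v w" "\<lambda>a u. dR x a u v w"])
      (use l in \<open>auto simp: within_U x intro!: R_deriv\<close>)
qed

lemma G_apply_deriv:
  assumes x: "x \<in> U" and a: "(a has_derivative a') (at x)"
  shows "((\<lambda>y. G y u (a y)) has_derivative (\<lambda>h. dG x h u (a x) + G x u (a' h))) (at x)"
  using has_derivative_linear_apply[OF dom x, of "\<lambda>y. G y u" "\<lambda>h. dG x h u" a a']
  by (simp add: within_U x a G_deriv bilinear_linear_right G_bilinear)

lemma dR_eq:
  assumes x: "x \<in> U"
  shows "dR x a u v w = ddG x a u v w - ddG x a v u w + (dG x a u (G x v w) + G x u (dG x a v w))
     - (dG x a v (G x u w) + G x v (dG x a u w))"
proof -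
  have "((\<lambda>y. R y u v w) has_derivative (\<lambda>a. ddG x a u v w - ddG x a v u w
      + (dG x a u (G x v w) + G x u (dG x a v w)) - (dG x a v (G x u w) + G x v (dG x a u w)))) (at x)"
    unfolding R_def
    by (intro has_derivative_diff has_derivative_add dG_deriv G_apply_deriv G_deriv x)
  from has_derivative_unique[OF R_deriv[OF x] this] show ?thesis by (rule fun_cong)
qed

text \<open>All terms without second derivatives of the Christoffel symbols cancel, and those with second
  derivatives cancel because second derivatives are symmetric.\<close>

lemma nablaR_bianchi2:
  assumes x: "x \<in> U"
  shows "nablaR x a u v w + nablaR x u v a w + nablaR x v a u w = 0"
  using x unfolding nablaR_def dR_eq[OF x]
  by (simp add: R_def G_expand dG_expand ddG_sym[of x u a] ddG_sym[of x v a] ddG_sym[of x v u]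
      G_sym[of x u a] G_sym[of x v a] G_sym[of x v u] algebra_simps)

lemma dR_antisym:
  assumes x: "x \<in> U" shows "dR x a u v w = - dR x a v u w"
  unfolding dR_eq[OF x] by simp

lemma dR_bianchi:
  assumes x: "x \<in> U" shows "dR x a u v w + dR x a v w u + dR x a w u v = 0"
proof -
  have "((\<lambda>y. R y u v w + R y v w u + R y w u v) has_derivative
      (\<lambda>a. dR x a u v w + dR x a v w u + dR x a w u v)) (at x)"
    by (intro has_derivative_add R_deriv x)
  then have "((\<lambda>y. 0) has_derivative (\<lambda>a. dR x a u v w + dR x a v w u + dR x a w u v)) (at x)"
    by (rule has_derivative_transform_within_open[OF _ U x]) (simp add: R_bianchi)
  from has_derivative_unique[OF this has_derivative_const] show ?thesis by (rule fun_cong)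
qed

lemma nablaR_antisym: "x \<in> U \<Longrightarrow> nablaR x a u v w = - nablaR x a v u w"
  unfolding nablaR_def
  by (simp add: dR_antisym[of x a u v] R_antisym[of x u v] R_antisym[of x u "G x a v"]
      R_antisym[of x "G x a u" v] G_expand)

lemma nablaR_bianchi:
  assumes x: "x \<in> U" shows "nablaR x a u v w + nablaR x a v w u + nablaR x a w u v = 0"
proof -
  have "nablaR x a u v w + nablaR x a v w u + nablaR x a w u v =
      (dR x a u v w + dR x a v w u + dR x a w u v)
    + G x a (R x u v w + R x v w u + R x w u v)
    - (R x (G x a u) v w + R x v w (G x a u) + R x w (G x a u) v)
    - (R x u (G x a v) w + R x (G x a v) w u + R x w u (G x a v))
    - (R x u v (G x a w) + R x v (G x a w) u + R x (G x a w) u v)"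
    by (simp add: nablaR_def G_expand x)
  then show ?thesis by (simp only: dR_bianchi[OF x] R_bianchi[OF x]) (simp add: G_expand x)
qed

lemma m_apply_deriv:
  assumes x: "x \<in> U" and a: "(a has_derivative a') (at x)" and b: "(b has_derivative b') (at x)"
  shows "((\<lambda>y. m y (a y) (b y)) has_derivative
    (\<lambda>h. m x (a' h + G x h (a x)) (b x) + m x (a x) (b' h + G x h (b x)))) (at x)"
proof -
  have "((\<lambda>y. m y u v) has_derivative (\<lambda>h. m x (G x h u) v + m x u (G x h v))) (at x)" for u v
    using smooth_has_derivative[OF m_smooth x, of u v] by (simp add: G_compat[OF x, symmetric])
  then have "((\<lambda>y. m y (a y) (b y)) has_derivative
    (\<lambda>h. (m x (G x h (a x)) (b x) + m x (a x) (G x h (b x))) + m x (a' h) (b x) + m x (a x) (b' h))) (at x)"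
    using has_derivative_bilinear_apply[OF dom x, of m "\<lambda>h u v. m x (G x h u) v + m x u (G x h v)" a a' b b'] a b
    by (simp add: within_U x m_bilinear)
  then show ?thesis by (simp add: m_expand x algebra_simps)
qed

text \<open>Compatibility expresses the second derivatives of \<open>m\<close> by Christoffel symbols and their
  derivatives; its antisymmetric part, which is zero, is \<open>m(R(u, v)w, z) + m(w, R(u, v)z)\<close>.\<close>

lemma R_skew:
  assumes x: "x \<in> U" shows "m x (R x u v w) z = - m x (R x u v z) w"
proof -
  have *: "frechet_derivative (\<lambda>y. frechet_derivative (\<lambda>y. m y w z) (at y) v) (at x) u =
      m x (dG x u v w + G x u (G x v w)) z + m x (G x v w) (G x u z) +
      (m x (G x u w) (G x v z) + m x w (dG x u v z + G x u (G x v z)))" for u v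
  proof -
    have "((\<lambda>y. m y (G y v w) z + m y w (G y v z)) has_derivative
      (\<lambda>h. (m x (dG x h v w + G x h (G x v w)) z + m x (G x v w) (0 + G x h z)) +
       (m x (0 + G x h w) (G x v z) + m x w (dG x h v z + G x h (G x v z))))) (at x)"
      by (intro has_derivative_add m_apply_deriv x G_deriv has_derivative_const)
    then have "((\<lambda>y. frechet_derivative (\<lambda>y. m y w z) (at y) v) has_derivative
      (\<lambda>h. (m x (dG x h v w + G x h (G x v w)) z + m x (G x v w) (0 + G x h z)) +
       (m x (0 + G x h w) (G x v z) + m x w (dG x h v z + G x h (G x v z))))) (at x)"
      by (rule has_derivative_transform_within_open[OF _ U x]) (simp add: G_compat)
    from fun_cong[OF frechet_derivative_at[OF this], of u] show ?thesis by (simp only: add_0)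
  qed
  have "m x (R x u v w) z + m x (R x u v z) w = 0"
    using second_derivative_sym[OF U m_smooth x, of w z v u] unfolding *
    by (simp add: R_def m_expand x m_sym[OF x, of w] m_sym[OF x, of "G x u w"]
        m_sym[OF x, of "G x v w"] algebra_simps)
  then show ?thesis by simp
qed

lemma nablaR_skew:
  assumes x: "x \<in> U" shows "m x (nablaR x a u v w) z = - m x (nablaR x a u v z) w"
proof -
  have "((\<lambda>y. m y (R y u v w) z + m y (R y u v z) w) has_derivative
    (\<lambda>h. (m x (dR x h u v w + G x h (R x u v w)) z + m x (R x u v w) (0 + G x h z)) +
       (m x (dR x h u v z + G x h (R x u v z)) w + m x (R x u v z) (0 + G x h w)))) (at x)"
    by (intro has_derivative_add m_apply_deriv x R_deriv has_derivative_const)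
  then have "((\<lambda>y. 0::real) has_derivative
    (\<lambda>h. (m x (dR x h u v w + G x h (R x u v w)) z + m x (R x u v w) (0 + G x h z)) +
       (m x (dR x h u v z + G x h (R x u v z)) w + m x (R x u v z) (0 + G x h w)))) (at x)"
    by (rule has_derivative_transform_within_open[OF _ U x]) (simp add: R_skew[of _ u v w z])
  from fun_cong[OF has_derivative_unique[OF this has_derivative_const], of a]
  show ?thesis
    using R_skew[OF x, of "G x a u" v w z] R_skew[OF x, of u "G x a v" w z]
      R_skew[OF x, of u v "G x a w" z] R_skew[OF x, of u v "G x a z" w]
    by (simp add: nablaR_def m_expand x)
qed

end

section \<open>The bi-Jacobi operator along a curve in coordinates\<close>

lemma has_vector_derivative_within_unique:
  assumes "derivative_domain S" "t \<in> S"
    "(f has_vector_derivative f') (at t within S)" "(f has_vector_derivative f'') (at t within S)"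
  shows "f' = f''"
  using fun_cong[OF has_derivative_within_unique[OF assms(1,2)
      assms(3,4)[unfolded has_vector_derivative_def]], of 1] by simp

lemma vector_derivative_eqI:
  assumes "derivative_domain S" "t \<in> S" "(f has_vector_derivative f') (at t within S)"
  shows "vector_derivative f (at t within S) = f'"
  using has_vector_derivative_within_unique[OF assms(1,2) _ assms(3)] assms(3)
  by (metis differentiableI_vector vector_derivative_works)

lemma smooth_on_vector_derivative:
  assumes S: "derivative_domain S" and f: "smooth_on S f"
  shows "t \<in> S \<Longrightarrow> (f has_vector_derivative vector_derivative f (at t within S)) (at t within S)"
    and "smooth_on S (\<lambda>t. vector_derivative f (at t within S))"
proof -
  show d: "(f has_vector_derivative vector_derivative f (at t within S)) (at t within S)" if "t \<in> S" for t
    using smooth_on_has_derivative[OF S f that] differentiableI vector_derivative_works by blast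
  have "frechet_derivative f (at t within S) 1 = vector_derivative f (at t within S)" if "t \<in> S" for t
    using frechet_derivative_eqI[OF S that d[OF that, unfolded has_vector_derivative_def]] by simp
  then show "smooth_on S (\<lambda>t. vector_derivative f (at t within S))"
    using smooth_on_frechet_derivative[OF S f, of 1] smooth_on_cong[OF S] by (metis (no_types, lifting))
qed

lemma smooth_on_bilinear_apply:
  fixes a :: "'a::euclidean_space \<Rightarrow> 'c::euclidean_space" and b :: "'a \<Rightarrow> 'd::euclidean_space"
  assumes S: "derivative_domain S" and B: "\<And>t. t \<in> S \<Longrightarrow> bilinear (B t)"
    and sm: "\<And>u v. smooth_on S (\<lambda>t. B t u v)" "smooth_on S a" "smooth_on S b"
  shows "smooth_on S (\<lambda>t. B t (a t) (b t))"
proof -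
  have *: "smooth_on S (\<lambda>t. B t (a t) v)" for v
    by (rule smooth_on_linear_apply[OF S _ sm(1,2)]) (rule bilinear_linear_left[OF B])
  show ?thesis
    by (rule smooth_on_linear_apply[where L = "\<lambda>t. B t (a t)", OF S _ * sm(3)])
      (rule bilinear_linear_right[OF B])
qed

lemma smooth_on_trilinear_apply:
  fixes a b c :: "'a::euclidean_space \<Rightarrow> 'c::euclidean_space"
  assumes S: "derivative_domain S" and B: "\<And>t. t \<in> S \<Longrightarrow> trilinear (B t)"
    and sm: "\<And>u v w. smooth_on S (\<lambda>t. B t u v w)" "smooth_on S a" "smooth_on S b" "smooth_on S c"
  shows "smooth_on S (\<lambda>t. B t (a t) (b t) (c t))"
proof -
  have *: "smooth_on S (\<lambda>t. B t (a t) v w)" for v w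
    by (rule smooth_on_linear_apply[OF S _ sm(1,2)]) (rule trilinear_linear[OF B])
  show ?thesis
    by (rule smooth_on_bilinear_apply[where B = "\<lambda>t. B t (a t)", OF S _ * sm(3,4)])
      (rule trilinear_bilinear[OF B])
qed

lemma (in coordinate_metric) nablaR_trilinear:
  assumes x: "x \<in> U" shows "trilinear (nablaR x a)"
  unfolding trilinear_def bilinear_def
  using x bilinear_expand[OF trilinear_bilinear[OF dR_trilinear[OF x]]]
    linear_add[OF trilinear_linear[OF dR_trilinear[OF x]]]
    linear_scale[OF trilinear_linear[OF dR_trilinear[OF x]]]
  by (intro conjI allI; intro linearI; simp add: nablaR_def G_expand R_expand algebra_simps)

lemma (in coordinate_metric) nablaR_linear:
  assumes x: "x \<in> U" shows "linear (\<lambda>a. nablaR x a u v w)"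
  using x linear_add[OF has_derivative_linear[OF R_deriv[OF x]]]
    linear_scale[OF has_derivative_linear[OF R_deriv[OF x]]]
  by (intro linearI; simp add: nablaR_def G_expand R_expand algebra_simps)

lemma (in coordinate_metric) nablaR_smooth: "smooth_on U (\<lambda>x. nablaR x a u v w)"
proof -
  note R = smooth_on_trilinear_apply[where B = R, OF dom R_trilinear R_smooth]
  show ?thesis
    unfolding nablaR_def dR_def
    by (intro smooth_on_diff[OF dom] smooth_on_add[OF dom] G_apply_smooth R smooth_derivative[OF R_smooth]
        R_smooth G_smooth smooth_on_const[OF dom])
qed

context coordinate_metric
begin

lemma R4_antisym: "x \<in> U \<Longrightarrow> m x (R x a b c) d = - m x (R x b a c) d"
  by (subst R_antisym) (simp add: m_expand)

lemma R4_bianchi: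
  assumes x: "x \<in> U" shows "m x (R x a b c) d + m x (R x b c a) d + m x (R x c a b) d = 0"
  using bilinear_ladd[OF m_bilinear[OF x], of "R x a b c + R x b c a" "R x c a b" d] R_bianchi[OF x, of a b c]
  by (simp add: m_expand x)

lemma R4_pair: "x \<in> U \<Longrightarrow> m x (R x a b c) d = m x (R x c d a) b"
  by (rule curvature_pair_symmetry[where \<rho> = "\<lambda>a b c d. m x (R x a b c) d"])
    (erule R4_antisym R_skew R4_bianchi)+

lemma nablaR4_antisym: "x \<in> U \<Longrightarrow> m x (nablaR x e a b c) d = - m x (nablaR x e b a c) d"
  by (subst nablaR_antisym) (simp_all add: m_expand)

lemma nablaR4_bianchi:
  assumes x: "x \<in> U" shows "m x (nablaR x e a b c) d + m x (nablaR x e b c a) d + m x (nablaR x e c a b) d = 0"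
  using bilinear_ladd[OF m_bilinear[OF x], of "nablaR x e a b c + nablaR x e b c a" "nablaR x e c a b" d]
    nablaR_bianchi[OF x, of e a b c]
  by (simp add: m_expand x)

lemma nablaR4_pair: "x \<in> U \<Longrightarrow> m x (nablaR x e a b c) d = m x (nablaR x e c d a) b"
  by (rule curvature_pair_symmetry[where \<rho> = "\<lambda>a b c d. m x (nablaR x e a b c) d"])
    (erule nablaR4_antisym nablaR_skew nablaR4_bianchi)+

lemma nablaR4_bianchi2:
  assumes x: "x \<in> U"
  shows "m x (nablaR x a u v w) d + m x (nablaR x u v a w) d + m x (nablaR x v a u w) d = 0"
  using bilinear_ladd[OF m_bilinear[OF x], of "nablaR x a u v w + nablaR x u v a w" "nablaR x v a u w" d]
    nablaR_bianchi2[OF x, of a u v w]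
  by (simp add: m_expand x)

end

text \<open>A curve in coordinates. The parameter set \<open>S\<close> is meant to be the set of times that the curve
  spends in one chart; derivatives are one-sided at end points of the time interval.\<close>

locale coordinate_curve = coordinate_metric U m G
  for U :: "'e::euclidean_space set" and m G +
  fixes S :: "real set" and p :: "real \<Rightarrow> 'e"
  assumes S: "derivative_domain S" and p_smooth: "smooth_on S p" and p_in_U: "t \<in> S \<Longrightarrow> p t \<in> U"
begin

definition y where "y t = vector_derivative p (at t within S)"

definition D where "D x t = vector_derivative x (at t within S) + G (p t) (y t) (x t)"

text \<open>The covariant derivative along the curve of a tensor of the type of the curvature.\<close>

definition tensor_D where "tensor_D T t u v w = D (\<lambda>s. T s u v w) t
  - T t (G (p t) (y t) u) v w - T t u (G (p t) (y t) v) w - T t u v (G (p t) (y t) w)"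

lemma p_deriv: "t \<in> S \<Longrightarrow> (p has_vector_derivative y t) (at t within S)"
  unfolding y_def by (rule smooth_on_vector_derivative(1)[OF S p_smooth])

lemma y_smooth: "smooth_on S y"
  unfolding y_def by (rule smooth_on_vector_derivative(2)[OF S p_smooth])

lemma along_smooth: "smooth_on U f \<Longrightarrow> smooth_on S (\<lambda>t. f (p t))"
  using p_in_U by (intro smooth_on_compose[OF S _ p_smooth]) auto

lemma along_deriv:
  assumes t: "t \<in> S" and f: "(f has_derivative f') (at (p t))"
  shows "((\<lambda>t. f (p t)) has_derivative (\<lambda>h. h *\<^sub>R f' (y t))) (at t within S)"
proof -
  interpret linear f' using f by (rule has_derivative_linear)
  show ?thesis
    using has_derivative_compose[OF p_deriv[OF t, unfolded has_vector_derivative_def] f]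
    by (simp add: scale)
qed

lemma G_along_smooth: "smooth_on S a \<Longrightarrow> smooth_on S b \<Longrightarrow> smooth_on S (\<lambda>t. G (p t) (a t) (b t))"
  by (rule smooth_on_bilinear_apply[where B = "\<lambda>t. G (p t)", OF S _ along_smooth[OF G_smooth]])
    (rule G_bilinear[OF p_in_U])

lemma R_along_smooth:
  "smooth_on S a \<Longrightarrow> smooth_on S b \<Longrightarrow> smooth_on S c \<Longrightarrow> smooth_on S (\<lambda>t. R (p t) (a t) (b t) (c t))"
  by (rule smooth_on_trilinear_apply[where B = "\<lambda>t. R (p t)", OF S _ along_smooth[OF R_smooth]])
    (rule R_trilinear[OF p_in_U])

lemma nablaR_along_smooth:
  assumes "smooth_on S e" "smooth_on S a" "smooth_on S b" "smooth_on S c"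
  shows "smooth_on S (\<lambda>t. nablaR (p t) (e t) (a t) (b t) (c t))"
proof -
  have *: "smooth_on S (\<lambda>t. nablaR (p t) (e t) u v w)" for u v w
    by (rule smooth_on_linear_apply[where L = "\<lambda>t e. nablaR (p t) e u v w",
          OF S _ along_smooth[OF nablaR_smooth] assms(1)]) (rule nablaR_linear[OF p_in_U])
  show ?thesis
    by (rule smooth_on_trilinear_apply[where B = "\<lambda>t. nablaR (p t) (e t)", OF S _ * assms(2-4)])
      (rule nablaR_trilinear[OF p_in_U])
qed

lemma D_smooth: "smooth_on S x \<Longrightarrow> smooth_on S (D x)"
  unfolding D_def
  by (intro smooth_on_add[OF S] smooth_on_vector_derivative(2)[OF S] G_along_smooth y_smooth)

lemma D_eqI:
  assumes "t \<in> S" "(x has_vector_derivative x') (at t within S)"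
  shows "D x t = x' + G (p t) (y t) (x t)"
  unfolding D_def vector_derivative_eqI[OF S assms] ..

lemma D_deriv: "smooth_on S x \<Longrightarrow> t \<in> S \<Longrightarrow>
    (x has_vector_derivative D x t - G (p t) (y t) (x t)) (at t within S)"
  using smooth_on_vector_derivative(1)[OF S] by (simp add: D_def)

lemma D_add:
  assumes "smooth_on S a" "smooth_on S b" "t \<in> S"
  shows "D (\<lambda>t. a t + b t) t = D a t + D b t"
  using D_eqI[OF assms(3) has_vector_derivative_add[OF D_deriv[OF assms(1,3)] D_deriv[OF assms(2,3)]]]
  by (simp add: G_expand p_in_U assms(3))

lemma D_const: "t \<in> S \<Longrightarrow> D (\<lambda>_. u) t = G (p t) (y t) u"
  using D_eqI[OF _ has_vector_derivative_const] by simp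

lemma D_cong:
  assumes "\<And>t. t \<in> S \<Longrightarrow> a t = b t" "t \<in> S" shows "D a t = D b t"
proof -
  have "(a has_vector_derivative a') (at t within S) \<longleftrightarrow> (b has_vector_derivative a') (at t within S)" for a'
    using assms by (metis has_vector_derivative_transform)
  then show ?thesis using assms by (simp add: D_def vector_derivative_def)
qed

lemma m_along_deriv:
  assumes a: "smooth_on S a" and b: "smooth_on S b" and t: "t \<in> S"
  shows "((\<lambda>t. m (p t) (a t) (b t)) has_vector_derivative
    m (p t) (D a t) (b t) + m (p t) (a t) (D b t)) (at t within S)"
proof -
  have "((\<lambda>x. m x u v) has_derivative (\<lambda>h. m (p t) (G (p t) h u) v + m (p t) u (G (p t) h v))) (at (p t))"
    for u v
    using m_apply_deriv[OF p_in_U[OF t] has_derivative_const has_derivative_const] by simp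
  from has_derivative_bilinear_apply[OF S t m_bilinear[OF p_in_U] along_deriv[OF t this]
      D_deriv[OF a t, unfolded has_vector_derivative_def] D_deriv[OF b t, unfolded has_vector_derivative_def]]
  show ?thesis
    by (simp add: has_vector_derivative_def m_expand p_in_U t algebra_simps)
qed

lemma tensor_D_product:
  assumes T: "\<And>t. t \<in> S \<Longrightarrow> trilinear (T t)" "\<And>u v w. smooth_on S (\<lambda>t. T t u v w)"
    and a: "smooth_on S a" and b: "smooth_on S b" and c: "smooth_on S c" and t: "t \<in> S"
  shows "D (\<lambda>t. T t (a t) (b t) (c t)) t = tensor_D T t (a t) (b t) (c t)
    + T t (D a t) (b t) (c t) + T t (a t) (D b t) (c t) + T t (a t) (b t) (D c t)"
proof -
  let ?v = "\<lambda>u v w. vector_derivative (\<lambda>t. T t u v w) (at t within S)"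
  note l = bilinear_expand[OF trilinear_bilinear[OF T(1)[OF t]]]
    linear_add[OF trilinear_linear[OF T(1)[OF t]]] linear_diff[OF trilinear_linear[OF T(1)[OF t]]]
    linear_scale[OF trilinear_linear[OF T(1)[OF t]]]
  have "((\<lambda>t. T t u v w) has_derivative (\<lambda>h. h *\<^sub>R ?v u v w)) (at t within S)" for u v w
    using smooth_on_vector_derivative(1)[OF S T(2) t] by (simp add: has_vector_derivative_def)
  from has_derivative_trilinear_apply[OF S t T(1) this
      D_deriv[OF a t, unfolded has_vector_derivative_def] D_deriv[OF b t, unfolded has_vector_derivative_def]
      D_deriv[OF c t, unfolded has_vector_derivative_def]]
  have "((\<lambda>t. T t (a t) (b t) (c t)) has_vector_derivative ?v (a t) (b t) (c t)
      + T t (D a t - G (p t) (y t) (a t)) (b t) (c t) + T t (a t) (D b t - G (p t) (y t) (b t)) (c t)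
      + T t (a t) (b t) (D c t - G (p t) (y t) (c t))) (at t within S)"
    by (simp add: has_vector_derivative_def l scaleR_add_right)
  from D_eqI[OF t this] show ?thesis
    unfolding tensor_D_def D_def[of "\<lambda>s. T s _ _ _"] by (simp add: l)
qed

lemma tensor_D_R:
  assumes t: "t \<in> S" shows "tensor_D (\<lambda>t. R (p t)) t u v w = nablaR (p t) (y t) u v w"
proof -
  have "((\<lambda>t. R (p t) u v w) has_vector_derivative dR (p t) (y t) u v w) (at t within S)"
    using along_deriv[OF t R_deriv[OF p_in_U[OF t]]] by (simp add: has_vector_derivative_def)
  from D_eqI[OF t this] show ?thesis by (simp add: tensor_D_def nablaR_def)
qed

lemma D_R:
  assumes "smooth_on S a" "smooth_on S b" "smooth_on S c" and t: "t \<in> S"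
  shows "D (\<lambda>t. R (p t) (a t) (b t) (c t)) t = nablaR (p t) (y t) (a t) (b t) (c t)
    + R (p t) (D a t) (b t) (c t) + R (p t) (a t) (D b t) (c t) + R (p t) (a t) (b t) (D c t)"
  using tensor_D_product[of "\<lambda>t. R (p t)", OF R_trilinear[OF p_in_U] along_smooth[OF R_smooth] assms]
  by (simp add: tensor_D_R t)

definition R2 where "R2 = tensor_D (tensor_D (\<lambda>t. R (p t)))"

lemma tensor_D_cong:
  assumes "\<And>t. t \<in> S \<Longrightarrow> T t = T' t" "t \<in> S" shows "tensor_D T t = tensor_D T' t"
  unfolding tensor_D_def[abs_def] using assms(1)[OF assms(2)]
  by (intro ext) (simp add: D_cong[OF _ assms(2), of "\<lambda>s. T s _ _ _" "\<lambda>s. T' s _ _ _"] assms(1))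

lemma D_nablaR:
  assumes "smooth_on S a" "smooth_on S b" "smooth_on S c" and t: "t \<in> S"
  shows "D (\<lambda>t. nablaR (p t) (y t) (a t) (b t) (c t)) t = R2 t (a t) (b t) (c t)
    + nablaR (p t) (y t) (D a t) (b t) (c t) + nablaR (p t) (y t) (a t) (D b t) (c t)
    + nablaR (p t) (y t) (a t) (b t) (D c t)"
proof -
  have "R2 t = tensor_D (\<lambda>t. nablaR (p t) (y t)) t"
    unfolding R2_def by (rule tensor_D_cong[OF _ t]) (intro ext, rule tensor_D_R)
  then show ?thesis
    using tensor_D_product[of "\<lambda>t. nablaR (p t) (y t)", OF nablaR_trilinear[OF p_in_U]
        nablaR_along_smooth[OF y_smooth smooth_on_const[OF S] smooth_on_const[OF S] smooth_on_const[OF S]]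
        assms] by simp
qed

abbreviation y1 where "y1 \<equiv> D y"
abbreviation y2 where "y2 \<equiv> D (D y)"

text \<open>The expression \<open>F(X, q')\<close> in coordinates.\<close>

definition bi_jacobi_terms where "bi_jacobi_terms x t =
  R2 t (x t) (y t) (y t) + nablaR (p t) (x t) (y1 t) (y t) (y t) + R (p t) (R (p t) (x t) (y t) (y t)) (y t) (y t)
  + R (p t) (x t) (y2 t) (y t)
  + 2 *\<^sub>R (nablaR (p t) (y t) (D x t) (y t) (y t) + nablaR (p t) (y t) (x t) (y1 t) (y t) + R (p t) (D (D x) t) (y t) (y t))
  + 3 *\<^sub>R (nablaR (p t) (y t) (x t) (y t) (y1 t) + R (p t) (x t) (y t) (y2 t) + R (p t) (x t) (y1 t) (y1 t))
  + 4 *\<^sub>R R (p t) (D x t) (y t) (y1 t)"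

text \<open>If a family of curves varies with velocity \<open>x\<close>, then \<open>accel_var x\<close> and \<open>jerk_var x\<close> are the
  covariant derivatives of \<open>y1\<close> and \<open>y2\<close> in the direction of the variation: commuting the two
  covariant derivatives produces the curvature terms.\<close>

definition accel_var where "accel_var x t = D (D x) t + R (p t) (x t) (y t) (y t)"
definition jerk_var where "jerk_var x t = D (accel_var x) t + R (p t) (x t) (y t) (y1 t)"

lemma accel_var_smooth: "smooth_on S x \<Longrightarrow> smooth_on S (accel_var x)"
  unfolding accel_var_def by (intro smooth_on_add[OF S] D_smooth R_along_smooth y_smooth)

lemma jerk_var_smooth: "smooth_on S x \<Longrightarrow> smooth_on S (jerk_var x)"
  unfolding jerk_var_def by (intro smooth_on_add[OF S] D_smooth accel_var_smooth R_along_smooth y_smooth)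

text \<open>Expanding the right hand side with the product rule gives every term of \<open>F\<close>; the terms that contain
  \<open>y1\<close> and the first derivative of \<open>x\<close> match after an application of the first Bianchi identity. In
  this form the highest derivatives can be moved to the other factor by partial integration.\<close>

lemma operator_factorization:
  assumes x: "smooth_on S x" and t: "t \<in> S"
  shows "D (D (D (D x))) t + bi_jacobi_terms x t = D (jerk_var x) t + R (p t) (accel_var x t) (y t) (y t)
    + R (p t) (x t) (y t) (y2 t) + nablaR (p t) (x t) (y1 t) (y t) (y t)
    + R (p t) (y1 t) (D x t) (y t) + R (p t) (y1 t) (y t) (D x t)"
proof -
  note sm = x D_smooth[OF x] D_smooth[OF D_smooth[OF x]] D_smooth[OF D_smooth[OF D_smooth[OF x]]]
    y_smooth D_smooth[OF y_smooth] D_smooth[OF D_smooth[OF y_smooth]]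
  note yy = y_smooth D_smooth[OF y_smooth] D_smooth[OF D_smooth[OF y_smooth]]
  have DU: "D (accel_var x) t = D (D (D x)) t + (nablaR (p t) (y t) (x t) (y t) (y t)
     + R (p t) (D x t) (y t) (y t) + R (p t) (x t) (y1 t) (y t) + R (p t) (x t) (y t) (y1 t))"
    if t: "t \<in> S" for t
    unfolding accel_var_def
    by (simp only: D_add[OF sm(3) R_along_smooth[OF sm(1) yy(1,1)] t] D_R[OF sm(1) yy(1,1) t])
  note Rs = R_along_smooth and Ns = nablaR_along_smooth[OF y_smooth]
  have "D (D (accel_var x)) t = D (\<lambda>t. D (D (D x)) t + (nablaR (p t) (y t) (x t) (y t) (y t)
     + R (p t) (D x t) (y t) (y t) + R (p t) (x t) (y1 t) (y t) + R (p t) (x t) (y t) (y1 t))) t"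
    by (rule D_cong[OF DU t])
  also have "\<dots> = D (D (D (D x))) t + (D (\<lambda>t. nablaR (p t) (y t) (x t) (y t) (y t)) t
     + D (\<lambda>t. R (p t) (D x t) (y t) (y t)) t + D (\<lambda>t. R (p t) (x t) (y1 t) (y t)) t
     + D (\<lambda>t. R (p t) (x t) (y t) (y1 t)) t)"
    by (simp only: D_add t sm Rs Ns smooth_on_add[OF S])
  finally have DDU: "D (D (accel_var x)) t = \<dots>" .
  have "D (jerk_var x) t = D (D (accel_var x)) t + D (\<lambda>t. R (p t) (x t) (y t) (y1 t)) t"
    unfolding jerk_var_def by (simp only: D_add t sm Rs D_smooth accel_var_smooth)
  then have "D (jerk_var x) t = D (D (D (D x))) t + (D (\<lambda>t. nablaR (p t) (y t) (x t) (y t) (y t)) t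
     + D (\<lambda>t. R (p t) (D x t) (y t) (y t)) t + D (\<lambda>t. R (p t) (x t) (y1 t) (y t)) t
     + D (\<lambda>t. R (p t) (x t) (y t) (y1 t)) t) + D (\<lambda>t. R (p t) (x t) (y t) (y1 t)) t"
    unfolding DDU .
  moreover have "R (p t) (y1 t) (D x t) (y t) + R (p t) (y1 t) (y t) (D x t) =
      R (p t) (D x t) (y t) (y1 t) - R (p t) (D x t) (y1 t) (y t) - R (p t) (D x t) (y1 t) (y t)"
  proof -
    have "a + b = c - (- b) - (- b)" if "c + - a + b = 0" for a b c :: 'e
      using that by (simp add: algebra_simps eq_neg_iff_add_eq_0)
    from this[of "R (p t) (D x t) (y t) (y1 t)" "R (p t) (y1 t) (y t) (D x t)" "R (p t) (y1 t) (D x t) (y t)"]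
    show ?thesis
      using R_bianchi[OF p_in_U[OF t], of "D x t" "y t" "y1 t"]
      by (simp add: R_antisym[of "p t" "y t" "y1 t" "D x t"] R_antisym[of "p t" "D x t" "y1 t" "y t"] add.commute)
  qed
  moreover have "3 *\<^sub>R v = v + (v + v)" "4 *\<^sub>R v = v + (v + (v + v))" for v :: 'e
    using scaleR_add_left[of 1 2 v] scaleR_add_left[of 2 2 v] by (simp_all add: scaleR_2)
  ultimately show ?thesis
    unfolding bi_jacobi_terms_def accel_var_def[of x t]
    by (simp add: D_R D_nablaR sm t R_expand p_in_U scaleR_2 algebra_simps)
qed

text \<open>The second variation of the energy as a form in the 2-jets \<open>(a0, a1, a2)\<close>, \<open>(b0, b1, b2)\<close> of two
  fields, where \<open>a1\<close> and \<open>a2\<close> stand for covariant derivatives; \<open>H\<close> is the Hessian of the potential.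
  The last bracket is half of the derivative of \<open>m(R(y1, y)a0, b0)\<close>. It comes from the last term of
  \<open>boundary_form\<close>, which is there because without it the form would not be symmetric.\<close>

definition index_form :: "(real \<Rightarrow> 'e \<Rightarrow> 'e) \<Rightarrow> real \<Rightarrow> 'e \<Rightarrow> 'e \<Rightarrow> 'e \<Rightarrow> 'e \<Rightarrow> 'e \<Rightarrow> 'e \<Rightarrow> real" where
  "index_form H t a0 a1 a2 b0 b1 b2 =
     m (p t) (a2 + R (p t) a0 (y t) (y t)) (b2 + R (p t) b0 (y t) (y t))
   - m (p t) (R (p t) a0 (y t) (y1 t)) b1
   + m (p t) (R (p t) a0 (y t) (y2 t)) b0
   + m (p t) (nablaR (p t) a0 (y1 t) (y t) (y t)) b0
   + m (p t) (R (p t) (y1 t) a1 (y t)) b0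
   + m (p t) (R (p t) (y1 t) (y t) a1) b0
   + m (p t) (H t a0) b0
   - (m (p t) (nablaR (p t) (y t) (y1 t) (y t) a0) b0 + m (p t) (R (p t) (y2 t) (y t) a0) b0
      + m (p t) (R (p t) (y1 t) (y t) a1) b0 + m (p t) (R (p t) (y1 t) (y t) a0) b1) / 2"

definition boundary_form where "boundary_form x z t = m (p t) (jerk_var x t) (z t) - m (p t) (accel_var x t) (D z t)
  + m (p t) (R (p t) (y1 t) (y t) (x t)) (z t) / 2"

text \<open>The squares and the Hessian are symmetric. The remaining terms are grouped by the
  derivatives that they contain; the groups are symmetric by the pair symmetry of \<open>R\<close> (terms in \<open>a0, b1\<close>),
  by skewness (the half terms), by the first Bianchi identity (terms with \<open>y2\<close>) and by the second
  Bianchi identity (terms with \<open>\<nabla>R\<close>).\<close>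

lemma index_form_sym:
  assumes t: "t \<in> S" and H: "\<And>u w. m (p t) (H t u) w = m (p t) (H t w) u"
  shows "index_form H t a0 a1 a2 b0 b1 b2 = index_form H t b0 b1 b2 a0 a1 a2"
proof -
  note x = p_in_U[OF t]
  note R4 = R4_pair[OF x] R4_antisym[OF x] R_skew[OF x]
  let ?r = "\<lambda>a b c d. m (p t) (R (p t) a b c) d"
  let ?n = "\<lambda>e a b c d. m (p t) (nablaR (p t) e a b c) d"
  let ?y = "y t" and ?z = "y1 t" and ?w = "y2 t"
  have first: "?r a0 ?y ?z b1 = - ?r ?z b1 ?y a0" for a0 b1
    using R4_pair[OF x, of a0 ?y ?z b1] R_skew[OF x, of ?z b1 a0 ?y] by linarith
  have second: "?r ?z ?y b a = - ?r ?z ?y a b" for a b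
    by (rule R_skew[OF x])
  have third: "?r a0 ?y ?w b0 - ?r b0 ?y ?w a0 = ?r ?w ?y a0 b0" "?r ?w ?y b0 a0 = - ?r ?w ?y a0 b0"
    using R4_pair[OF x, of b0 ?y ?w a0] R_skew[OF x, of ?w a0 b0 ?y] R4_antisym[OF x, of ?w ?y a0 b0]
      R4_bianchi[OF x, of a0 ?y ?w b0] R_skew[OF x, of ?w ?y a0 b0] by linarith+
  have fourth: "?n a0 ?z ?y ?y b0 - ?n b0 ?z ?y ?y a0 = ?n ?y ?z ?y a0 b0"
      "?n ?y ?z ?y b0 a0 = - ?n ?y ?z ?y a0 b0"
    using nablaR4_pair[OF x, of a0 ?z ?y ?y b0] nablaR4_pair[OF x, of b0 ?z ?y ?y a0]
      nablaR4_antisym[OF x, of b0 ?y a0 ?z ?y] nablaR4_bianchi2[OF x, of a0 ?y b0 ?z ?y]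
      nablaR4_pair[OF x, of ?y b0 a0 ?z ?y] nablaR_skew[OF x, of ?y ?z ?y b0 a0] by linarith+
  show ?thesis
    unfolding index_form_def using first[of a0 b1] first[of b0 a1] second[of b1 a0] second[of b0 a1] third fourth
      H[of a0 b0] m_sym[OF x, of "a2 + R (p t) a0 ?y ?y" "b2 + R (p t) b0 ?y ?y"]
    by (simp add: field_simps)
qed

lemma boundary_form_deriv:
  assumes x: "smooth_on S x" and z: "smooth_on S z" and t: "t \<in> S"
  shows "(boundary_form x z has_vector_derivative
     m (p t) (D (D (D (D x))) t + bi_jacobi_terms x t + H t (x t)) (z t)
     - index_form H t (x t) (D x t) (D (D x) t) (z t) (D z t) (D (D z) t)) (at t within S)"
proof -
  note U = p_in_U[OF t]
  have "(boundary_form x z has_vector_derivative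
     (m (p t) (D (jerk_var x) t) (z t) + m (p t) (jerk_var x t) (D z t))
   - (m (p t) (D (accel_var x) t) (D z t) + m (p t) (accel_var x t) (D (D z) t))
   + (m (p t) (D (\<lambda>t. R (p t) (y1 t) (y t) (x t)) t) (z t) + m (p t) (R (p t) (y1 t) (y t) (x t)) (D z t)) / 2)
     (at t within S)"
    unfolding boundary_form_def[abs_def]
    by (intro has_vector_derivative_add has_vector_derivative_diff has_vector_derivative_divide
      m_along_deriv R_along_smooth jerk_var_smooth accel_var_smooth D_smooth y_smooth x z t)
  moreover have "m (p t) (R (p t) (accel_var x t) (y t) (y t)) (z t) = m (p t) (accel_var x t) (R (p t) (z t) (y t) (y t))"
    using R4_pair[OF U, of "accel_var x t" "y t" "y t" "z t"] R4_antisym[OF U, of "y t" "z t" "accel_var x t" "y t"]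
      R_skew[OF U, of "z t" "y t" "accel_var x t" "y t"] m_sym[OF U, of "accel_var x t" "R (p t) (z t) (y t) (y t)"] by linarith
  moreover have "D (jerk_var x) t = D (D (D (D x))) t + bi_jacobi_terms x t - (R (p t) (accel_var x t) (y t) (y t)
    + R (p t) (x t) (y t) (y2 t) + nablaR (p t) (x t) (y1 t) (y t) (y t)
    + R (p t) (y1 t) (D x t) (y t) + R (p t) (y1 t) (y t) (D x t))"
    unfolding operator_factorization[OF x t] by (simp add: algebra_simps)
  moreover have "D (\<lambda>t. R (p t) (y1 t) (y t) (x t)) t = nablaR (p t) (y t) (y1 t) (y t) (x t)
      + R (p t) (y2 t) (y t) (x t) + R (p t) (y1 t) (y t) (D x t)"
    using D_R[OF D_smooth[OF y_smooth] y_smooth x t] by (simp add: R_def[of _ "y1 t" "y1 t"])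
  ultimately show ?thesis
    by (simp add: index_form_def jerk_var_def[of x t] accel_var_def[of x t] m_expand[OF U] accel_var_def[of z t]
        add_divide_distrib algebra_simps)
qed

end

section \<open>Linear differential equations and quadratic forms on an interval\<close>

lemma bounded_bilinear_forms:
  fixes Q :: "real \<Rightarrow> 'v::euclidean_space \<Rightarrow> 'w::euclidean_space \<Rightarrow> 'z::real_normed_vector"
  assumes Q: "\<And>t. t \<in> {a..b} \<Longrightarrow> bilinear (Q t)"
    and cont: "\<And>u v. continuous_on {a..b} (\<lambda>t. Q t u v)"
  shows "\<exists>K>0. \<forall>t\<in>{a..b}. \<forall>u v. norm (Q t u v) \<le> K * norm u * norm v"
proof -
  have "\<exists>k. \<forall>t\<in>{a..b}. norm (Q t i j) \<le> k" for i j
  proof -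
    have "bounded ((\<lambda>t. Q t i j) ` {a..b})"
      by (rule compact_imp_bounded[OF compact_continuous_image[OF cont compact_Icc]])
    then show ?thesis by (auto simp: bounded_iff)
  qed
  then obtain k where k: "\<And>i j t. t \<in> {a..b} \<Longrightarrow> norm (Q t i j) \<le> k i j" by metis
  define K where "K = 1 + (\<Sum>i\<in>Basis. \<Sum>j\<in>Basis. \<bar>k i j\<bar>)"
  have "norm (Q t u v) \<le> K * norm u * norm v" if t: "t \<in> {a..b}" for t u v
  proof -
    have "Q t u v = (\<Sum>i\<in>Basis. \<Sum>j\<in>Basis. (u \<bullet> i) *\<^sub>R (v \<bullet> j) *\<^sub>R Q t i j)"
    proof -
      have lin: "linear (\<lambda>u. Q t u v)" "\<And>u. linear (Q t u)" for v
        using Q[OF t] by (auto simp: bilinear_def)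
      have "Q t u v = (\<Sum>i\<in>Basis. (u \<bullet> i) *\<^sub>R Q t i v)"
        by (subst (1) euclidean_representation[of u, symmetric])
          (simp add: linear_sum[OF lin(1)] linear_scale[OF lin(1)])
      also have "\<dots> = (\<Sum>i\<in>Basis. (u \<bullet> i) *\<^sub>R (\<Sum>j\<in>Basis. (v \<bullet> j) *\<^sub>R Q t i j))"
        by (intro sum.cong refl arg_cong2[where f = scaleR])
          (subst (1) euclidean_representation[of v, symmetric],
            simp add: linear_sum[OF lin(2)] linear_scale[OF lin(2)])
      finally show ?thesis by (simp add: scaleR_sum_right)
    qed
    also have "norm \<dots> \<le> (\<Sum>i\<in>Basis. \<Sum>j\<in>Basis. \<bar>k i j\<bar> * norm u * norm v)"
    proof (intro sum_norm_le)
      fix i :: 'v and j :: 'w assume ij: "i \<in> Basis" "j \<in> Basis"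
      have "norm ((u \<bullet> i) *\<^sub>R (v \<bullet> j) *\<^sub>R Q t i j) = \<bar>u \<bullet> i\<bar> * (\<bar>v \<bullet> j\<bar> * norm (Q t i j))" by (simp add: abs_mult)
      also have "\<dots> \<le> norm u * (norm v * \<bar>k i j\<bar>)"
        using k[OF t, of i j] Basis_le_norm[OF ij(1), of u] Basis_le_norm[OF ij(2), of v]
        by (intro mult_mono) auto
      finally show "norm ((u \<bullet> i) *\<^sub>R (v \<bullet> j) *\<^sub>R Q t i j) \<le> \<bar>k i j\<bar> * norm u * norm v"
        by (simp add: mult_ac)
    qed
    also have "\<dots> = (\<Sum>i\<in>Basis. \<Sum>j\<in>Basis. \<bar>k i j\<bar>) * norm u * norm v"
      by (simp add: sum_distrib_right)
    also have "\<dots> \<le> K * norm u * norm v"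
      unfolding K_def by (intro mult_right_mono) auto
    finally show ?thesis .
  qed
  moreover have "K > 0" unfolding K_def by (intro add_pos_nonneg sum_nonneg) auto
  ultimately show ?thesis by blast
qed

lemma bounded_linear_maps:
  fixes A :: "real \<Rightarrow> 'v::euclidean_space \<Rightarrow> 'z::real_normed_vector"
  assumes A: "\<And>t. t \<in> {a..b} \<Longrightarrow> linear (A t)" and cont: "\<And>u. continuous_on {a..b} (\<lambda>t. A t u)"
  shows "\<exists>K>0. \<forall>t\<in>{a..b}. \<forall>u. norm (A t u) \<le> K * norm u"
proof -
  have "bilinear (\<lambda>u (s::real). s *\<^sub>R A t u)" if "t \<in> {a..b}" for t
    unfolding bilinear_def using linear_add[OF A[OF that]] linear_scale[OF A[OF that]]
    by (intro conjI allI linearI) (simp_all add: scaleR_add_right scaleR_add_left)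
  moreover have "continuous_on {a..b} (\<lambda>t. s *\<^sub>R A t u)" for s :: real and u
    by (intro continuous_on_scaleR continuous_on_const cont)
  ultimately have "\<exists>K>0. \<forall>t\<in>{a..b}. \<forall>u (s::real). norm (s *\<^sub>R A t u) \<le> K * norm u * norm s"
    by (rule bounded_bilinear_forms)
  then obtain K where K: "K > 0" "\<forall>t\<in>{a..b}. \<forall>u (s::real). norm (s *\<^sub>R A t u) \<le> K * norm u * norm s"
    by (elim exE conjE)
  have "norm (A t u) \<le> K * norm u" if "t \<in> {a..b}" for t u
    using K(2)[rule_format, OF that, of 1 u] by simp
  then show ?thesis using K(1) by blast
qed

text \<open>The growth estimate of Gronwall: \<open>exp (- 2 K t) |z(t)|\<^sup>2\<close> is nonincreasing.\<close>

lemma linear_ode_zero_forward: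
  fixes z :: "real \<Rightarrow> 'v::euclidean_space"
  assumes z: "\<And>t. t \<in> {a..b} \<Longrightarrow> (z has_vector_derivative z' t) (at t within {a..b})"
    and K: "\<And>t. t \<in> {a..b} \<Longrightarrow> norm (z' t) \<le> K * norm (z t)"
    and s: "s \<in> {a..b}" "z s = 0" and t: "t \<in> {s..b}"
  shows "z t = 0"
proof -
  define f where "f t = exp (- 2 * K * t) * (z t \<bullet> z t)" for t
  have "s \<le> t" using t by simp
  have df: "(f has_real_derivative exp (- 2 * K * r) * (2 * (z r \<bullet> z' r)) + (- 2 * K * exp (- 2 * K * r)) * (z r \<bullet> z r))
      (at r within {s..t})" if r: "r \<in> {s..t}" for r
  proof -
    have rab: "r \<in> {a..b}" "{s..t} \<subseteq> {a..b}" using r s t by auto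
    have zr: "(z has_vector_derivative z' r) (at r within {s..t})"
      using has_vector_derivative_within_subset[OF z[OF rab(1)] rab(2)] .
    have "((\<lambda>t. z t \<bullet> z t) has_derivative (\<lambda>h. z r \<bullet> (h *\<^sub>R z' r) + (h *\<^sub>R z' r) \<bullet> z r)) (at r within {s..t})"
      using zr unfolding has_vector_derivative_def by (intro has_derivative_inner)
    then have "((\<lambda>t. z t \<bullet> z t) has_real_derivative 2 * (z r \<bullet> z' r)) (at r within {s..t})"
      unfolding has_field_derivative_def
      by (rule has_derivative_eq_rhs) (auto simp: inner_commute algebra_simps)
    moreover have "((\<lambda>t. exp (- 2 * K * t)) has_real_derivative - 2 * K * exp (- 2 * K * r)) (at r within {s..t})"
      by (auto intro!: derivative_eq_intros)
    ultimately show ?thesis unfolding f_def[abs_def]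
      by (auto intro!: derivative_eq_intros)
  qed
  have neg: "exp (- 2 * K * r) * (2 * (z r \<bullet> z' r)) + (- 2 * K * exp (- 2 * K * r)) * (z r \<bullet> z r) \<le> 0"
    if r: "r \<in> {s..t}" for r
  proof -
    have "z r \<bullet> z' r \<le> norm (z r) * norm (z' r)" by (rule norm_cauchy_schwarz)
    also have "\<dots> \<le> norm (z r) * (K * norm (z r))"
      using K[of r] r s t by (intro mult_left_mono) auto
    also have "\<dots> = K * (z r \<bullet> z r)" by (simp add: dot_square_norm power2_eq_square)
    finally have "exp (- 2 * K * r) * (2 * (z r \<bullet> z' r) - 2 * K * (z r \<bullet> z r)) \<le> 0"
      by (intro mult_nonneg_nonpos) auto
    then show ?thesis by (simp add: algebra_simps)
  qed
  have "f t \<le> f s"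
  proof (cases "s = t")
    case False
    then have "s < t" using \<open>s \<le> t\<close> by simp
    from mvt_simple[OF this df[unfolded has_field_derivative_def]]
    obtain r where r: "r \<in> {s<..<t}" "f t - f s = (exp (- 2 * K * r) * (2 * (z r \<bullet> z' r))
        + (- 2 * K * exp (- 2 * K * r)) * (z r \<bullet> z r)) * (t - s)"
      by auto
    then have "f t - f s \<le> 0"
      using neg[of r] \<open>s \<le> t\<close> by (simp only: r(2)) (intro mult_nonpos_nonneg; simp)
    then show ?thesis by simp
  qed simp
  then have "z t \<bullet> z t \<le> 0" using s by (simp add: f_def mult_le_0_iff)
  then show ?thesis by (metis inner_gt_zero_iff not_le)
qed

lemma linear_ode_zero:
  fixes z :: "real \<Rightarrow> 'v::euclidean_space"
  assumes z: "\<And>t. t \<in> {a..b} \<Longrightarrow> (z has_vector_derivative A t (z t)) (at t within {a..b})"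
    and A: "\<And>t. t \<in> {a..b} \<Longrightarrow> linear (A t)" "\<And>u. continuous_on {a..b} (\<lambda>t. A t u)"
    and s: "s \<in> {a..b}" "z s = 0" and t: "t \<in> {a..b}"
  shows "z t = 0"
proof -
  obtain K where K: "K > 0" "\<And>t u. t \<in> {a..b} \<Longrightarrow> norm (A t u) \<le> K * norm u"
    using bounded_linear_maps[OF A] by blast
  show ?thesis
  proof (cases "s \<le> t")
    case True
    show ?thesis
      by (rule linear_ode_zero_forward[OF z K(2) s]) (use True t in auto)
  next
    case False
    have "((\<lambda>t. z (- t)) has_vector_derivative - A (- t) (z (- t))) (at t within {- b..- a})"
      if t: "t \<in> {- b..- a}" for t
    proof -
      have "(z has_vector_derivative A (- t) (z (- t))) (at (- t) within {a..b})"
        using z[of "- t"] t by auto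
      moreover have "uminus ` {- b..- a} = {a..b}" by (simp add: image_uminus_atLeastAtMost)
      moreover have "(uminus has_vector_derivative (- 1)) (at t within {- b..- a})"
        by (auto intro!: derivative_eq_intros)
      ultimately show ?thesis
        using vector_diff_chain_within[of uminus "-1" t "{- b..- a}" z "A (- t) (z (- t))"]
        by (simp add: o_def)
    qed
    then have "z (- (- t)) = 0"
      by (rule linear_ode_zero_forward[where K = K and s = "- s"])
        (use K(2) s t False in auto)
    then show ?thesis by simp
  qed
qed

text \<open>By compactness \<open>Q\<close> is uniformly positive on the highest component, and the mixed terms are absorbed by
  Young's inequality.\<close>

lemma coercive_on_highest_order:
  fixes Q :: "real \<Rightarrow> 'e::euclidean_space \<times> 'e \<times> 'e \<Rightarrow> 'e \<times> 'e \<times> 'e \<Rightarrow> real"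
  assumes ab: "a \<le> b" and Q: "\<And>t. t \<in> {a..b} \<Longrightarrow> bilinear (Q t)"
    and cont: "\<And>u v. continuous_on {a..b} (\<lambda>t. Q t u v)"
    and pos: "\<And>t e. t \<in> {a..b} \<Longrightarrow> e \<noteq> 0 \<Longrightarrow> Q t (0, 0, e) (0, 0, e) > 0"
  shows "\<exists>\<alpha>>0. \<exists>C>0. \<forall>t\<in>{a..b}. \<forall>u0 u1 u2. Q t (u0, u1, u2) (u0, u1, u2) \<ge>
    \<alpha> * (norm u2)\<^sup>2 - C * ((norm u0)\<^sup>2 + (norm u1)\<^sup>2)"
proof -
  obtain K where K: "K > 0" "\<And>t u v. t \<in> {a..b} \<Longrightarrow> norm (Q t u v) \<le> K * norm u * norm v"
    using bounded_bilinear_forms[OF Q cont] by blast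
  define f where "f = (\<lambda>(t, e). \<Sum>i\<in>Basis. \<Sum>j\<in>Basis. ((e::'e) \<bullet> i) * ((e \<bullet> j) * Q t (0, 0, i) (0, 0, j)))"
  have f: "f (t, e) = Q t (0, 0, e) (0, 0, e)" if t: "t \<in> {a..b}" for t e
  proof -
    note b = Q[OF t]
    have pair: "(0::'e, 0::'e, e) = (\<Sum>i\<in>Basis. (e \<bullet> i) *\<^sub>R (0::'e, 0::'e, i))" for e
      by (simp add: prod_eq_iff fst_sum snd_sum euclidean_representation)
    have A: "Q t (0, 0, e) w = (\<Sum>i\<in>Basis. (e \<bullet> i) * Q t (0, 0, i) w)" for w
      by (subst pair) (simp only: linear_sum[OF bilinear_linear_left[OF b]]
          linear_scale[OF bilinear_linear_left[OF b]] real_scaleR_def)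
    have B: "Q t w (0, 0, e) = (\<Sum>j\<in>Basis. (e \<bullet> j) * Q t w (0, 0, j))" for w
      by (subst pair) (simp only: linear_sum[OF bilinear_linear_right[OF b]]
          linear_scale[OF bilinear_linear_right[OF b]] real_scaleR_def)
    have "Q t (0, 0, e) (0, 0, e) = (\<Sum>i\<in>Basis. e \<bullet> i * Q t (0, 0, i) (0, 0, e))" by (rule A)
    also have "\<dots> = f (t, e)" by (simp only: B) (simp add: f_def sum_distrib_left)
    finally show ?thesis ..
  qed
  have "continuous_on ({a..b} \<times> sphere 0 1) f"
    unfolding f_def case_prod_beta
    by (intro continuous_intros continuous_on_compose2[OF cont]) auto
  moreover have "compact ({a..b} \<times> sphere (0::'e) 1)" by (intro compact_Times) auto
  moreover have "{a..b} \<times> sphere (0::'e) 1 \<noteq> {}" using ab by simp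
  ultimately obtain q where q: "q \<in> {a..b} \<times> sphere 0 1" "\<And>r. r \<in> {a..b} \<times> sphere 0 1 \<Longrightarrow> f q \<le> f r"
    using continuous_attains_inf by metis
  define \<beta> where "\<beta> = f q"
  obtain t0 e0 where te: "q = (t0, e0)" "t0 \<in> {a..b}" "norm e0 = 1"
    using q(1) by (cases q) auto
  then have "e0 \<noteq> 0" by auto
  then have \<beta>: "\<beta> > 0" using pos[OF te(2)] f[OF te(2)] by (simp add: \<beta>_def te(1))
  have lower: "Q t (0, 0, e) (0, 0, e) \<ge> \<beta> * (norm e)\<^sup>2" if t: "t \<in> {a..b}" for t e
  proof (cases "e = 0")
    case True
    have "Q t 0 0 = 0" using bilinear_lzero[OF Q[OF t]] by blast
    then show ?thesis using True by (simp add: zero_prod_def)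
  next
    case False
    define u where "u = e /\<^sub>R norm e"
    have "(t, u) \<in> {a..b} \<times> sphere 0 1" using t False by (simp add: u_def)
    then have "\<beta> \<le> Q t (0, 0, u) (0, 0, u)" using q(2) f[OF t] by (metis \<beta>_def)
    then have "\<beta> * (norm e)\<^sup>2 \<le> Q t (0, 0, u) (0, 0, u) * (norm e)\<^sup>2" by (rule mult_right_mono) simp
    moreover have "(0, 0, e) = norm e *\<^sub>R (0::'e, 0::'e, u)" using False by (simp add: u_def)
    then have "Q t (0, 0, e) (0, 0, e) = (norm e)\<^sup>2 * Q t (0, 0, u) (0, 0, u)"
      by (simp only: bilinear_lmul[OF Q[OF t]] bilinear_rmul[OF Q[OF t]]) (simp add: power2_eq_square)
    ultimately show ?thesis by (simp add: mult.commute)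
  qed
  have "Q t (u0, u1, u2) (u0, u1, u2) \<ge>
      \<beta> / 2 * (norm u2)\<^sup>2 - (K + 2 * K\<^sup>2 / \<beta>) * ((norm u0)\<^sup>2 + (norm u1)\<^sup>2)"
    if t: "t \<in> {a..b}" for t u0 u1 u2
  proof -
    define p r where "p = (0::'e, 0::'e, u2)" and "r = (u0, u1, 0::'e)"
    have n: "norm p = norm u2" "(norm r)\<^sup>2 = (norm u0)\<^sup>2 + (norm u1)\<^sup>2"
      by (simp_all add: p_def r_def norm_Pair)
    have "Q t (u0, u1, u2) (u0, u1, u2) = Q t (p + r) (p + r)" by (simp add: p_def r_def)
    also have "\<dots> = Q t p p + Q t p r + Q t r p + Q t r r"
      using Q[OF t] by (simp add: bilinear_ladd bilinear_radd)
    finally have e: "Q t (u0, u1, u2) (u0, u1, u2) = \<dots>" .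
    have "\<bar>Q t p r\<bar> \<le> K * norm u2 * norm r" "\<bar>Q t r p\<bar> \<le> K * norm u2 * norm r" "\<bar>Q t r r\<bar> \<le> K * (norm r)\<^sup>2"
      using K(2)[OF t, of p r] K(2)[OF t, of r p] K(2)[OF t, of r r] n
      by (simp_all add: mult_ac power2_eq_square)
    moreover have "Q t p p \<ge> \<beta> * (norm u2)\<^sup>2" using lower[OF t] by (simp add: p_def)
    moreover have "2 * (K * norm u2 * norm r) \<le> \<beta> / 2 * (norm u2)\<^sup>2 + 2 * K\<^sup>2 / \<beta> * (norm r)\<^sup>2"
    proof -
      have "0 \<le> \<beta> / 2 * (norm u2 - 2 * K / \<beta> * norm r)\<^sup>2" using \<beta> by simp
      also have "\<dots> = \<beta> / 2 * (norm u2)\<^sup>2 + 2 * K\<^sup>2 / \<beta> * (norm r)\<^sup>2 - 2 * (K * norm u2 * norm r)"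
        using \<beta> by (simp add: power2_eq_square field_simps)
      finally show ?thesis by simp
    qed
    ultimately show ?thesis unfolding e n(2)[symmetric] by (simp add: algebra_simps)
  qed
  moreover have "\<beta> / 2 > 0" "K + 2 * K\<^sup>2 / \<beta> > 0" using \<beta> K by (auto intro: add_pos_nonneg)
  ultimately show ?thesis by blast
qed

text \<open>The hypothesis says that \<open>f\<close> is the antiderivative of \<open>f'\<close> that vanishes at \<open>d\<close>; in this form it
  applies to functions \<open>f'\<close> with jumps. The bound is the Cauchy-Schwarz inequality for
  \<open>\<integral> f'\<close>, obtained from \<open>0 \<le> \<integral> |f' + k|\<^sup>2\<close> with the optimal constant \<open>k\<close>.\<close>

lemma poincare_right_end:
  fixes f f' :: "real \<Rightarrow> 'e::euclidean_space"
  assumes f: "\<And>t. t \<in> {c..d} \<Longrightarrow> (f' has_integral - f t) {t..d}"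
    and int: "(\<lambda>t. (norm (f' t))\<^sup>2) integrable_on {c..d}" and t: "t \<in> {c..d}"
  shows "(norm (f t))\<^sup>2 \<le> (d - c) * integral {c..d} (\<lambda>t. (norm (f' t))\<^sup>2)"
proof (cases "t = d")
  case True
  have "(f' has_integral 0) {d..d}" using has_integral_refl(2)[of f' d] by simp
  moreover have "(f' has_integral - f d) {d..d}" using f[OF t] True by simp
  ultimately have "- f d = 0" using has_integral_unique by blast
  then show ?thesis using True t integral_nonneg[OF int] by simp
next
  case False
  then have td: "t < d" using t by simp
  define k where "k = (1 / (d - t)) *\<^sub>R f t"
  have sub: "{t..d} \<subseteq> {c..d}" using t by auto
  have intt: "(\<lambda>t. (norm (f' t))\<^sup>2) integrable_on {t..d}"
    by (rule integrable_on_subinterval[OF int sub])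
  have fk: "((\<lambda>s. f' s \<bullet> k) has_integral (- f t \<bullet> k)) {t..d}"
    using has_integral_linear[OF f[OF t] bounded_linear_inner_left[of k]] by (simp add: o_def)
  have "((\<lambda>s. (norm (f' s))\<^sup>2 + 2 * (f' s \<bullet> k) + (norm k)\<^sup>2) has_integral
      integral {t..d} (\<lambda>t. (norm (f' t))\<^sup>2) + 2 * (- f t \<bullet> k) + (d - t) * (norm k)\<^sup>2) {t..d}"
    using has_integral_const_real[of "(norm k)\<^sup>2" t d] td
    by (intro has_integral_add integrable_integral intt has_integral_mult_right
        fk) auto
  moreover have "(norm (f' s))\<^sup>2 + 2 * (f' s \<bullet> k) + (norm k)\<^sup>2 \<ge> 0" for s
  proof -
    have "(norm (f' s))\<^sup>2 + 2 * (f' s \<bullet> k) + (norm k)\<^sup>2 = (norm (f' s + k))\<^sup>2"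
      by (simp add: power2_norm_eq_inner inner_add_left inner_add_right inner_commute)
    then show ?thesis by simp
  qed
  ultimately have "0 \<le> integral {t..d} (\<lambda>t. (norm (f' t))\<^sup>2) + 2 * (- f t \<bullet> k) + (d - t) * (norm k)\<^sup>2"
    by (rule has_integral_nonneg)
  also have "\<dots> = integral {t..d} (\<lambda>t. (norm (f' t))\<^sup>2) - (norm (f t))\<^sup>2 / (d - t)"
  proof -
    have "f t \<bullet> k = (norm (f t))\<^sup>2 / (d - t)" by (simp add: k_def power2_norm_eq_inner)
    moreover have "(d - t) * (norm k)\<^sup>2 = (norm (f t))\<^sup>2 / (d - t)"
      using td by (simp add: k_def power_divide power2_eq_square)
    ultimately show ?thesis by simp
  qed
  finally have "(norm (f t))\<^sup>2 \<le> (d - t) * integral {t..d} (\<lambda>t. (norm (f' t))\<^sup>2)"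
    using td by (simp add: field_simps)
  also have "\<dots> \<le> (d - c) * integral {c..d} (\<lambda>t. (norm (f' t))\<^sup>2)"
    using t td by (intro mult_mono integral_subset_le[OF sub intt int] integral_nonneg[OF intt]) auto
  finally show ?thesis .
qed

section \<open>Vanishing of truncated combinations\<close>

lemma has_integral_truncate:
  fixes f :: "real \<Rightarrow> 'a::banach"
  assumes "(f has_integral i) {t..s}" "s \<le> d"
  shows "((\<lambda>r. if r \<le> s then f r else 0) has_integral i) {t..d}"
proof -
  have "((\<lambda>r. if r \<in> {t..s} then f r else 0) has_integral i) {t..d}"
    using assms by (subst has_integral_restrict) auto
  then show ?thesis
    by (rule has_integral_eq[rotated]) auto
qed

lemma truncated_antiderivative:
  fixes f f' :: "real \<Rightarrow> 'e::euclidean_space"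
  assumes f: "\<And>t. t \<in> {c..d} \<Longrightarrow> (f has_vector_derivative f' t) (at t within {c..d})"
    and s: "s \<in> {c..d}" "f s = 0" and t: "t \<in> {c..d}"
  shows "((\<lambda>r. if r \<le> s then f' r else 0) has_integral - (if t \<le> s then f t else 0)) {t..d}"
proof (cases "t \<le> s")
  case True
  have "(f' has_integral f s - f t) {t..s}"
    by (rule fundamental_theorem_of_calculus[OF True])
      (use s t in \<open>auto intro!: has_vector_derivative_within_subset[OF f]\<close>)
  then show ?thesis using True s by (auto intro: has_integral_truncate)
next
  case False
  then show ?thesis by (auto intro: has_integral_is_0)
qed

text \<open>The functions \<open>x0 k\<close> are truncated at \<open>s k\<close>, where they have a double zero: so the truncated function and its
  derivative are still antiderivatives of the (discontinuous) next one. The integrated form of the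
  combination is at most \<open>0\<close> by \<open>total\<close>, while coercivity and the Poincare inequality, applied twice,
  bound it below by a positive multiple of the integral of the squared second derivative.\<close>

lemma truncated_combination_vanishes:
  fixes x0 x1 x2 :: "'k \<Rightarrow> real \<Rightarrow> 'e::euclidean_space" and s a :: "'k \<Rightarrow> real"
  assumes K: "finite K" and s: "\<And>k. k \<in> K \<Longrightarrow> s k \<in> {c..d}"
    and d0: "\<And>k t. k \<in> K \<Longrightarrow> t \<in> {c..d} \<Longrightarrow> (x0 k has_vector_derivative x1 k t) (at t within {c..d})"
    and d1: "\<And>k t. k \<in> K \<Longrightarrow> t \<in> {c..d} \<Longrightarrow> (x1 k has_vector_derivative x2 k t) (at t within {c..d})"
    and c2: "\<And>k. k \<in> K \<Longrightarrow> continuous_on {c..d} (x2 k)"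
    and zero: "\<And>k. k \<in> K \<Longrightarrow> x0 k (s k) = 0" "\<And>k. k \<in> K \<Longrightarrow> x1 k (s k) = 0"
    and Q: "\<And>t. t \<in> {c..d} \<Longrightarrow> bilinear (Q t)"
    and coercive: "\<And>t u0 u1 u2. t \<in> {c..d} \<Longrightarrow>
      \<alpha> * (norm u2)\<^sup>2 - C * ((norm u0)\<^sup>2 + (norm u1)\<^sup>2) \<le> Q t (u0, u1, u2) (u0, u1, u2)"
    and small: "C > 0" "d - c \<le> 1" "2 * C * (d - c) < \<alpha>"
    and int: "\<And>j k. j \<in> K \<Longrightarrow> k \<in> K \<Longrightarrow>
      ((\<lambda>t. Q t (x0 j t, x1 j t, x2 j t) (x0 k t, x1 k t, x2 k t)) has_integral q j k) {c..min (s j) (s k)}"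
    and total: "(\<Sum>j\<in>K. \<Sum>k\<in>K. a j * a k * q j k) \<le> 0"
    and t: "t \<in> {c..d}"
  shows "(\<Sum>k\<in>K. a k *\<^sub>R (if t \<le> s k then x0 k t else 0)) = 0"
proof -
  define w where "w x t = (\<Sum>k\<in>K. a k *\<^sub>R (if t \<le> s k then x k t else 0))"
    for x :: "'k \<Rightarrow> real \<Rightarrow> 'e" and t
  define h where "h = d - c"
  have h: "0 \<le> h" using t by (simp add: h_def)
  have c1: "continuous_on {c..d} (x1 k)" if "k \<in> K" for k
    using d1[OF that] by (meson continuous_on_eq_continuous_within has_vector_derivative_continuous)
  have w1: "(w x2 has_integral - w x1 t) {t..d}" if "t \<in> {c..d}" for t
    unfolding w_def[abs_def] sum_negf[symmetric] scaleR_minus_right[symmetric]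
    by (intro has_integral_sum K has_integral_cmul truncated_antiderivative[OF d1 s zero(2) that])
  have w0: "(w x1 has_integral - w x0 t) {t..d}" if "t \<in> {c..d}" for t
    unfolding w_def[abs_def] sum_negf[symmetric] scaleR_minus_right[symmetric]
    by (intro has_integral_sum K has_integral_cmul truncated_antiderivative[OF d0 s zero(1) that])
  have square: "(\<lambda>t. (norm (w x t))\<^sup>2) integrable_on {c..d}" if x: "\<And>k. k \<in> K \<Longrightarrow> continuous_on {c..d} (x k)" for x
  proof -
    have "(\<lambda>t. if t \<le> min (s j) (s k) then x j t \<bullet> x k t else 0) integrable_on {c..d}"
      if jk: "j \<in> K" "k \<in> K" for j k
    proof -
      have "(\<lambda>t. x j t \<bullet> x k t) integrable_on {c..min (s j) (s k)}"
        by (intro integrable_continuous_real continuous_on_inner continuous_on_subset[OF x[OF jk(1)]]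
          continuous_on_subset[OF x[OF jk(2)]]) (use s[OF jk(1)] s[OF jk(2)] in auto)
      then show ?thesis
        using has_integral_truncate[of _ _ c "min (s j) (s k)" d] s[OF jk(1)] unfolding integrable_on_def by fastforce
    qed
    then have "(\<lambda>t. \<Sum>j\<in>K. \<Sum>k\<in>K. (a j * a k) *\<^sub>R (if t \<le> min (s j) (s k) then x j t \<bullet> x k t else 0))
        integrable_on {c..d}"
      by (intro integrable_sum K integrable_cmul)
    moreover have "(norm (w x t))\<^sup>2 =
        (\<Sum>j\<in>K. \<Sum>k\<in>K. (a j * a k) *\<^sub>R (if t \<le> min (s j) (s k) then x j t \<bullet> x k t else 0))" for t
      unfolding power2_norm_eq_inner w_def inner_sum_left inner_sum_right
      by (intro sum.cong refl) (auto simp: inner_commute)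
    ultimately show ?thesis by simp
  qed
  define A where "A = integral {c..d} (\<lambda>t. (norm (w x2 t))\<^sup>2)"
  define B where "B = integral {c..d} (\<lambda>t. (norm (w x1 t))\<^sup>2)"
  have A: "0 \<le> A" unfolding A_def by (rule integral_nonneg[OF square[OF c2]]) auto
  have n1: "(norm (w x1 t))\<^sup>2 \<le> h * A" if "t \<in> {c..d}" for t
    unfolding h_def A_def by (rule poincare_right_end[OF w1 square[OF c2] that])
  have n0: "(norm (w x0 t))\<^sup>2 \<le> h * B" if "t \<in> {c..d}" for t
    unfolding h_def B_def by (rule poincare_right_end[OF w0 square[OF c1] that])
  have "B \<le> integral {c..d} (\<lambda>t. h * A)"
    unfolding B_def by (rule integral_le[OF square[OF c1]]) (use n1 in auto)
  then have B: "B \<le> h * (h * A)" using t by (simp add: h_def)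
  have hA: "0 \<le> h * A" using h A by simp
  have hB: "h * B \<le> h * A"
  proof -
    have "B \<le> 1 * (1 * A)"
      using B small(2) h A hA unfolding h_def[symmetric]
      by (meson mult_mono order_trans mult_right_mono order_refl zero_le_one)
    then show ?thesis using h by (simp add: mult_left_mono)
  qed
  have "((\<lambda>t. \<Sum>j\<in>K. \<Sum>k\<in>K. (a j * a k) *\<^sub>R (if t \<le> min (s j) (s k)
      then Q t (x0 j t, x1 j t, x2 j t) (x0 k t, x1 k t, x2 k t) else 0)) has_integral
      (\<Sum>j\<in>K. \<Sum>k\<in>K. (a j * a k) *\<^sub>R q j k)) {c..d}"
    using s by (intro has_integral_sum K has_integral_cmul has_integral_truncate int)
      (auto simp: min_le_iff_disj)
  moreover have "(\<Sum>j\<in>K. \<Sum>k\<in>K. (a j * a k) *\<^sub>R (if t \<le> min (s j) (s k)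
      then Q t (x0 j t, x1 j t, x2 j t) (x0 k t, x1 k t, x2 k t) else 0)) =
      Q t (w x0 t, w x1 t, w x2 t) (w x0 t, w x1 t, w x2 t)" if t: "t \<in> {c..d}" for t
  proof -
    let ?v = "\<lambda>k. if t \<le> s k then (x0 k t, x1 k t, x2 k t) else 0"
    have v: "(w x0 t, w x1 t, w x2 t) = (\<Sum>k\<in>K. a k *\<^sub>R ?v k)"
      unfolding w_def
      by (simp add: prod_eq_iff fst_sum snd_sum if_distrib[of fst] if_distrib[of snd] if_distribR cong: if_cong)
    have "Q t (\<Sum>k\<in>K. a k *\<^sub>R ?v k) (\<Sum>k\<in>K. a k *\<^sub>R ?v k) =
        (\<Sum>j\<in>K. \<Sum>k\<in>K. (a j * a k) * Q t (?v j) (?v k))"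
      using Q[OF t]
      by (simp only: linear_sum[OF bilinear_linear_left] linear_sum[OF bilinear_linear_right]
        bilinear_lmul bilinear_rmul real_scaleR_def sum_distrib_left mult.assoc)
    also have "\<dots> = (\<Sum>j\<in>K. \<Sum>k\<in>K. (a j * a k) *\<^sub>R (if t \<le> min (s j) (s k)
      then Q t (x0 j t, x1 j t, x2 j t) (x0 k t, x1 k t, x2 k t) else 0))"
      by (intro sum.cong refl) (simp add: bilinear_lzero[OF Q[OF t]] bilinear_rzero[OF Q[OF t]])
    finally show ?thesis unfolding v ..
  qed
  ultimately have form: "((\<lambda>t. Q t (w x0 t, w x1 t, w x2 t) (w x0 t, w x1 t, w x2 t)) has_integral
      (\<Sum>j\<in>K. \<Sum>k\<in>K. (a j * a k) *\<^sub>R q j k)) {c..d}"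
    by (rule has_integral_eq[rotated])
  have "((\<lambda>t. \<alpha> * (norm (w x2 t))\<^sup>2 - C * (2 * (h * A))) has_integral
      \<alpha> * A - (d - c) * (C * (2 * (h * A)))) {c..d}"
    unfolding A_def using has_integral_const_real[of "C * (2 * (h * A))" c d] t
    by (intro has_integral_diff has_integral_mult_right integrable_integral square c2)
      (auto simp: A_def)
  then have "\<alpha> * A - (d - c) * (C * (2 * (h * A))) \<le> (\<Sum>j\<in>K. \<Sum>k\<in>K. (a j * a k) *\<^sub>R q j k)"
  proof (rule has_integral_le[OF _ form])
    fix t assume t: "t \<in> {c..d}"
    have "(norm (w x0 t))\<^sup>2 + (norm (w x1 t))\<^sup>2 \<le> 2 * (h * A)"
      using n0[OF t] n1[OF t] hB by linarith
    then have "C * ((norm (w x0 t))\<^sup>2 + (norm (w x1 t))\<^sup>2) \<le> C * (2 * (h * A))"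
      using small(1) by (intro mult_left_mono) auto
    then show "\<alpha> * (norm (w x2 t))\<^sup>2 - C * (2 * (h * A)) \<le>
        Q t (w x0 t, w x1 t, w x2 t) (w x0 t, w x1 t, w x2 t)"
      using coercive[OF t, of "w x2 t" "w x0 t" "w x1 t"] by linarith
  qed
  also have "\<dots> \<le> 0" using total by simp
  finally have "\<alpha> * A \<le> (2 * C * h) * (h * A)" by (simp add: h_def mult_ac)
  also have "\<dots> \<le> (2 * C * h) * A"
    using small(1,2) h A by (intro mult_left_mono) (auto simp: h_def[symmetric] mult_left_le_one_le)
  finally have "(\<alpha> - 2 * C * h) * A \<le> 0" by (simp add: algebra_simps)
  then have "A = 0" using small(3) A by (simp add: h_def mult_le_0_iff)
  then have "B \<le> 0" using B by simp
  then have "h * B \<le> 0" using h by (simp add: mult_nonneg_nonpos)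
  then have "(norm (w x0 t))\<^sup>2 \<le> 0" using n0[OF t] by linarith
  then have "w x0 t = 0" by simp
  then show ?thesis by (simp add: w_def)
qed

text \<open>The vectors \<open>v k\<close> may coincide for different \<open>k\<close>, hence the indices are kept.\<close>

lemma nontrivial_vanishing_combination:
  fixes v :: "'k \<Rightarrow> 'v::euclidean_space"
  assumes K: "finite K" "card K > DIM('v)"
  shows "\<exists>a. (\<exists>k\<in>K. a k \<noteq> 0) \<and> (\<Sum>k\<in>K. a k *\<^sub>R v k) = 0"
proof (cases "inj_on v K")
  case True
  then have "dependent (v ` K)"
    using K by (intro dependent_biggerset) (auto simp: card_image)
  then obtain u y where u: "y \<in> v ` K" "u y \<noteq> 0" "(\<Sum>y\<in>v ` K. u y *\<^sub>R y) = 0"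
    using dependent_finite[of "v ` K"] K by auto
  then show ?thesis
    using sum.reindex[OF True, of "\<lambda>y. u y *\<^sub>R y"] by (intro exI[of _ "\<lambda>k. u (v k)"]) auto
next
  case False
  then obtain i j where ij: "i \<in> K" "j \<in> K" "i \<noteq> j" "v i = v j" by (auto simp: inj_on_def)
  define a where "a k = (if k = i then 1 else 0) - (if k = j then 1 else 0 :: real)" for k
  have "(\<Sum>k\<in>K. a k *\<^sub>R v k) = (\<Sum>k\<in>K. (if k = i then v k else 0) - (if k = j then v k else 0))"
    by (intro sum.cong) (auto simp: a_def)
  also have "\<dots> = 0" using ij K by (simp add: sum_subtractf)
  finally show ?thesis using ij by (intro exI[of _ a]) (auto simp: a_def)
qed

section \<open>Bi-Jacobi fields in coordinates\<close>

text \<open>\<open>H t\<close> stands for the covariant Hessian of the potential at the point \<open>p t\<close>.\<close>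

locale coordinate_curve_hessian = coordinate_curve U m G S p
  for U :: "'e::euclidean_space set" and m G S p +
  fixes H :: "real \<Rightarrow> 'e \<Rightarrow> 'e"
  assumes H_linear: "t \<in> S \<Longrightarrow> linear (H t)" and H_smooth: "smooth_on S (\<lambda>t. H t u)"
    and H_sym: "t \<in> S \<Longrightarrow> m (p t) (H t u) w = m (p t) (H t w) u"
begin

lemma R_zero: "t \<in> S \<Longrightarrow> R (p t) 0 v w = 0"
  by (rule linear_0[OF trilinear_linear[OF R_trilinear[OF p_in_U]]])

definition solution where
  "solution x \<longleftrightarrow> smooth_on S x \<and> (\<forall>t\<in>S. D (D (D (D x))) t + bi_jacobi_terms x t + H t (x t) = 0)"

lemma solution_smooth: "solution x \<Longrightarrow> smooth_on S x"
  by (simp add: solution_def)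

lemma solution_boundary_form_deriv:
  assumes x: "solution x" and z: "smooth_on S z" and t: "t \<in> S"
  shows "(boundary_form x z has_vector_derivative
     - index_form H t (x t) (D x t) (D (D x) t) (z t) (D z t) (D (D z) t)) (at t within S)"
proof -
  have "D (D (D (D x))) t + bi_jacobi_terms x t + H t (x t) = 0" using x t by (simp add: solution_def)
  from boundary_form_deriv[OF solution_smooth[OF x] z t, of H, unfolded this] show ?thesis
    by (simp add: bilinear_lzero[OF m_bilinear] p_in_U t)
qed

text \<open>This is self-adjointness: the bracket of two solutions is a conserved symplectic form.\<close>

lemma concomitant_constant:
  assumes x: "solution x" and z: "solution z" and t: "t \<in> S"
  shows "((\<lambda>t. boundary_form x z t - boundary_form z x t) has_vector_derivative 0) (at t within S)"
  using has_vector_derivative_diff[OF solution_boundary_form_deriv[OF x solution_smooth[OF z] t]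
      solution_boundary_form_deriv[OF z solution_smooth[OF x] t]]
    index_form_sym[where H = H, OF t H_sym[OF t], of "x t" "D x t" "D (D x) t" "z t" "D z t" "D (D z) t"]
  by simp

text \<open>The equation as a first order system for \<open>(x, D x, accel_var x, jerk_var x)\<close>. Compared with the
  system for the covariant derivatives of \<open>x\<close> it avoids derivatives of the curvature of second
  order.\<close>

definition jacobi_system where "jacobi_system t = (\<lambda>(a, b, u, w). (b - G (p t) (y t) a,
   u - R (p t) a (y t) (y t) - G (p t) (y t) b,
   w - R (p t) a (y t) (y1 t) - G (p t) (y t) u,
   - (R (p t) u (y t) (y t) + R (p t) a (y t) (y2 t) + nablaR (p t) a (y1 t) (y t) (y t)
     + R (p t) (y1 t) b (y t) + R (p t) (y1 t) (y t) b + H t a) - G (p t) (y t) w))"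

definition state where "state x t = (x t, D x t, accel_var x t, jerk_var x t)"

lemma state_deriv:
  assumes x: "solution x" and t: "t \<in> S"
  shows "(state x has_vector_derivative jacobi_system t (state x t)) (at t within S)"
proof -
  note sx = solution_smooth[OF x]
  have "D (jerk_var x) t = - (R (p t) (accel_var x t) (y t) (y t) + R (p t) (x t) (y t) (y2 t)
      + nablaR (p t) (x t) (y1 t) (y t) (y t) + R (p t) (y1 t) (D x t) (y t)
      + R (p t) (y1 t) (y t) (D x t) + H t (x t))"
  proof -
    have "D (D (D (D x))) t + bi_jacobi_terms x t + H t (x t) = 0" using x t by (simp add: solution_def)
    from this[unfolded operator_factorization[OF sx t]] show ?thesis
      by (simp add: eq_neg_iff_add_eq_0 algebra_simps)
  qed
  then have "jacobi_system t (state x t) = (D x t - G (p t) (y t) (x t), D (D x) t - G (p t) (y t) (D x t),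
      D (accel_var x) t - G (p t) (y t) (accel_var x t), D (jerk_var x) t - G (p t) (y t) (jerk_var x t))"
    by (simp add: jacobi_system_def state_def accel_var_def[of x t] jerk_var_def[of x t])
  then show ?thesis
    unfolding state_def[abs_def]
    by (simp add: has_vector_derivative_Pair D_deriv sx t D_smooth accel_var_smooth jerk_var_smooth)
qed

lemma jacobi_system_linear: "t \<in> S \<Longrightarrow> linear (jacobi_system t)"
  using linear_add[OF nablaR_linear[OF p_in_U]] linear_scale[OF nablaR_linear[OF p_in_U]]
  by (intro linearI) (auto simp: jacobi_system_def G_expand R_expand p_in_U linear_add[OF H_linear]
      linear_scale[OF H_linear] algebra_simps)

lemma jacobi_system_continuous: "continuous_on S (\<lambda>t. jacobi_system t u)"
proof -
  obtain a b v w where u: "u = (a, b, v, w)" by (cases u) auto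
  have c: "\<And>c. smooth_on S (\<lambda>t. c)" by (rule smooth_on_const[OF S])
  show ?thesis
    unfolding u jacobi_system_def case_prod_conv
    by (intro continuous_on_Pair smooth_on_imp_continuous_on smooth_on_add[OF S] smooth_on_diff[OF S]
      smooth_on_minus[OF S] R_along_smooth nablaR_along_smooth G_along_smooth H_smooth c y_smooth
      D_smooth[OF y_smooth] D_smooth[OF D_smooth[OF y_smooth]])
qed

lemma D_vanishes:
  assumes x: "\<And>t. t \<in> S \<inter> {c<..<d} \<Longrightarrow> x t = 0" and t: "t \<in> S \<inter> {c<..<d}"
  shows "D x t = 0"
proof -
  have tS: "t \<in> S" using t by simp
  have "(x has_vector_derivative 0) (at t within S)"
  proof (rule has_vector_derivative_transform_within[OF has_vector_derivative_const])
    show "0 < min (t - c) (d - t)" using t by auto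
    show "0 = x r" if "r \<in> S" "dist r t < min (t - c) (d - t)" for r
      using x[of r] that by (auto simp: dist_real_def abs_less_iff)
  qed (use tS in auto)
  from D_eqI[OF tS this] show ?thesis using x[OF t] by (simp add: G_expand p_in_U tS)
qed

text \<open>On the open interval where \<open>x\<close> vanishes, so do its covariant derivatives, hence the state; then the
  state is zero on the whole interval.\<close>

lemma solution_zero:
  assumes x: "solution x" and ab: "{a..b} \<subseteq> S" and s: "s \<in> {a..b}" "s \<in> {c<..<d}"
    and vanish: "\<And>t. t \<in> S \<inter> {c<..<d} \<Longrightarrow> x t = 0" and t: "t \<in> {a..b}"
  shows "x t = 0"
proof -
  let ?I = "S \<inter> {c<..<d}"
  have Dx: "D x t = 0" if "t \<in> ?I" for t by (rule D_vanishes[OF vanish that])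
  have DDx: "D (D x) t = 0" if "t \<in> ?I" for t by (rule D_vanishes[OF Dx that])
  have accel_var: "accel_var x t = 0" if "t \<in> ?I" for t
    using that DDx vanish by (auto simp: accel_var_def R_zero)
  have D_UU: "D (accel_var x) t = 0" if "t \<in> ?I" for t by (rule D_vanishes[OF accel_var that])
  have jerk_var: "jerk_var x t = 0" if "t \<in> ?I" for t
    using that D_UU vanish by (auto simp: jerk_var_def R_zero)
  have sI: "s \<in> ?I" using s ab by auto
  have "state x t = 0"
  proof (rule linear_ode_zero[where a = a and b = b and A = jacobi_system and s = s])
    show "(state x has_vector_derivative jacobi_system t (state x t)) (at t within {a..b})" if "t \<in> {a..b}" for t
      using has_vector_derivative_within_subset[OF state_deriv[OF x] ab] that ab by auto
    show "linear (jacobi_system t)" if "t \<in> {a..b}" for t using jacobi_system_linear that ab by auto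
    show "continuous_on {a..b} (\<lambda>t. jacobi_system t u)" for u by (rule continuous_on_subset[OF jacobi_system_continuous ab])
    show "state x s = 0" using vanish[OF sI] Dx[OF sI] accel_var[OF sI] jerk_var[OF sI] by (simp add: state_def zero_prod_def)
  qed (use s t in auto)
  then show ?thesis by (simp add: state_def zero_prod_def)
qed

text \<open>The general results about forms on an interval use ordinary derivatives, whereas the index form uses
  covariant ones. \<open>jet1\<close> and \<open>jet2\<close> convert the former into the latter.\<close>

definition Gy where "Gy t u = G (p t) (y t) u"
definition dGy where "dGy t u = vector_derivative (\<lambda>s. Gy s u) (at t within S)"
definition jet1 where "jet1 t u0 u1 = u1 + Gy t u0"
definition jet2 where "jet2 t u0 u1 u2 = u2 + 2 *\<^sub>R Gy t u1 + dGy t u0 + Gy t (Gy t u0)"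

definition index_form_jets :: "real \<Rightarrow> 'e \<times> 'e \<times> 'e \<Rightarrow> 'e \<times> 'e \<times> 'e \<Rightarrow> real" where
  "index_form_jets t a b = index_form H t (fst a) (jet1 t (fst a) (fst (snd a))) (jet2 t (fst a) (fst (snd a)) (snd (snd a)))
     (fst b) (jet1 t (fst b) (fst (snd b))) (jet2 t (fst b) (fst (snd b)) (snd (snd b)))"

lemma Gy_linear: "t \<in> S \<Longrightarrow> linear (Gy t)"
  unfolding Gy_def[abs_def] by (rule bilinear_linear_right[OF G_bilinear[OF p_in_U]])

lemma Gy_smooth: "smooth_on S (\<lambda>t. Gy t u)"
  unfolding Gy_def by (intro G_along_smooth y_smooth smooth_on_const[OF S])

lemma dGy_smooth: "smooth_on S (\<lambda>t. dGy t u)"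
  unfolding dGy_def by (rule smooth_on_vector_derivative(2)[OF S Gy_smooth])

lemma dGy_deriv: "t \<in> S \<Longrightarrow> ((\<lambda>t. Gy t u) has_derivative (\<lambda>h. h *\<^sub>R dGy t u)) (at t within S)"
  using smooth_on_vector_derivative(1)[OF S Gy_smooth] by (simp add: dGy_def has_vector_derivative_def)

lemma dGy_linear: "t \<in> S \<Longrightarrow> linear (dGy t)"
  using has_derivative_linear_family[OF S _ Gy_linear dGy_deriv, of t 1] by simp

lemma D_jets:
  assumes x: "smooth_on S x" and t: "t \<in> S"
  defines "x' \<equiv> \<lambda>t. vector_derivative x (at t within S)"
  defines "x'' \<equiv> \<lambda>t. vector_derivative x' (at t within S)"
  shows "D x t = jet1 t (x t) (x' t)" "D (D x) t = jet2 t (x t) (x' t) (x'' t)"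
proof -
  have Dx: "D x t = jet1 t (x t) (x' t)" for t by (simp add: D_def jet1_def x'_def Gy_def)
  then show "D x t = jet1 t (x t) (x' t)" .
  have x': "smooth_on S x'" unfolding x'_def by (rule smooth_on_vector_derivative(2)[OF S x])
  have "((\<lambda>t. Gy t (x t)) has_vector_derivative dGy t (x t) + Gy t (x' t)) (at t within S)"
    using has_derivative_linear_apply[OF S t Gy_linear dGy_deriv[OF t]
        smooth_on_vector_derivative(1)[OF S x t, unfolded has_vector_derivative_def]]
    by (simp add: has_vector_derivative_def x'_def linear_scale[OF Gy_linear[OF t]] scaleR_add_right)
  with smooth_on_vector_derivative(1)[OF S x' t]
  have "(D x has_vector_derivative x'' t + (dGy t (x t) + Gy t (x' t))) (at t within S)"
    unfolding Dx[abs_def] jet1_def x''_def by (rule has_vector_derivative_add)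
  from D_eqI[OF t this] show "D (D x) t = jet2 t (x t) (x' t) (x'' t)"
    by (simp add: Dx jet1_def jet2_def Gy_def[symmetric] linear_add[OF Gy_linear[OF t]] scaleR_2)
qed

lemma index_form_jets_sym: "t \<in> S \<Longrightarrow> index_form_jets t a b = index_form_jets t b a"
  unfolding index_form_jets_def by (rule index_form_sym[OF _ H_sym])

lemma index_form_jets_bilinear:
  assumes t: "t \<in> S" shows "bilinear (index_form_jets t)"
proof -
  have "linear (\<lambda>a. index_form_jets t a b)" for b
    using linear_add[OF nablaR_linear[OF p_in_U[OF t]]] linear_scale[OF nablaR_linear[OF p_in_U[OF t]]] t
    by (intro linearI; simp add: index_form_jets_def index_form_def jet1_def jet2_def m_expand R_expand p_in_U
      linear_add[OF H_linear] linear_scale[OF H_linear] linear_add[OF Gy_linear] linear_scale[OF Gy_linear]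
      linear_add[OF dGy_linear] linear_scale[OF dGy_linear]
      bilinear_expand[OF trilinear_bilinear[OF nablaR_trilinear]] add_divide_distrib algebra_simps)
  moreover have "index_form_jets t a = (\<lambda>b. index_form_jets t b a)" for a
    by (rule ext) (rule index_form_jets_sym[OF t])
  ultimately show ?thesis unfolding bilinear_def by metis
qed

lemma index_form_jets_continuous: "continuous_on S (\<lambda>t. index_form_jets t a b)"
proof -
  have c: "\<And>c. smooth_on S (\<lambda>t. c)" by (rule smooth_on_const[OF S])
  have ms: "continuous_on S (\<lambda>t. m (p t) (f t) (g t))" if "smooth_on S f" "smooth_on S g" for f g
    by (rule smooth_on_imp_continuous_on[OF smooth_on_bilinear_apply[where B = "\<lambda>t. m (p t)",
            OF S _ along_smooth[OF m_smooth] that]]) (rule m_bilinear[OF p_in_U])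
  have Gyy: "smooth_on S (\<lambda>t. Gy t (f t))" if "smooth_on S f" for f
    by (rule smooth_on_linear_apply[OF S Gy_linear Gy_smooth that])
  have j1: "smooth_on S (\<lambda>t. jet1 t u0 u1)" for u0 u1
    unfolding jet1_def by (intro smooth_on_add[OF S] Gy_smooth c)
  have j2: "smooth_on S (\<lambda>t. jet2 t u0 u1 u2)" for u0 u1 u2
    unfolding jet2_def
    by (intro smooth_on_add[OF S] smooth_on_scaleR[OF S] Gyy Gy_smooth dGy_smooth c)
  show ?thesis
    unfolding index_form_jets_def index_form_def
    by (intro continuous_on_add continuous_on_diff continuous_on_divide continuous_on_const ms
      smooth_on_add[OF S] R_along_smooth nablaR_along_smooth H_smooth j1 j2 c y_smooth
      D_smooth[OF y_smooth] D_smooth[OF D_smooth[OF y_smooth]]) auto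
qed

lemma index_form_jets_positive:
  assumes t: "t \<in> S" and e: "e \<noteq> 0" shows "index_form_jets t (0, 0, e) (0, 0, e) > 0"
  using m_pos[OF p_in_U[OF t] e] linear_0[OF nablaR_linear[OF p_in_U[OF t]]] t
  by (simp add: index_form_jets_def index_form_def jet1_def jet2_def m_expand R_expand p_in_U linear_0[OF H_linear]
    linear_0[OF Gy_linear] linear_0[OF dGy_linear] R_zero
      bilinear_expand[OF trilinear_bilinear[OF nablaR_trilinear]])

lemma index_form_integral:
  assumes x: "solution x" and z: "solution z" and ce: "c \<le> e" "{c..e} \<subseteq> S" and zero: "z e = 0" "D z e = 0"
  defines "x' \<equiv> \<lambda>t. vector_derivative x (at t within S)"
  defines "z' \<equiv> \<lambda>t. vector_derivative z (at t within S)"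
  shows "((\<lambda>t. index_form_jets t (x t, x' t, vector_derivative x' (at t within S))
    (z t, z' t, vector_derivative z' (at t within S))) has_integral boundary_form x z c) {c..e}"
proof -
  note sx = solution_smooth[OF x] and sz = solution_smooth[OF z]
  have "(boundary_form x z has_vector_derivative - index_form_jets t (x t, x' t, vector_derivative x' (at t within S))
    (z t, z' t, vector_derivative z' (at t within S))) (at t within {c..e})" if t: "t \<in> {c..e}" for t
  proof -
    have tS: "t \<in> S" using t ce by auto
    show ?thesis
      using has_vector_derivative_within_subset[OF solution_boundary_form_deriv[OF x sz tS] ce(2)]
      by (simp add: index_form_jets_def x'_def z'_def D_jets[OF sx tS] D_jets[OF sz tS])
  qed
  from fundamental_theorem_of_calculus[OF ce(1) this]
  have "((\<lambda>t. - index_form_jets t (x t, x' t, vector_derivative x' (at t within S))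
    (z t, z' t, vector_derivative z' (at t within S))) has_integral boundary_form x z e - boundary_form x z c) {c..e}" .
  note has_integral_neg[OF this]
  moreover have "e \<in> S" using ce by auto
  then have "boundary_form x z e = 0" using zero by (simp add: boundary_form_def bilinear_rzero[OF m_bilinear] p_in_U)
  ultimately show ?thesis by simp
qed

lemma boundary_form_linear_combination:
  assumes K: "finite K" and c: "c \<in> S" and zero: "(\<Sum>k\<in>K. a k *\<^sub>R (z k c, D (z k) c)) = 0"
  shows "(\<Sum>k\<in>K. a k * boundary_form x (z k) c) = 0"
proof -
  have z: "(\<Sum>k\<in>K. a k *\<^sub>R z k c) = 0" "(\<Sum>k\<in>K. a k *\<^sub>R D (z k) c) = 0"
    using arg_cong[OF zero, of fst] arg_cong[OF zero, of snd] by (simp_all add: fst_sum snd_sum)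
  have lin: "(\<Sum>k\<in>K. a k * m (p c) u (f k)) = m (p c) u (\<Sum>k\<in>K. a k *\<^sub>R f k)" for u f
    using bilinear_linear_right[OF m_bilinear[OF p_in_U[OF c]], of u] by (simp add: linear_sum linear_scale)
  have "(\<Sum>k\<in>K. a k * boundary_form x (z k) c) = (\<Sum>k\<in>K. a k * m (p c) (jerk_var x c) (z k c))
      - (\<Sum>k\<in>K. a k * m (p c) (accel_var x c) (D (z k) c))
      + (\<Sum>k\<in>K. a k * m (p c) (R (p c) (y1 c) (y c) (x c)) (z k c)) / 2"
    by (simp add: boundary_form_def sum_subtractf[symmetric] sum.distrib[symmetric] sum_divide_distrib algebra_simps)
  also have "\<dots> = 0"
    unfolding lin z by (simp add: bilinear_rzero[OF m_bilinear] p_in_U c)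
  finally show ?thesis .
qed

text \<open>The Morse-theoretic step. The points of \<open>K\<close> serve as indices of the fields: \<open>X k\<close> has a double zero
  at \<open>k\<close>. As there are more than \<open>2 dim\<close> of them, some combination has a double zero at \<open>c\<close>. The
  interval has to be so short that the index form is definite; \<open>\<delta>\<close> depends only on \<open>[a, b]\<close>.\<close>

lemma some_field_vanishes:
  assumes ab: "{a..b} \<subseteq> S" "a < b"
  obtains \<delta> where "\<delta> > 0" and "\<And>c d K X. \<lbrakk>a \<le> c; c < d; d \<le> b; d - c < \<delta>;
      finite K; K \<subseteq> {c<..d}; DIM('e \<times> 'e) < card K;
      \<And>k. k \<in> K \<Longrightarrow> solution (X k); \<And>k. k \<in> K \<Longrightarrow> X k k = 0; \<And>k. k \<in> K \<Longrightarrow> D (X k) k = 0;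
      \<And>j k. j \<in> K \<Longrightarrow> k \<in> K \<Longrightarrow> boundary_form (X j) (X k) c = boundary_form (X k) (X j) c\<rbrakk>
    \<Longrightarrow> \<exists>k\<in>K. \<forall>t\<in>{a..b}. X k t = 0"
proof -
  have abS: "t \<in> S" if "t \<in> {a..b}" for t using that ab by auto
  obtain \<alpha> C where aC: "\<alpha> > 0" "C > 0" "\<And>t u0 u1 u2. t \<in> {a..b} \<Longrightarrow>
      \<alpha> * (norm u2)\<^sup>2 - C * ((norm u0)\<^sup>2 + (norm u1)\<^sup>2) \<le> index_form_jets t (u0, u1, u2) (u0, u1, u2)"
    using coercive_on_highest_order[of a b index_form_jets] index_form_jets_bilinear index_form_jets_positive
      continuous_on_subset[OF index_form_jets_continuous ab(1)] ab(2) abS by (metis less_imp_le)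
  define \<delta> where "\<delta> = min 1 (\<alpha> / (2 * C))"
  have main: "\<exists>k\<in>K. \<forall>t\<in>{a..b}. X k t = 0"
    if cd: "a \<le> c" "c < d" "d \<le> b" "d - c < \<delta>" and K: "finite K" "K \<subseteq> {c<..d}" "DIM('e \<times> 'e) < card K"
      and X: "\<And>k. k \<in> K \<Longrightarrow> solution (X k)" "\<And>k. k \<in> K \<Longrightarrow> X k k = 0" "\<And>k. k \<in> K \<Longrightarrow> D (X k) k = 0"
      and sym: "\<And>j k. j \<in> K \<Longrightarrow> k \<in> K \<Longrightarrow> boundary_form (X j) (X k) c = boundary_form (X k) (X j) c"
    for c d K and X :: "real \<Rightarrow> real \<Rightarrow> 'e"
  proof -
    define X1 where "X1 k = (\<lambda>t. vector_derivative (X k) (at t within S))" for k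
    define X2 where "X2 k = (\<lambda>t. vector_derivative (X1 k) (at t within S))" for k
    have cdS: "{c..d} \<subseteq> S" using cd ab by auto
    note smX = solution_smooth[OF X(1)]
    have smX1: "smooth_on S (X1 k)" if "k \<in> K" for k
      unfolding X1_def by (rule smooth_on_vector_derivative(2)[OF S smX[OF that]])
    have smX2: "smooth_on S (X2 k)" if "k \<in> K" for k
      unfolding X2_def by (rule smooth_on_vector_derivative(2)[OF S smX1[OF that]])
    have "{c<..d} \<subseteq> {c..d}" by auto
    then have kS: "k \<in> {c..d}" "k \<in> S" if "k \<in> K" for k using that K(2) cdS by blast+
    have X1zero: "X1 k k = 0" if "k \<in> K" for k
      using D_jets(1)[OF smX[OF that] kS(2)[OF that]] X(2,3)[OF that]
      by (simp add: X1_def jet1_def linear_0[OF Gy_linear[OF kS(2)[OF that]]])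
    obtain e where e: "\<exists>k\<in>K. e k \<noteq> 0" "(\<Sum>k\<in>K. e k *\<^sub>R (X k c, D (X k) c)) = 0"
      using nontrivial_vanishing_combination[OF K(1,3), of "\<lambda>k. (X k c, D (X k) c)"] by (elim exE conjE)
    have w: "(\<Sum>k\<in>K. e k *\<^sub>R (if t \<le> k then X k t else 0)) = 0" if t: "t \<in> {c..d}" for t
    proof (rule truncated_combination_vanishes[where s = "\<lambda>k. k" and ?x0.0 = X and ?x1.0 = X1 and ?x2.0 = X2
          and Q = index_form_jets and \<alpha> = \<alpha> and C = C and q = "\<lambda>j k. boundary_form (X j) (X k) c", OF K(1) kS(1) _ _ _ X(2) X1zero])
      show "(X k has_vector_derivative X1 k t) (at t within {c..d})" if "k \<in> K" "t \<in> {c..d}" for k t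
        using has_vector_derivative_within_subset[OF smooth_on_vector_derivative(1)[OF S smX[OF that(1)]] cdS]
          that cdS unfolding X1_def by blast
      show "(X1 k has_vector_derivative X2 k t) (at t within {c..d})" if "k \<in> K" "t \<in> {c..d}" for k t
        using has_vector_derivative_within_subset[OF smooth_on_vector_derivative(1)[OF S smX1[OF that(1)]] cdS]
          that cdS unfolding X2_def by blast
      show "continuous_on {c..d} (X2 k)" if "k \<in> K" for k
        by (rule continuous_on_subset[OF smooth_on_imp_continuous_on[OF smX2[OF that]] cdS])
      show "bilinear (index_form_jets t)" if "t \<in> {c..d}" for t using index_form_jets_bilinear that cdS by blast
      show "\<alpha> * (norm u2)\<^sup>2 - C * ((norm u0)\<^sup>2 + (norm u1)\<^sup>2) \<le> index_form_jets t (u0, u1, u2) (u0, u1, u2)"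
        if "t \<in> {c..d}" for t u0 u1 u2 using aC(3)[of t] that cd by auto
      show "0 < C" by (rule aC(2))
      show "d - c \<le> 1" using cd(4) by (simp add: \<delta>_def)
      have "d - c < \<alpha> / (2 * C)" using cd(4) by (simp add: \<delta>_def)
      then show "2 * C * (d - c) < \<alpha>" using aC(2) by (simp add: field_simps)
      show "((\<lambda>t. index_form_jets t (X j t, X1 j t, X2 j t) (X k t, X1 k t, X2 k t)) has_integral boundary_form (X j) (X k) c) {c..min j k}"
        if jk: "j \<in> K" "k \<in> K" for j k
      proof (cases "k \<le> j")
        case True
        have "{c..k} \<subseteq> S" "c \<le> k" using kS(1)[OF jk(2)] cdS by auto
        from index_form_integral[OF X(1)[OF jk(1)] X(1)[OF jk(2)] this(2,1) X(2,3)[OF jk(2)]]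
        show ?thesis using True by (simp add: X1_def X2_def min_absorb2)
      next
        case False
        have cj: "{c..j} \<subseteq> S" "c \<le> j" using kS(1)[OF jk(1)] cdS by auto
        have "((\<lambda>t. index_form_jets t (X k t, X1 k t, X2 k t) (X j t, X1 j t, X2 j t)) has_integral boundary_form (X k) (X j) c) {c..j}"
          using index_form_integral[OF X(1)[OF jk(2)] X(1)[OF jk(1)] cj(2,1) X(2,3)[OF jk(1)]]
          by (simp add: X1_def X2_def)
        then have "((\<lambda>t. index_form_jets t (X j t, X1 j t, X2 j t) (X k t, X1 k t, X2 k t)) has_integral boundary_form (X k) (X j) c) {c..j}"
          by (rule has_integral_eq[rotated]) (use cj(1) index_form_jets_sym in blast)
        then show ?thesis using False sym[OF jk] by (simp add: min_absorb1)
      qed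
      have "(\<Sum>j\<in>K. \<Sum>k\<in>K. e j * e k * boundary_form (X j) (X k) c) = (\<Sum>j\<in>K. e j * (\<Sum>k\<in>K. e k * boundary_form (X j) (X k) c))"
        by (simp add: sum_distrib_left mult.assoc)
      also have "\<dots> = 0"
      proof -
        have "c \<in> S" using cdS cd(2) by auto
        from boundary_form_linear_combination[OF K(1) this e(2)] show ?thesis by simp
      qed
      finally show "(\<Sum>j\<in>K. \<Sum>k\<in>K. e j * e k * boundary_form (X j) (X k) c) \<le> 0" by simp
    qed (use t in auto)
    \<comment> \<open>Between the last index \<open>k\<close> with nonzero coefficient and its predecessor \<open>l\<close>, only \<open>X k\<close>
      contributes to the truncated combination.\<close>
    define N where "N = {k \<in> K. e k \<noteq> 0}"
    have N: "finite N" "N \<noteq> {}" using K(1) e(1) by (auto simp: N_def)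
    define k where "k = Max N"
    have k: "k \<in> K" "e k \<noteq> 0" using Max_in[OF N] by (auto simp: k_def N_def)
    define l where "l = Max (insert c {j \<in> K. j < k})"
    have fin: "finite (insert c {j \<in> K. j < k})" using K(1) by simp
    have l: "l < k" "c \<le> l" "\<And>j. j \<in> K \<Longrightarrow> j < k \<Longrightarrow> j \<le> l"
      using Max_in[OF fin] Max_ge[OF fin] K(2) k(1) by (auto simp: l_def)
    have vanish: "X k t = 0" if t: "t \<in> S \<inter> {l<..<k}" for t
    proof -
      have tcd: "t \<in> {c..d}" using t l kS(1)[OF k(1)] by auto
      have "e j *\<^sub>R (if t \<le> j then X j t else 0) = (if j = k then e k *\<^sub>R X k t else 0)" if j: "j \<in> K" for j
      proof (cases "k < j")
        case True
        then have "j \<notin> N" using Max_ge[OF N(1), of j] by (auto simp: k_def)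
        then show ?thesis using j True by (simp add: N_def)
      next
        case False
        then show ?thesis using l(3)[OF j] t by (cases "j = k") auto
      qed
      then have "(\<Sum>j\<in>K. e j *\<^sub>R (if t \<le> j then X j t else 0)) = e k *\<^sub>R X k t"
        using K(1) k(1) by simp
      then show ?thesis using w[OF tcd] k(2) by simp
    qed
    have "(l + k) / 2 \<in> {a..b}" "(l + k) / 2 \<in> {l<..<k}"
      using l kS(1)[OF k(1)] cd by auto
    from solution_zero[OF X(1)[OF k(1)] ab(1) this vanish] k(1) show ?thesis by blast
  qed
  have \<delta>: "\<delta> > 0" using aC by (simp add: \<delta>_def)
  show thesis by (rule that[OF \<delta> main])
qed

end

section \<open>Smooth dependence and change of coordinates\<close>

text \<open>Smooth solvability of \<open>m(f, b) = k b\<close>, \<open>b \<in> B\<close>, by Gram-Schmidt: the new basis vector is replaced by its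
  component \<open>e\<close> orthogonal to the span of the old ones, and a multiple of \<open>e\<close> corrects the new
  equation without disturbing the old ones. Only divisions by \<open>m(e, b) > 0\<close> occur.\<close>

lemma smooth_riesz_on_subset:
  fixes m :: "'e::euclidean_space \<Rightarrow> 'e \<Rightarrow> 'e \<Rightarrow> real" and B :: "'e set"
  assumes U: "derivative_domain U" and bil: "\<And>x. x \<in> U \<Longrightarrow> bilinear (m x)"
    and sym: "\<And>x u v. x \<in> U \<Longrightarrow> m x u v = m x v u"
    and pos: "\<And>x u. x \<in> U \<Longrightarrow> u \<noteq> 0 \<Longrightarrow> m x u u > 0" and sm: "\<And>u v. smooth_on U (\<lambda>x. m x u v)"
    and B: "finite B" "B \<subseteq> Basis" and k: "\<And>b. b \<in> B \<Longrightarrow> smooth_on U (k b)"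
  shows "\<exists>f. smooth_on U f \<and> (\<forall>x\<in>U. f x \<in> span B \<and> (\<forall>b\<in>B. m x (f x) b = k b x))"
  using B k
proof (induction B arbitrary: k rule: finite_induct)
  case empty
  show ?case by (rule exI[of _ "\<lambda>_. 0"]) (simp add: smooth_on_const[OF U])
next
  case (insert b B)
  have bB: "b \<in> Basis" "b \<notin> span B"
  proof -
    show b: "b \<in> Basis" using insert.prems by simp
    have "b \<notin> span (Basis - {b})" using independent_Basis b by (auto simp: dependent_def)
    moreover have "B \<subseteq> Basis - {b}" using insert by auto
    ultimately show "b \<notin> span B" using span_mono by blast
  qed
  obtain f where f: "smooth_on U f" "\<And>x. x \<in> U \<Longrightarrow> f x \<in> span B"
    "\<And>x b. x \<in> U \<Longrightarrow> b \<in> B \<Longrightarrow> m x (f x) b = k b x"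
    using insert.IH[of k] insert.prems by auto
  obtain h where h: "smooth_on U h" "\<And>x. x \<in> U \<Longrightarrow> h x \<in> span B"
    "\<And>x c. x \<in> U \<Longrightarrow> c \<in> B \<Longrightarrow> m x (h x) c = m x b c"
    using insert.IH[of "\<lambda>c x. m x b c"] insert.prems sm by auto
  have mlin: "smooth_on U (\<lambda>x. m x (a x) u)" if "smooth_on U a" for a u
    by (rule smooth_on_linear_apply[where L = "\<lambda>x a. m x a u", OF U _ sm that])
      (rule bilinear_linear_left[OF bil])
  define e where "e x = b - h x" for x
  have e: "smooth_on U e" unfolding e_def[abs_def] by (intro smooth_on_diff[OF U] smooth_on_const[OF U] h(1))
  have orth: "m x (e x) c = 0" if "x \<in> U" "c \<in> B" for x c
    using h(3)[OF that] bil[OF that(1)] by (simp add: e_def bilinear_lsub)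
  have eb: "m x (e x) b > 0" if x: "x \<in> U" for x
  proof -
    have "m x (e x) w = 0" if "w \<in> span B" for w
      using linear_eq_0_on_span[OF bilinear_linear_right[OF bil[OF x]] _ that] orth[OF x] by blast
    then have "m x (e x) (h x) = 0" using h(2)[OF x] by blast
    then have "m x (e x) b = m x (e x) (e x)"
      using bil[OF x] by (simp add: e_def[of x] bilinear_rsub)
    moreover have "e x \<noteq> 0" using bB(2) h(2)[OF x] by (auto simp: e_def)
    ultimately show ?thesis using pos[OF x] by simp
  qed
  define l where "l x = (k b x - m x (f x) b) / m x (e x) b" for x
  have l: "smooth_on U l" unfolding l_def[abs_def]
    by (intro smooth_on_divide[OF U] smooth_on_diff[OF U] mlin f(1) e insert.prems) (use eb in force)+
  show ?case
  proof (intro exI conjI ballI)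
    show "smooth_on U (\<lambda>x. f x + l x *\<^sub>R e x)"
      by (intro smooth_on_add[OF U] smooth_on_scaleR[OF U] f(1) l e)
    fix x assume x: "x \<in> U"
    show "f x + l x *\<^sub>R e x \<in> span (insert b B)"
    proof -
      have "span B \<subseteq> span (insert b B)" by (rule span_mono) auto
      then have "f x \<in> span (insert b B)" "h x \<in> span (insert b B)"
        using f(2)[OF x] h(2)[OF x] by blast+
      then show ?thesis
        unfolding e_def by (intro span_add span_scale span_diff span_base[of b] insertI1)
    qed
    fix c assume c: "c \<in> insert b B"
    have "m x (f x + l x *\<^sub>R e x) c = m x (f x) c + l x * m x (e x) c"
      using bil[OF x] by (simp add: bilinear_ladd bilinear_lmul)
    then show "m x (f x + l x *\<^sub>R e x) c = k c x"
    proof (cases "c = b")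
      case True
      then show ?thesis using eb[OF x] bil[OF x] by (simp add: l_def bilinear_ladd bilinear_lmul)
    next
      case False
      then show ?thesis using c f(3)[OF x] orth[OF x] bil[OF x] by (simp add: bilinear_ladd bilinear_lmul)
    qed
  qed
qed

text \<open>This yields the smoothness of the Christoffel symbols and of the gradient, which are characterized by
  their products with arbitrary vectors.\<close>

lemma smooth_riesz:
  fixes m :: "'e::euclidean_space \<Rightarrow> 'e \<Rightarrow> 'e \<Rightarrow> real"
  assumes U: "derivative_domain U" and bil: "\<And>x. x \<in> U \<Longrightarrow> bilinear (m x)"
    and sym: "\<And>x u v. x \<in> U \<Longrightarrow> m x u v = m x v u"
    and pos: "\<And>x u. x \<in> U \<Longrightarrow> u \<noteq> 0 \<Longrightarrow> m x u u > 0" and sm: "\<And>u v. smooth_on U (\<lambda>x. m x u v)"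
    and k: "\<And>w. smooth_on U (\<lambda>x. k x w)" and f: "\<And>x w. x \<in> U \<Longrightarrow> m x (f x) w = k x w"
  shows "smooth_on U f"
proof -
  obtain h where h: "smooth_on U h" "\<And>x b. x \<in> U \<Longrightarrow> b \<in> Basis \<Longrightarrow> m x (h x) b = k x b"
    using smooth_riesz_on_subset[OF U bil sym pos sm finite_Basis order_refl, of "\<lambda>b x. k x b"] k by auto
  have "h x = f x" if x: "x \<in> U" for x
  proof -
    have "m x (h x - f x) b = 0" if "b \<in> Basis" for b
      using h(2)[OF x that] f[OF x] bil[OF x] by (simp add: bilinear_lsub)
    then have "m x (h x - f x) w = 0" for w
      using linear_eq_0_on_span[OF bilinear_linear_right[OF bil[OF x]], of Basis] span_Basis by blast
    then show ?thesis using pos[OF x, of "h x - f x"] by fastforce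
  qed
  then show ?thesis using smooth_on_cong[OF U] h(1) by metis
qed

lemma (in coordinate_metric) hessian_sym:
  assumes x: "x \<in> U" and gr: "smooth_on U gr" and f: "smooth_on U f"
    and grad: "\<And>x w. x \<in> U \<Longrightarrow> m x (gr x) w = frechet_derivative f (at x) w"
  shows "m x (frechet_derivative gr (at x) u + G x u (gr x)) w =
    m x (frechet_derivative gr (at x) w + G x w (gr x)) u"
proof -
  have *: "frechet_derivative (\<lambda>y. frechet_derivative f (at y) w) (at x) u =
      m x (frechet_derivative gr (at x) u + G x u (gr x)) w + m x (gr x) (0 + G x u w)" for u w
  proof -
    have "((\<lambda>y. frechet_derivative f (at y) w) has_derivative
        (\<lambda>h. m x (frechet_derivative gr (at x) h + G x h (gr x)) w + m x (gr x) (0 + G x h w))) (at x)"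
      by (rule has_derivative_transform_within_open[OF
          m_apply_deriv[OF x smooth_has_derivative[OF gr x] has_derivative_const] U x]) (simp add: grad)
    from fun_cong[OF frechet_derivative_at[OF this], of u] show ?thesis by simp
  qed
  show ?thesis
    using second_derivative_sym[OF U f x, of w u] unfolding * by (simp add: G_sym[OF x, of u w])
qed

text \<open>The algebra behind the uniqueness of the Levi-Civita connection.\<close>

lemma antisymmetric_symmetric_zero:
  fixes T :: "'a \<Rightarrow> 'a \<Rightarrow> 'a \<Rightarrow> real"
  assumes "\<And>u v w. T u v w = T v u w" "\<And>u v w. T u v w = - T u w v"
  shows "T u v w = 0"
  using assms(1)[of u v w] assms(2)[of u v w] assms(1)[of u w v] assms(2)[of w u v]
    assms(1)[of w v u] assms(2)[of v w u] by linarith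

text \<open>A change of coordinates \<open>\<phi>\<close> on the overlap \<open>V\<close> of two charts.\<close>

locale coordinate_change = X: coordinate_metric U m G + Y: coordinate_metric U' m' G'
  for U U' :: "'e::euclidean_space set" and m G m' G' +
  fixes V :: "'e set" and \<phi> :: "'e \<Rightarrow> 'e"
  assumes V: "open V" and VU: "V \<subseteq> U" and \<phi>_smooth: "smooth_on V \<phi>" and \<phi>_in: "x \<in> V \<Longrightarrow> \<phi> x \<in> U'"
    and isometry: "x \<in> V \<Longrightarrow> m x u v =
      m' (\<phi> x) (frechet_derivative \<phi> (at x) u) (frechet_derivative \<phi> (at x) v)"
    and \<phi>_surj: "x \<in> V \<Longrightarrow> surj (frechet_derivative \<phi> (at x))"
begin

definition d\<phi> where "d\<phi> x u = frechet_derivative \<phi> (at x) u"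
definition dd\<phi> where "dd\<phi> x v u = frechet_derivative (\<lambda>y. d\<phi> y u) (at x) v"
definition ddd\<phi> where "ddd\<phi> x w v u = frechet_derivative (\<lambda>y. dd\<phi> y v u) (at x) w"

lemma domV: "derivative_domain V" by (rule derivative_domain_open[OF V])

lemma within_V: "x \<in> V \<Longrightarrow> at x within V = at x" by (rule at_within_open[OF _ V])

lemma d\<phi>_smooth: "smooth_on V (\<lambda>x. d\<phi> x u)"
  unfolding d\<phi>_def by (rule smooth_on_open_derivative(1)[OF V \<phi>_smooth])

lemma dd\<phi>_smooth: "smooth_on V (\<lambda>x. dd\<phi> x v u)"
  unfolding dd\<phi>_def by (rule smooth_on_open_derivative(1)[OF V d\<phi>_smooth])

lemma \<phi>_deriv: "x \<in> V \<Longrightarrow> (\<phi> has_derivative d\<phi> x) (at x)"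
  unfolding d\<phi>_def[abs_def] by (rule smooth_on_open_derivative(2)[OF V \<phi>_smooth])

lemma d\<phi>_deriv: "x \<in> V \<Longrightarrow> ((\<lambda>y. d\<phi> y u) has_derivative (\<lambda>v. dd\<phi> x v u)) (at x)"
  unfolding dd\<phi>_def by (rule smooth_on_open_derivative(2)[OF V d\<phi>_smooth])

lemma dd\<phi>_deriv: "x \<in> V \<Longrightarrow> ((\<lambda>y. dd\<phi> y v u) has_derivative (\<lambda>w. ddd\<phi> x w v u)) (at x)"
  unfolding ddd\<phi>_def by (rule smooth_on_open_derivative(2)[OF V dd\<phi>_smooth])

lemma d\<phi>_linear: "x \<in> V \<Longrightarrow> linear (d\<phi> x)"
  by (rule has_derivative_linear[OF \<phi>_deriv])

lemma dd\<phi>_sym: "x \<in> V \<Longrightarrow> dd\<phi> x u v = dd\<phi> x v u"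
  unfolding dd\<phi>_def d\<phi>_def by (rule second_derivative_sym[OF V \<phi>_smooth])

lemma ddd\<phi>_sym: "x \<in> V \<Longrightarrow> ddd\<phi> x w v u = ddd\<phi> x v w u"
  unfolding ddd\<phi>_def dd\<phi>_def by (rule second_derivative_sym[OF V d\<phi>_smooth])

lemma along_\<phi>_deriv:
  assumes x: "x \<in> V" and f: "(f has_derivative f') (at (\<phi> x))"
  shows "((\<lambda>y. f (\<phi> y)) has_derivative (\<lambda>h. f' (d\<phi> x h))) (at x)"
  by (rule has_derivative_compose[OF \<phi>_deriv[OF x] f])

text \<open>Differentiating the isometry condition shows that the defect \<open>\<delta>\<close> of the rule satisfies the
  compatibility equation without derivatives; it is also symmetric, so it vanishes.\<close>

lemma christoffel_transform:
  assumes x: "x \<in> V"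
  shows "d\<phi> x (G x u v) = G' (\<phi> x) (d\<phi> x u) (d\<phi> x v) + dd\<phi> x u v"
proof -
  have xU: "x \<in> U" and yU: "\<phi> x \<in> U'" using x VU \<phi>_in by auto
  define \<delta> where "\<delta> u v = d\<phi> x (G x u v) - G' (\<phi> x) (d\<phi> x u) (d\<phi> x v) - dd\<phi> x u v" for u v
  have iso: "m y u v = m' (\<phi> y) (d\<phi> y u) (d\<phi> y v)" if "y \<in> V" for y u v
    using isometry[OF that] by (simp add: d\<phi>_def)
  have compat: "m' (\<phi> x) (\<delta> u v) (d\<phi> x w) + m' (\<phi> x) (\<delta> u w) (d\<phi> x v) = 0" for u v w
  proof -
    have m': "((\<lambda>y. m' (\<phi> y) a b) has_derivative
        (\<lambda>h. m' (\<phi> x) (G' (\<phi> x) (d\<phi> x h) a) b + m' (\<phi> x) a (G' (\<phi> x) (d\<phi> x h) b))) (at x)" for a b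
      using along_\<phi>_deriv[OF x Y.m_apply_deriv[OF yU has_derivative_const has_derivative_const]] by simp
    have "((\<lambda>y. m' (\<phi> y) (d\<phi> y v) (d\<phi> y w)) has_derivative
       (\<lambda>h. (m' (\<phi> x) (G' (\<phi> x) (d\<phi> x h) (d\<phi> x v)) (d\<phi> x w) + m' (\<phi> x) (d\<phi> x v) (G' (\<phi> x) (d\<phi> x h) (d\<phi> x w)))
        + m' (\<phi> x) (dd\<phi> x h v) (d\<phi> x w) + m' (\<phi> x) (d\<phi> x v) (dd\<phi> x h w))) (at x within V)"
      by (rule has_derivative_bilinear_apply[where B = "\<lambda>y. m' (\<phi> y)", OF domV x])
        (auto simp: within_V x intro: Y.m_bilinear \<phi>_in m' d\<phi>_deriv)
    then have "((\<lambda>y. m y v w) has_derivative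
       (\<lambda>h. (m' (\<phi> x) (G' (\<phi> x) (d\<phi> x h) (d\<phi> x v)) (d\<phi> x w) + m' (\<phi> x) (d\<phi> x v) (G' (\<phi> x) (d\<phi> x h) (d\<phi> x w)))
        + m' (\<phi> x) (dd\<phi> x h v) (d\<phi> x w) + m' (\<phi> x) (d\<phi> x v) (dd\<phi> x h w))) (at x)"
      unfolding within_V[OF x] by (rule has_derivative_transform_within_open[OF _ V x]) (simp add: iso)
    from frechet_derivative_at[OF this, THEN fun_cong, of u] X.G_compat[OF xU, of v w u]
    have "m x (G x u v) w + m x v (G x u w) =
        (m' (\<phi> x) (G' (\<phi> x) (d\<phi> x u) (d\<phi> x v)) (d\<phi> x w) + m' (\<phi> x) (d\<phi> x v) (G' (\<phi> x) (d\<phi> x u) (d\<phi> x w)))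
        + m' (\<phi> x) (dd\<phi> x u v) (d\<phi> x w) + m' (\<phi> x) (d\<phi> x v) (dd\<phi> x u w)" by simp
    then show ?thesis
      by (simp add: iso[OF x] \<delta>_def Y.m_expand yU Y.m_sym[OF yU, of "d\<phi> x v"])
  qed
  have "m' (\<phi> x) (\<delta> u v) (d\<phi> x w) = 0" for w
  proof (rule antisymmetric_symmetric_zero[where T = "\<lambda>u v w. m' (\<phi> x) (\<delta> u v) (d\<phi> x w)"])
    show "m' (\<phi> x) (\<delta> u v) (d\<phi> x w) = m' (\<phi> x) (\<delta> v u) (d\<phi> x w)" for u v w
      by (simp add: \<delta>_def X.G_sym[OF xU, of u v] Y.G_sym[OF yU, of "d\<phi> x u" "d\<phi> x v"] dd\<phi>_sym[OF x, of u v])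
    show "m' (\<phi> x) (\<delta> u v) (d\<phi> x w) = - m' (\<phi> x) (\<delta> u w) (d\<phi> x v)" for u v w
      using compat[of u v w] by simp
  qed
  moreover obtain w where "\<delta> u v = d\<phi> x w" using \<phi>_surj[OF x] by (auto simp: surj_def d\<phi>_def)
  ultimately have "m' (\<phi> x) (\<delta> u v) (\<delta> u v) = 0" by simp
  then have "\<delta> u v = 0" using Y.m_pos[OF yU, of "\<delta> u v"] by auto
  then show ?thesis by (simp add: \<delta>_def algebra_simps)
qed

text \<open>Differentiate the transformation rule of the Christoffel symbols and antisymmetrize: the second and
  third derivatives of \<open>\<phi>\<close> are symmetric and drop out.\<close>

lemma curvature_transform:
  assumes x: "x \<in> V"
  shows "d\<phi> x (X.R x w u v) = Y.R (\<phi> x) (d\<phi> x w) (d\<phi> x u) (d\<phi> x v)"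
proof -
  have xU: "x \<in> U" and yU: "\<phi> x \<in> U'" using x VU \<phi>_in by auto
  note lin = linear_add[OF d\<phi>_linear[OF x]] linear_diff[OF d\<phi>_linear[OF x]]
  have *: "dd\<phi> x w (G x u v) + d\<phi> x (X.dG x w u v) =
      Y.dG (\<phi> x) (d\<phi> x w) (d\<phi> x u) (d\<phi> x v) + G' (\<phi> x) (dd\<phi> x w u) (d\<phi> x v)
      + G' (\<phi> x) (d\<phi> x u) (dd\<phi> x w v) + ddd\<phi> x w u v" for w u v
  proof -
    have "((\<lambda>y. d\<phi> y (G y u v)) has_derivative (\<lambda>h. dd\<phi> x h (G x u v) + d\<phi> x (X.dG x h u v))) (at x within V)"
      by (rule has_derivative_linear_apply[OF domV x d\<phi>_linear])
        (auto simp: within_V x intro: d\<phi>_deriv X.G_deriv xU)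
    moreover have "((\<lambda>y. G' (\<phi> y) (d\<phi> y u) (d\<phi> y v)) has_derivative
        (\<lambda>h. Y.dG (\<phi> x) (d\<phi> x h) (d\<phi> x u) (d\<phi> x v) + G' (\<phi> x) (dd\<phi> x h u) (d\<phi> x v)
          + G' (\<phi> x) (d\<phi> x u) (dd\<phi> x h v))) (at x within V)"
      by (rule has_derivative_bilinear_apply[where B = "\<lambda>y. G' (\<phi> y)", OF domV x])
        (auto simp: within_V x intro: Y.G_bilinear \<phi>_in along_\<phi>_deriv[OF x Y.G_deriv[OF yU]] d\<phi>_deriv)
    then have "((\<lambda>y. G' (\<phi> y) (d\<phi> y u) (d\<phi> y v) + dd\<phi> y u v) has_derivative
        (\<lambda>h. Y.dG (\<phi> x) (d\<phi> x h) (d\<phi> x u) (d\<phi> x v) + G' (\<phi> x) (dd\<phi> x h u) (d\<phi> x v)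
          + G' (\<phi> x) (d\<phi> x u) (dd\<phi> x h v) + ddd\<phi> x h u v)) (at x within V)"
      unfolding within_V[OF x] by (rule has_derivative_add[OF _ dd\<phi>_deriv[OF x]])
    then have "((\<lambda>y. d\<phi> y (G y u v)) has_derivative
        (\<lambda>h. Y.dG (\<phi> x) (d\<phi> x h) (d\<phi> x u) (d\<phi> x v) + G' (\<phi> x) (dd\<phi> x h u) (d\<phi> x v)
          + G' (\<phi> x) (d\<phi> x u) (dd\<phi> x h v) + ddd\<phi> x h u v)) (at x within V)"
      by (rule has_derivative_transform[OF x, rotated]) (simp add: christoffel_transform)
    ultimately show ?thesis using has_derivative_within_unique[OF domV x] by (metis (no_types, lifting))
  qed
  have e: "d\<phi> x (X.dG x w u v) =
      Y.dG (\<phi> x) (d\<phi> x w) (d\<phi> x u) (d\<phi> x v) + G' (\<phi> x) (dd\<phi> x w u) (d\<phi> x v)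
      + G' (\<phi> x) (d\<phi> x u) (dd\<phi> x w v) + ddd\<phi> x w u v - dd\<phi> x w (G x u v)" for w u v
    using *[of w u v] by (simp add: algebra_simps)
  show ?thesis
    by (simp add: X.R_def Y.R_def lin e christoffel_transform[OF x] Y.G_expand yU
        dd\<phi>_sym[OF x, of u w] ddd\<phi>_sym[OF x, of u w])
qed

end

section \<open>Coordinate expressions on a Riemannian manifold\<close>

context riemannian_manifold
begin

abbreviation chart_image where "chart_image c \<equiv> chart_map c ` chart_dom c"

lemma chart_imageE:
  assumes "c \<in> A" "x \<in> chart_image c"
  shows "c \<in> charts_at (chart_inv c x)" "chart_map c (chart_inv c x) = x"
proof -
  obtain r where r: "x = chart_map c r" "c \<in> charts_at r" using assms by (auto simp: charts_at_def)
  show "c \<in> charts_at (chart_inv c x)" "chart_map c (chart_inv c x) = x"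
    using r by (simp_all add: chart_inv_map)
qed

lemma charts_atD: "c \<in> charts_at p \<Longrightarrow> c \<in> A" "c \<in> charts_at p \<Longrightarrow> chart_map c p \<in> chart_image c"
  by (auto simp: charts_at_def)

lemma christoffel_levi_civita:
  assumes "c \<in> A" "x \<in> chart_image c" shows "is_levi_civita_form c x (christoffel c x)"
  unfolding christoffel_def by (rule theI'[OF levi_civita_form_ex1[OF assms]])

lemma local_metric_smooth: "c \<in> A \<Longrightarrow> smooth_on (chart_image c) (\<lambda>x. local_metric c x u v)"
  unfolding local_metric_def by (rule metric_smooth)

lemma christoffel_smooth:
  assumes c: "c \<in> A" shows "smooth_on (chart_image c) (\<lambda>x. christoffel c x u v)"
proof (rule smooth_riesz[where m = "local_metric c"])
  let ?d = "\<lambda>x u v w. frechet_derivative (\<lambda>y. local_metric c y v w) (at x) u"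
  show dom: "derivative_domain (chart_image c)" by (rule derivative_domain_open[OF open_chart_image[OF c]])
  have d: "smooth_on (chart_image c) (\<lambda>x. ?d x u v w)" for u v w
    by (rule smooth_on_open_derivative(1)[OF open_chart_image[OF c] local_metric_smooth[OF c]])
  show "smooth_on (chart_image c) (\<lambda>x. (?d x u v w + ?d x v u w - ?d x w u v) / 2)" for w
    by (intro smooth_on_divide[OF dom] smooth_on_add[OF dom] smooth_on_diff[OF dom] d smooth_on_const[OF dom]) simp
  show "local_metric c x (christoffel c x u v) w = (?d x u v w + ?d x v u w - ?d x w u v) / 2"
    if x: "x \<in> chart_image c" for x w
  proof -
    note l = christoffel_levi_civita[OF c x]
    have d: "?d x u v w = local_metric c x (christoffel c x u v) w + local_metric c x v (christoffel c x u w)"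
      and s: "christoffel c x u v = christoffel c x v u" for u v w
      using l unfolding is_levi_civita_form_def by blast+
    note ms = local_metric_sym[OF c x]
    show ?thesis unfolding d
      by (simp add: s[of v u] s[of w u] s[of w v] ms[of v "christoffel c x u w"])
  qed
qed (use local_metric_bilinear[OF c] local_metric_sym[OF c] local_metric_pos[OF c] local_metric_smooth[OF c]
  in auto)

lemma coordinate_metric_chart:
  assumes c: "c \<in> A" shows "coordinate_metric (chart_image c) (local_metric c) (christoffel c)"
proof
  show "open (chart_image c)" by (rule open_chart_image[OF c])
  show "smooth_on (chart_image c) (\<lambda>x. local_metric c x u v)" for u v by (rule local_metric_smooth[OF c])
  show "smooth_on (chart_image c) (\<lambda>x. christoffel c x u v)" for u v by (rule christoffel_smooth[OF c])
  fix x u v w assume x: "x \<in> chart_image c"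
  note l = christoffel_levi_civita[OF c x, unfolded is_levi_civita_form_def]
  show "bilinear (local_metric c x)" by (rule local_metric_bilinear[OF c x])
  show "local_metric c x u v = local_metric c x v u" by (rule local_metric_sym[OF c x])
  show "0 < local_metric c x u u" if "u \<noteq> 0" using local_metric_pos[OF c x that] .
  show "bilinear (christoffel c x)" by (rule l[THEN conjunct1])
  show "christoffel c x u v = christoffel c x v u"
    by (rule l[THEN conjunct2, THEN conjunct1, rule_format])
  show "frechet_derivative (\<lambda>y. local_metric c y v w) (at x) u =
      local_metric c x (christoffel c x u v) w + local_metric c x v (christoffel c x u w)"
    by (rule l[THEN conjunct2, THEN conjunct2, rule_format])
qed

lemma tangent_transform:
  "v \<in> tangent_space p \<Longrightarrow> c \<in> charts_at p \<Longrightarrow> c' \<in> charts_at p \<Longrightarrow>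
    v c' = frechet_derivative (transition c c') (at (chart_map c p)) (v c)"
  unfolding tangent_space_def by (elim CollectE conjE) (drule bspec, assumption, drule bspec)

lemma tangent_outside: "v \<in> tangent_space p \<Longrightarrow> c \<notin> charts_at p \<Longrightarrow> v c = 0"
  unfolding tangent_space_def by (drule CollectD, drule conjunct1, drule spec, drule mp)

lemma tangentI:
  assumes "\<And>c. c \<notin> charts_at p \<Longrightarrow> v c = 0"
    and "\<And>c c'. c \<in> charts_at p \<Longrightarrow> c' \<in> charts_at p \<Longrightarrow>
      v c' = frechet_derivative (transition c c') (at (chart_map c p)) (v c)"
  shows "v \<in> tangent_space p"
  unfolding tangent_space_def
proof (intro CollectI conjI allI impI ballI)
  show "v c = 0" if "c \<notin> charts_at p" for c by (rule assms(1)[OF that])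
  show "v c' = frechet_derivative (transition c c') (at (chart_map c p)) (v c)"
    if "c \<in> charts_at p" "c' \<in> charts_at p" for c c' by (rule assms(2)[OF that])
qed

lemma tvec_of_tangent_vector:
  assumes "v \<in> tangent_space p" "c \<in> charts_at p" shows "tvec_of c (v c) p = v"
proof
  fix c'
  show "tvec_of c (v c) p c' = v c'"
    using tangent_transform[OF assms, of c'] tangent_outside[OF assms(1), of c']
    by (cases "c' \<in> charts_at p") (simp_all add: tvec_of_def)
qed

lemma local_metric_eq:
  assumes "u \<in> tangent_space p" "v \<in> tangent_space p" "c \<in> charts_at p"
  shows "local_metric c (chart_map c p) (u c) (v c) = g p u v"
  using assms by (simp add: local_metric_def chart_inv_map tvec_of_tangent_vector)

lemma transition_map: "c \<in> charts_at p \<Longrightarrow> transition c c' (chart_map c p) = chart_map c' p"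
  by (simp add: transition_def chart_inv_map)

lemma coordinate_change_transition:
  assumes c: "c \<in> A" "c' \<in> A"
  shows "coordinate_change (chart_image c) (chart_image c') (local_metric c) (christoffel c)
    (local_metric c') (christoffel c') (chart_map c ` (chart_dom c \<inter> chart_dom c')) (transition c c')"
proof -
  interpret X: coordinate_metric "chart_image c" "local_metric c" "christoffel c"
    by (rule coordinate_metric_chart[OF c(1)])
  interpret Y: coordinate_metric "chart_image c'" "local_metric c'" "christoffel c'"
    by (rule coordinate_metric_chart[OF c(2)])
  show ?thesis
  proof
    show "open (chart_map c ` (chart_dom c \<inter> chart_dom c'))"
      by (rule open_chart_map_image[OF c(1) open_chart_dom[OF c(2)]])
    show "smooth_on (chart_map c ` (chart_dom c \<inter> chart_dom c')) (transition c c')"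
      by (rule transition_smooth[OF c])
    fix x assume "x \<in> chart_map c ` (chart_dom c \<inter> chart_dom c')"
    then obtain r where r: "x = chart_map c r" "c \<in> charts_at r" "c' \<in> charts_at r"
      using c by (auto simp: charts_at_def)
    show "transition c c' x \<in> chart_image c'" using r by (simp add: transition_map charts_atD)
    show "local_metric c x u v = local_metric c' (transition c c' x)
        (frechet_derivative (transition c c') (at x) u) (frechet_derivative (transition c c') (at x) v)" for u v
      using local_metric_eq[OF tvec_of_tangent[OF r(2)] tvec_of_tangent[OF r(2)] r(2), of u v]
        local_metric_eq[OF tvec_of_tangent[OF r(2)] tvec_of_tangent[OF r(2)] r(3), of u v] r
      by (simp add: tvec_of_chart transition_map) (simp add: tvec_of_def)
    show "surj (frechet_derivative (transition c c') (at x))"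
    proof (rule surjI)
      show "frechet_derivative (transition c c') (at x)
          (frechet_derivative (transition c' c) (at (chart_map c' r)) u) = u" for u
        using transition_derivative_compose[OF r(3,2,3), of u] transition_derivative_same[OF r(3)] r(1) by simp
    qed
  qed auto
qed

lemma frechet_derivative_chart_cong:
  assumes c: "c \<in> charts_at p" and eq: "\<And>x. x \<in> chart_image c \<Longrightarrow> f x = h x"
  shows "frechet_derivative f (at (chart_map c p)) = frechet_derivative h (at (chart_map c p))"
  using frechet_derivative_cong_within[OF eq charts_atD(2)[OF c]]
    at_within_open[OF charts_atD(2)[OF c] open_chart_image[OF charts_atD(1)[OF c]]] by simp

text \<open>Curvature and its derivative are defined by extending vectors to fields with constant coordinates in
  the chart; for those fields only the Christoffel term of \<open>\<nabla>\<close> remains, and they commute.\<close>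

lemma nabla_constant_field:
  assumes c: "c \<in> charts_at p"
  shows "nabla X (tvec_of c w) p c = christoffel c (chart_map c p) (X p c) w"
proof -
  have "frechet_derivative (\<lambda>x. tvec_of c w (chart_inv c x) c) (at (chart_map c p)) =
      frechet_derivative (\<lambda>x. w) (at (chart_map c p))"
    by (rule frechet_derivative_chart_cong[OF c])
      (simp add: tvec_of_chart chart_imageE charts_atD(1)[OF c])
  then show ?thesis
    using c by (simp add: nabla_def dir_deriv_def tvec_of_chart frechet_derivative_const)
qed

lemma nabla_chart:
  assumes c: "c \<in> charts_at p" and eq: "\<And>x. x \<in> chart_image c \<Longrightarrow> Y (chart_inv c x) c = h x"
  shows "nabla X Y p c = frechet_derivative h (at (chart_map c p)) (X p c)
    + christoffel c (chart_map c p) (X p c) (h (chart_map c p))"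
  using frechet_derivative_chart_cong[OF c, of "\<lambda>x. Y (chart_inv c x) c" h] eq
    eq[OF charts_atD(2)[OF c]] c
  by (simp add: nabla_def dir_deriv_def chart_inv_map)

lemma curvature_chart:
  assumes c: "c \<in> charts_at p"
  shows "curvature p u v w c = coordinate_metric.R (christoffel c) (chart_map c p) (u c) (v c) (w c)"
proof -
  interpret C: coordinate_metric "chart_image c" "local_metric c" "christoffel c"
    by (rule coordinate_metric_chart[OF charts_atD(1)[OF c]])
  have cA: "c \<in> A" by (rule charts_atD(1)[OF c])
  have nn: "nabla (tvec_of c a) (nabla (tvec_of c b) (tvec_of c e)) p c =
      C.dG (chart_map c p) a b e + christoffel c (chart_map c p) a (christoffel c (chart_map c p) b e)" for a b e
  proof -
    have "nabla (tvec_of c b) (tvec_of c e) (chart_inv c x) c = christoffel c x b e" if "x \<in> chart_image c" for x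
      using nabla_constant_field[OF chart_imageE(1)[OF cA that]] chart_imageE[OF cA that]
      by (simp add: tvec_of_chart)
    from nabla_chart[OF c, of "nabla (tvec_of c b) (tvec_of c e)" "\<lambda>x. christoffel c x b e", OF this]
    show ?thesis using c by (simp add: tvec_of_chart C.dG_def)
  qed
  have "lie_bracket (tvec_of c a) (tvec_of c b) p c = 0" for a b
  proof -
    have "dir_deriv (tvec_of c a) (tvec_of c b) p c = 0" for a b
      using nabla_constant_field[OF c, of "tvec_of c a" b] c by (simp add: nabla_def tvec_of_chart)
    then show ?thesis by (simp add: lie_bracket_def)
  qed
  then have "nabla (lie_bracket (tvec_of c a) (tvec_of c b)) (tvec_of c e) p c = 0" for a b e
    using nabla_constant_field[OF c, of "lie_bracket (tvec_of c a) (tvec_of c b)" e]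
    by (simp add: bilinear_lzero[OF C.G_bilinear] charts_atD[OF c])
  then show ?thesis
    by (simp add: curvature_def curvature_fields_def nn C.R_def)
qed

lemma nabla_curvature_chart:
  assumes c: "c \<in> charts_at p"
  shows "nabla_curvature p a u v w c =
    coordinate_metric.nablaR (christoffel c) (chart_map c p) (a c) (u c) (v c) (w c)"
proof -
  interpret C: coordinate_metric "chart_image c" "local_metric c" "christoffel c"
    by (rule coordinate_metric_chart[OF charts_atD(1)[OF c]])
  have cA: "c \<in> A" by (rule charts_atD(1)[OF c])
  have "nabla (tvec_of c (a c)) (\<lambda>r. curvature r (tvec_of c (u c) r) (tvec_of c (v c) r) (tvec_of c (w c) r)) p c =
      C.dR (chart_map c p) (a c) (u c) (v c) (w c) +
      christoffel c (chart_map c p) (a c) (C.R (chart_map c p) (u c) (v c) (w c))"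
    by (subst nabla_chart[OF c, of _ "\<lambda>x. C.R x (u c) (v c) (w c)"])
      (simp_all add: curvature_chart chart_imageE cA tvec_of_chart c C.dR_def)
  then show ?thesis
    by (simp add: nabla_curvature_def Let_def curvature_chart[OF c] nabla_constant_field[OF c]
        tvec_of_chart[OF c] C.nablaR_def)
qed

lemma curvature_tangent:
  assumes "u \<in> tangent_space p" "v \<in> tangent_space p" "w \<in> tangent_space p"
  shows "curvature p u v w \<in> tangent_space p"
  unfolding tangent_space_def
proof (intro CollectI conjI allI impI ballI)
  show "curvature p u v w c = 0" if "c \<notin> charts_at p" for c
    using that by (simp add: curvature_def curvature_fields_def nabla_def)
  fix c c' assume c: "c \<in> charts_at p" "c' \<in> charts_at p"
  interpret T: coordinate_change "chart_image c" "chart_image c'" "local_metric c" "christoffel c"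
    "local_metric c'" "christoffel c'" "chart_map c ` (chart_dom c \<inter> chart_dom c')" "transition c c'"
    by (rule coordinate_change_transition[OF charts_atD(1)[OF c(1)] charts_atD(1)[OF c(2)]])
  have x: "chart_map c p \<in> chart_map c ` (chart_dom c \<inter> chart_dom c')"
    using c by (auto simp: charts_at_def)
  show "curvature p u v w c' = frechet_derivative (transition c c') (at (chart_map c p)) (curvature p u v w c)"
    using T.curvature_transform[OF x, of "u c" "v c" "w c"] c
    by (simp add: curvature_chart T.d\<phi>_def transition_map tangent_transform[OF assms(1) c]
        tangent_transform[OF assms(2) c] tangent_transform[OF assms(3) c])
qed

lemma tangent_add:
  assumes u: "u \<in> tangent_space p" and v: "v \<in> tangent_space p"
  shows "(\<lambda>c. u c + v c) \<in> tangent_space p"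
proof (rule tangentI)
  show "u c + v c = 0" if "c \<notin> charts_at p" for c
    using tangent_outside[OF u that] tangent_outside[OF v that] by simp
  show "u c' + v c' = frechet_derivative (transition c c') (at (chart_map c p)) (u c + v c)"
    if "c \<in> charts_at p" "c' \<in> charts_at p" for c c'
    using tangent_transform[OF u that] tangent_transform[OF v that]
      linear_add[OF has_derivative_linear[OF transition_has_derivative[OF that]]] by simp
qed

text \<open>The gradient is defined by a condition in all charts at once. The vector that represents the
  differential in one chart satisfies it by the chain rule, and it is the only one by the
  uniqueness of representing vectors in that chart.\<close>

lemma grad_chart:
  assumes V: "smooth_function V" and c: "c \<in> charts_at p"
  shows "local_metric c (chart_map c p) (grad V p c) w =
    frechet_derivative (V \<circ> chart_inv c) (at (chart_map c p)) w"
proof -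
  let ?d = "\<lambda>c. frechet_derivative (V \<circ> chart_inv c) (at (chart_map c p))"
  have deriv: "((V \<circ> chart_inv c) has_derivative ?d c) (at (chart_map c p))" if "c \<in> charts_at p" for c
    using V smooth_on_open_derivative(2)[OF open_chart_image[OF charts_atD(1)[OF that]] _ charts_atD(2)[OF that]]
      charts_atD(1)[OF that] unfolding smooth_function_def by blast
  have change: "?d c' (frechet_derivative (transition c c') (at (chart_map c p)) u) = ?d c u"
    if c': "c' \<in> charts_at p" for c' u
  proof -
    let ?S = "chart_map c ` (chart_dom c \<inter> chart_dom c')"
    have cc: "c \<in> A" "c' \<in> A" and x: "chart_map c p \<in> ?S"
      using c c' by (auto simp: charts_at_def)
    have "((V \<circ> chart_inv c') \<circ> transition c c' has_derivative
        ?d c' \<circ> frechet_derivative (transition c c') (at (chart_map c p))) (at (chart_map c p))"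
      by (rule diff_chain_at[OF transition_has_derivative[OF c c']])
        (simp add: transition_map[OF c] deriv[OF c'])
    then have "((V \<circ> chart_inv c) has_derivative
        ?d c' \<circ> frechet_derivative (transition c c') (at (chart_map c p))) (at (chart_map c p))"
    proof (rule has_derivative_transform_within_open[OF _ open_chart_map_image[OF cc(1) open_chart_dom[OF cc(2)]] x])
      fix z assume "z \<in> ?S"
      then obtain r where "z = chart_map c r" "c \<in> charts_at r" "c' \<in> charts_at r"
        using cc by (auto simp: charts_at_def)
      then show "((V \<circ> chart_inv c') \<circ> transition c c') z = (V \<circ> chart_inv c) z"
        by (simp add: transition_map chart_inv_map)
    qed
    from has_derivative_unique[OF this deriv[OF c]] show ?thesis by (metis comp_apply)
  qed
  obtain \<zeta> where \<zeta>: "\<And>w. local_metric c (chart_map c p) \<zeta> w = ?d c w"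
    using local_metric_riesz[OF charts_atD[OF c] has_derivative_linear[OF deriv[OF c]]] by blast
  have "grad V p = tvec_of c \<zeta> p"
    unfolding grad_def
  proof (rule the_equality, intro conjI ballI)
    show "tvec_of c \<zeta> p \<in> tangent_space p" by (rule tvec_of_tangent[OF c])
    fix w c' assume w: "w \<in> tangent_space p" and c': "c' \<in> charts_at p"
    have "g p (tvec_of c \<zeta> p) w = ?d c (w c)"
      using local_metric_eq[OF tvec_of_tangent[OF c] w c, of \<zeta>] \<zeta> by (simp add: tvec_of_chart[OF c])
    also have "\<dots> = ?d c' (w c')"
      by (simp add: tangent_transform[OF w c c'] change[OF c'])
    finally show "g p (tvec_of c \<zeta> p) w = ?d c' (w c')" .
  next
    fix z assume z: "z \<in> tangent_space p \<and> (\<forall>w\<in>tangent_space p. \<forall>c\<in>charts_at p. g p z w = ?d c (w c))"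
    have "local_metric c (chart_map c p) (z c) w = ?d c w" for w
      using z local_metric_eq[of z p "tvec_of c w p" c] tvec_of_tangent[OF c, of w] c
      by (simp add: tvec_of_chart[OF c])
    then have "z c = \<zeta>"
      using local_metric_riesz[OF charts_atD[OF c] has_derivative_linear[OF deriv[OF c]]] \<zeta> by metis
    then show "z = tvec_of c \<zeta> p" using tvec_of_tangent_vector[of z p c] z c by simp
  qed
  then show ?thesis using \<zeta> by (simp add: tvec_of_chart[OF c])
qed

end

section \<open>Bi-Jacobi fields in a chart\<close>

locale riemannian_curve = riemannian_manifold A g
  for A :: "('q::{t2_space, second_countable_topology}, 'e::euclidean_space) chart set" and g +
  fixes T :: real and q :: "real \<Rightarrow> 'q" and V :: "'q \<Rightarrow> real"
  assumes T: "T > 0" and q: "smooth_curve {0..T} q" and V: "smooth_function V"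
begin

text \<open>The times at which the curve is in \<open>W\<close>. For open \<open>W\<close> this set is relatively open in \<open>[0, T]\<close>, so
  derivatives within it agree with those within \<open>[0, T]\<close>.\<close>

definition time_set where "time_set W = {t \<in> {0..T}. q t \<in> W}"

lemma time_set_nhd:
  assumes W: "open W" and t: "t \<in> time_set W"
  shows "\<exists>r>0. {0..T} \<inter> ball t r \<subseteq> time_set W"
proof -
  have "continuous_on {0..T} q" using q by (simp add: smooth_curve_def)
  then obtain B where B: "open B" "B \<inter> {0..T} = q -` W \<inter> {0..T}"
    using W unfolding continuous_on_open_invariant by blast
  then have "t \<in> B" using t by (auto simp: time_set_def)
  then obtain r where "r > 0" "ball t r \<subseteq> B" using B(1) open_contains_ball by blast
  then show ?thesis using B(2) unfolding time_set_def by blast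
qed

lemma at_within_time_set:
  assumes W: "open W" and t: "t \<in> time_set W"
  shows "at t within time_set W = at t within {0..T}"
proof -
  obtain r where r: "r > 0" "{0..T} \<inter> ball t r \<subseteq> time_set W" using time_set_nhd[OF assms] by blast
  have "time_set W \<subseteq> {0..T}" by (auto simp: time_set_def)
  then have "time_set W \<inter> ball t r - {t} = {0..T} \<inter> ball t r - {t}" using r(2) by blast
  then show ?thesis using at_within_nhd[of t "ball t r" "time_set W" "{0..T}"] r(1) by simp
qed

lemma derivative_domain_time_set:
  assumes W: "open W" shows "derivative_domain (time_set W)"
  unfolding derivative_domain_def
proof (intro ballI allI impI)
  fix t i e :: real assume t: "t \<in> time_set W" and i: "i \<in> Basis" and e: "0 < e"
  obtain r where r: "r > 0" "{0..T} \<inter> ball t r \<subseteq> time_set W" using time_set_nhd[OF W t] by blast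
  have tT: "t \<in> {0..T}" using t by (simp add: time_set_def)
  define d where "d = (if t < T then min (min (r / 2) (e / 2)) (T - t) else - min (min (r / 2) (e / 2)) T)"
  have "t + d \<in> {0..T}" "dist t (t + d) < r" "0 < \<bar>d\<bar>" "\<bar>d\<bar> < e"
    using r(1) e tT T by (auto simp: d_def dist_real_def)
  then show "\<exists>d. 0 < \<bar>d\<bar> \<and> \<bar>d\<bar> < e \<and> t + d *\<^sub>R i \<in> time_set W"
    using i r(2) by (intro exI[of _ d]) auto
qed

abbreviation S where "S c \<equiv> time_set (chart_dom c)"

lemma S_charts: "c \<in> A \<Longrightarrow> t \<in> S c \<Longrightarrow> c \<in> charts_at (q t)"
  by (auto simp: time_set_def charts_at_def)

lemma charts_S: "c \<in> charts_at (q t) \<Longrightarrow> t \<in> {0..T} \<Longrightarrow> t \<in> S c"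
  by (auto simp: time_set_def charts_at_def)

lemma at_S: "c \<in> A \<Longrightarrow> t \<in> S c \<Longrightarrow> at t within S c = at t within {0..T}"
  by (rule at_within_time_set[OF open_chart_dom])

definition pq where "pq c t = chart_map c (q t)"

definition hess where "hess c x u = frechet_derivative (\<lambda>x. grad V (chart_inv c x) c) (at x) u
  + christoffel c x u (grad V (chart_inv c x) c)"

lemma coordinate_curve_chart:
  assumes c: "c \<in> A"
  shows "coordinate_curve_hessian (chart_image c) (local_metric c) (christoffel c) (S c) (pq c)
    (\<lambda>t. hess c (pq c t))"
proof -
  interpret M: coordinate_metric "chart_image c" "local_metric c" "christoffel c"
    by (rule coordinate_metric_chart[OF c])
  interpret M: coordinate_curve "chart_image c" "local_metric c" "christoffel c" "S c" "pq c"
  proof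
    show "derivative_domain (S c)" by (rule derivative_domain_time_set[OF open_chart_dom[OF c]])
    show "smooth_on (S c) (pq c)"
      using q c unfolding smooth_curve_def time_set_def pq_def[abs_def] comp_def by blast
    show "pq c t \<in> chart_image c" if "t \<in> S c" for t
      using charts_atD(2)[OF S_charts[OF c that]] by (simp add: pq_def)
  qed
  let ?gr = "\<lambda>x. grad V (chart_inv c x) c"
  have sV: "smooth_on (chart_image c) (V \<circ> chart_inv c)" using V c by (simp add: smooth_function_def)
  have grad: "local_metric c x (?gr x) w = frechet_derivative (V \<circ> chart_inv c) (at x) w"
    if "x \<in> chart_image c" for x w
    using grad_chart[OF V chart_imageE(1)[OF c that]] chart_imageE(2)[OF c that] by simp
  have gr: "smooth_on (chart_image c) ?gr"
    by (rule smooth_riesz[where m = "local_metric c", OF M.dom M.m_bilinear M.m_sym M.m_pos M.m_smooth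
          M.smooth_derivative[OF sV] grad])
  have lin: "linear (hess c x)" if x: "x \<in> chart_image c" for x
    using linear_add[OF has_derivative_linear[OF M.smooth_has_derivative[OF gr x]]]
      linear_scale[OF has_derivative_linear[OF M.smooth_has_derivative[OF gr x]]]
    by (intro linearI) (simp_all add: hess_def M.G_expand x algebra_simps)
  have sm: "smooth_on (chart_image c) (\<lambda>x. hess c x u)" for u
    unfolding hess_def by (intro smooth_on_add[OF M.dom] M.smooth_derivative[OF gr] M.G_apply_smooth gr)
  have sym: "local_metric c x (hess c x u) w = local_metric c x (hess c x w) u" if "x \<in> chart_image c" for x u w
    unfolding hess_def by (rule M.hessian_sym[OF that gr sV grad])
  show ?thesis
  proof (intro coordinate_curve_hessian.intro coordinate_curve_hessian_axioms.intro M.coordinate_curve_axioms)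
    show "linear (hess c (pq c t))" if "t \<in> S c" for t by (rule lin[OF M.p_in_U[OF that]])
    show "smooth_on (S c) (\<lambda>t. hess c (pq c t) u)" for u by (rule M.along_smooth[OF sm])
    show "local_metric c (pq c t) (hess c (pq c t) u) w = local_metric c (pq c t) (hess c (pq c t) w) u"
      if "t \<in> S c" for t u w by (rule sym[OF M.p_in_U[OF that]])
  qed
qed

abbreviation cov where "cov \<equiv> cov_deriv_along {0..T} q"
abbreviation vel where "vel \<equiv> velocity {0..T} q"

lemma velocity_chart:
  assumes c: "c \<in> A" and t: "t \<in> S c"
  shows "vel t c = coordinate_curve.y (S c) (pq c) t"
proof -
  interpret C: coordinate_curve_hessian "chart_image c" "local_metric c" "christoffel c" "S c" "pq c"
    "\<lambda>t. hess c (pq c t)" by (rule coordinate_curve_chart[OF c])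
  show ?thesis
  proof -
    have "pq c = chart_map c \<circ> q" by (simp add: fun_eq_iff pq_def)
    then have "C.y t = vector_derivative (chart_map c \<circ> q) (at t within {0..T})"
      unfolding C.y_def at_S[OF c t] by (simp only:)
    then show ?thesis using S_charts[OF c t] by (simp add: velocity_def)
  qed
qed

lemma cov_chart:
  assumes c: "c \<in> A" and t: "t \<in> S c"
  shows "cov X t c = coordinate_curve.D (christoffel c) (S c) (pq c) (\<lambda>s. X s c) t"
proof -
  interpret C: coordinate_curve_hessian "chart_image c" "local_metric c" "christoffel c" "S c" "pq c"
    "\<lambda>t. hess c (pq c t)" by (rule coordinate_curve_chart[OF c])
  show ?thesis
    using S_charts[OF c t]
    by (simp add: cov_deriv_along_def C.D_def velocity_chart[OF c t] at_S[OF c t] pq_def[of c t])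
qed

text \<open>Iterated covariant derivatives are computed by applying this repeatedly.\<close>

lemma cov_cov_chart:
  assumes c: "c \<in> A" and t: "t \<in> S c" and x: "\<And>s. s \<in> S c \<Longrightarrow> X s c = x s"
  shows "cov X t c = coordinate_curve.D (christoffel c) (S c) (pq c) x t"
proof -
  interpret C: coordinate_curve_hessian "chart_image c" "local_metric c" "christoffel c" "S c" "pq c"
    "\<lambda>t. hess c (pq c t)" by (rule coordinate_curve_chart[OF c])
  show ?thesis unfolding cov_chart[OF c t] by (rule C.D_cong[OF x t])
qed

lemma cov_tensor_chart:
  assumes c: "c \<in> A" and t: "t \<in> S c"
    and F: "\<And>s u v w. s \<in> S c \<Longrightarrow> F s u v w c = f s (u c) (v c) (w c)"
  shows "cov_deriv_tensor_along {0..T} q F t u v w c =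
    coordinate_curve.tensor_D (christoffel c) (S c) (pq c) f t (u c) (v c) (w c)"
proof -
  interpret C: coordinate_curve_hessian "chart_image c" "local_metric c" "christoffel c" "S c" "pq c"
    "\<lambda>t. hess c (pq c t)" by (rule coordinate_curve_chart[OF c])
  have tv: "tvec_of c a (q s) c = a" if "s \<in> S c" for a s by (rule tvec_of_chart[OF S_charts[OF c that]])
  have "cov (\<lambda>s. tvec_of c a (q s)) t c = christoffel c (pq c t) (C.y t) a" for a
    using cov_cov_chart[OF c t, of "\<lambda>s. tvec_of c a (q s)" "\<lambda>_. a"] tv C.D_const[OF t] by simp
  moreover have "cov (\<lambda>s. F s (tvec_of c a (q s)) (tvec_of c b (q s)) (tvec_of c e (q s))) t c
      = C.D (\<lambda>s. f s a b e) t" for a b e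
    by (rule cov_cov_chart[OF c t]) (simp add: F tv)
  ultimately show ?thesis
    by (simp add: cov_deriv_tensor_along_def Let_def F[OF t] tv[OF t] C.tensor_D_def)
qed

lemma curvature_chart_curve:
  "c \<in> A \<Longrightarrow> t \<in> S c \<Longrightarrow>
    curvature (q t) u v w c = coordinate_metric.R (christoffel c) (pq c t) (u c) (v c) (w c)"
  using curvature_chart[OF S_charts] by (simp add: pq_def)

text \<open>All ingredients of the bi-Jacobi equation at the chart \<open>c\<close> depend only on the coordinates in \<open>c\<close>, so
  the equation can be read in each chart separately.\<close>

lemma field_solution:
  assumes X: "modified_bi_jacobi_field V T q X" and c: "c \<in> A"
  shows "coordinate_curve_hessian.solution (christoffel c) (S c) (pq c) (\<lambda>t. hess c (pq c t)) (\<lambda>t. X t c)"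
proof -
  interpret C: coordinate_curve_hessian "chart_image c" "local_metric c" "christoffel c" "S c" "pq c"
    "\<lambda>t. hess c (pq c t)" by (rule coordinate_curve_chart[OF c])
  let ?x = "\<lambda>t. X t c"
  have sx: "smooth_on (S c) ?x"
    using X c unfolding modified_bi_jacobi_field_def smooth_field_along_def time_set_def by blast
  have eq: "(cov ^^ 4) X t c + bi_jacobi_F {0..T} q X t c + nabla (\<lambda>_. X t) (grad V) (q t) c = 0"
    if "t \<in> S c" for t
    using X that unfolding modified_bi_jacobi_field_def time_set_def by blast
  have d1: "cov X t c = C.D ?x t" if "t \<in> S c" for t by (rule cov_chart[OF c that])
  have d2: "cov (cov X) t c = C.D (C.D ?x) t" if "t \<in> S c" for t
    by (rule cov_cov_chart[OF c that]) (rule d1)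
  have d3: "cov (cov (cov X)) t c = C.D (C.D (C.D ?x)) t" if "t \<in> S c" for t
    by (rule cov_cov_chart[OF c that]) (rule d2)
  have d4: "cov (cov (cov (cov X))) t c = C.D (C.D (C.D (C.D ?x))) t" if "t \<in> S c" for t
    by (rule cov_cov_chart[OF c that]) (rule d3)
  have v0: "vel t c = C.y t" if "t \<in> S c" for t by (rule velocity_chart[OF c that])
  have v1: "cov vel t c = C.y1 t" if "t \<in> S c" for t by (rule cov_cov_chart[OF c that]) (rule v0)
  have v2: "cov (cov vel) t c = C.y2 t" if "t \<in> S c" for t by (rule cov_cov_chart[OF c that]) (rule v1)
  have R0: "curvature (q t) u v w c = C.R (pq c t) (u c) (v c) (w c)" if "t \<in> S c" for t u v w
    by (rule curvature_chart_curve[OF c that])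
  let ?R1 = "cov_deriv_tensor_along {0..T} q (\<lambda>s. curvature (q s))"
  have R1: "?R1 t u v w c = C.tensor_D (\<lambda>t. C.R (pq c t)) t (u c) (v c) (w c)" if "t \<in> S c" for t u v w
    by (rule cov_tensor_chart[OF c that]) (rule R0)
  have R2: "cov_deriv_tensor_along {0..T} q ?R1 t u v w c = C.R2 t (u c) (v c) (w c)" if "t \<in> S c" for t u v w
    unfolding C.R2_def by (rule cov_tensor_chart[OF c that]) (rule R1)
  have "C.D (C.D (C.D (C.D ?x))) t + C.bi_jacobi_terms ?x t + hess c (pq c t) (X t c) = 0" if t: "t \<in> S c" for t
  proof -
    have "(cov ^^ 4) X t c = C.D (C.D (C.D (C.D ?x))) t"
      using d4[OF t] by (simp add: eval_nat_numeral)
    moreover have "bi_jacobi_F {0..T} q X t c = C.bi_jacobi_terms ?x t"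
      using nabla_curvature_chart[OF S_charts[OF c t]]
      by (simp add: bi_jacobi_F_def Let_def C.bi_jacobi_terms_def R0[OF t] R1[OF t] R2[OF t] C.tensor_D_R[OF t] eval_nat_numeral
          d1[OF t] d2[OF t] v0[OF t] v1[OF t] v2[OF t] pq_def[of c t, symmetric])
    moreover have "nabla (\<lambda>_. X t) (grad V) (q t) c = hess c (pq c t) (X t c)"
      using S_charts[OF c t]
      by (simp add: nabla_def dir_deriv_def hess_def pq_def chart_inv_map)
    ultimately show ?thesis using eq[OF t] by simp
  qed
  then show ?thesis using sx by (simp add: C.solution_def)
qed

end

section \<open>Finiteness of biconjugate points\<close>

context riemannian_curve
begin

abbreviation field where "field \<equiv> smooth_field_along {0..T} q"

lemma chart_exists: "\<exists>c. c \<in> charts_at p"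
proof -
  have "p \<in> (\<Union>c\<in>A. chart_dom c)" using charts_cover by simp
  then show ?thesis unfolding charts_at_def by blast
qed

lemma chart_of_time: "t \<in> {0..T} \<Longrightarrow> \<exists>c. c \<in> A \<and> t \<in> S c"
  using chart_exists[of "q t"] charts_S charts_atD(1) by blast

lemma field_tangent: "field X \<Longrightarrow> t \<in> {0..T} \<Longrightarrow> X t \<in> tangent_space (q t)"
  by (simp add: smooth_field_along_def)

lemma field_smooth: "field X \<Longrightarrow> c \<in> A \<Longrightarrow> smooth_on (S c) (\<lambda>t. X t c)"
  by (simp add: smooth_field_along_def time_set_def)

lemma fieldI:
  assumes "\<And>t. t \<in> {0..T} \<Longrightarrow> X t \<in> tangent_space (q t)" "\<And>c. c \<in> A \<Longrightarrow> smooth_on (S c) (\<lambda>t. X t c)"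
  shows "field X"
  using assms by (simp add: smooth_field_along_def time_set_def)

lemma p_deriv_chart:
  assumes c: "c \<in> charts_at (q t)" and t: "t \<in> {0..T}"
  shows "(pq c has_vector_derivative vel t c) (at t within {0..T})"
proof -
  have cA: "c \<in> A" and tS: "t \<in> S c" using c t by (auto intro: charts_atD charts_S)
  interpret C: coordinate_curve_hessian "chart_image c" "local_metric c" "christoffel c" "S c" "pq c"
    "\<lambda>t. hess c (pq c t)" by (rule coordinate_curve_chart[OF cA])
  show ?thesis using C.p_deriv[OF tS] by (simp add: velocity_chart[OF cA tS] at_S[OF cA tS])
qed

lemma velocity_tangent:
  assumes t: "t \<in> {0..T}" shows "vel t \<in> tangent_space (q t)"
proof (rule tangentI)
  show "vel t c = 0" if "c \<notin> charts_at (q t)" for c using that by (simp add: velocity_def)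
  fix c c' assume c: "c \<in> charts_at (q t)" and c': "c' \<in> charts_at (q t)"
  note cA = charts_atD(1)[OF c] and cA' = charts_atD(1)[OF c']
  let ?J = "time_set (chart_dom c \<inter> chart_dom c')"
  have oJ: "open (chart_dom c \<inter> chart_dom c')" using open_chart_dom cA cA' by blast
  have tJ: "t \<in> ?J" using c c' t by (auto simp: time_set_def charts_at_def)
  note dJ = derivative_domain_time_set[OF oJ] and aJ = at_within_time_set[OF oJ tJ]
  have "((\<lambda>s. transition c c' (pq c s)) has_vector_derivative
      frechet_derivative (transition c c') (at (pq c t)) (vel t c)) (at t within {0..T})"
    unfolding has_vector_derivative_def
    using has_derivative_compose[OF p_deriv_chart[OF c t, unfolded has_vector_derivative_def]
        transition_has_derivative[OF c c', folded pq_def]]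
      linear_scale[OF has_derivative_linear[OF transition_has_derivative[OF c c', folded pq_def]]] by simp
  then have "((\<lambda>s. transition c c' (pq c s)) has_vector_derivative
      frechet_derivative (transition c c') (at (pq c t)) (vel t c)) (at t within ?J)" by (simp add: aJ)
  moreover have "transition c c' (pq c s) = pq c' s" if "s \<in> ?J" for s
    using that cA by (simp add: pq_def transition_map time_set_def charts_at_def)
  ultimately have "(pq c' has_vector_derivative
      frechet_derivative (transition c c') (at (pq c t)) (vel t c)) (at t within ?J)"
    using has_vector_derivative_transform[OF tJ, of "pq c'" "\<lambda>s. transition c c' (pq c s)"] by simp
  moreover have "(pq c' has_vector_derivative vel t c') (at t within ?J)"
    using p_deriv_chart[OF c' t] by (simp add: aJ)
  ultimately show "vel t c' = frechet_derivative (transition c c') (at (chart_map c (q t))) (vel t c)"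
    using has_vector_derivative_within_unique[OF dJ tJ] by (simp add: pq_def)
qed

lemma velocity_field: "field vel"
proof (rule fieldI[OF velocity_tangent])
  fix c assume c: "c \<in> A"
  interpret C: coordinate_curve_hessian "chart_image c" "local_metric c" "christoffel c" "S c" "pq c"
    "\<lambda>t. hess c (pq c t)" by (rule coordinate_curve_chart[OF c])
  show "smooth_on (S c) (\<lambda>t. vel t c)"
    using C.y_smooth smooth_on_cong[OF C.S, of "\<lambda>t. vel t c" C.y] velocity_chart[OF c] by simp
qed

text \<open>Differentiating \<open>X c' = d\<phi> (X c)\<close> along the curve produces a second derivative of \<open>\<phi>\<close>, which is
  exactly the defect in the transformation rule of the Christoffel symbols.\<close>

lemma cov_tangent:
  assumes X: "field X" and t: "t \<in> {0..T}" shows "cov X t \<in> tangent_space (q t)"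
proof (rule tangentI)
  show "cov X t c = 0" if "c \<notin> charts_at (q t)" for c using that by (simp add: cov_deriv_along_def)
  fix c c' assume c: "c \<in> charts_at (q t)" and c': "c' \<in> charts_at (q t)"
  note cA = charts_atD(1)[OF c] and cA' = charts_atD(1)[OF c']
  interpret T: coordinate_change "chart_image c" "chart_image c'" "local_metric c" "christoffel c"
    "local_metric c'" "christoffel c'" "chart_map c ` (chart_dom c \<inter> chart_dom c')" "transition c c'"
    by (rule coordinate_change_transition[OF cA cA'])
  let ?J = "time_set (chart_dom c \<inter> chart_dom c')"
  have oJ: "open (chart_dom c \<inter> chart_dom c')" using open_chart_dom cA cA' by blast
  have tJ: "t \<in> ?J" using c c' t by (auto simp: time_set_def charts_at_def)
  note dJ = derivative_domain_time_set[OF oJ] and aJ = at_within_time_set[OF oJ tJ]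
  have pV: "pq c s \<in> chart_map c ` (chart_dom c \<inter> chart_dom c')" if "s \<in> ?J" for s
    using that by (auto simp: pq_def time_set_def)
  have sJ: "c \<in> charts_at (q s)" "c' \<in> charts_at (q s)" "s \<in> {0..T}" if "s \<in> ?J" for s
    using that cA cA' by (auto simp: time_set_def charts_at_def)
  have der: "((\<lambda>s. X s c) has_vector_derivative vector_derivative (\<lambda>s. X s c) (at t within {0..T}))
      (at t within {0..T})" if c: "c \<in> charts_at (q t)" for c
    using smooth_on_vector_derivative(1)[OF derivative_domain_time_set[OF open_chart_dom[OF charts_atD(1)[OF c]]]
        field_smooth[OF X charts_atD(1)[OF c]] charts_S[OF c t]]
    by (simp add: at_S[OF charts_atD(1)[OF c] charts_S[OF c t]])
  let ?x' = "\<lambda>c. vector_derivative (\<lambda>s. X s c) (at t within {0..T})"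
  have L: "((\<lambda>s. T.d\<phi> (pq c s) u) has_derivative (\<lambda>h. h *\<^sub>R T.dd\<phi> (pq c t) (vel t c) u)) (at t within ?J)" for u
    using has_derivative_compose[OF p_deriv_chart[OF c t, unfolded has_vector_derivative_def]
        T.d\<phi>_deriv[OF pV[OF tJ], of u]]
      linear_scale[OF has_derivative_linear[OF T.d\<phi>_deriv[OF pV[OF tJ], of u]]] by (simp add: aJ)
  have derJ: "((\<lambda>s. X s c) has_derivative (\<lambda>h. h *\<^sub>R ?x' c)) (at t within ?J)"
    using der[OF c] by (simp add: has_vector_derivative_def aJ)
  have "((\<lambda>s. T.d\<phi> (pq c s) (X s c)) has_vector_derivative
      T.dd\<phi> (pq c t) (vel t c) (X t c) + T.d\<phi> (pq c t) (?x' c)) (at t within ?J)"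
    using has_derivative_linear_apply[where L = "\<lambda>s. T.d\<phi> (pq c s)", OF dJ tJ T.d\<phi>_linear[OF pV] L derJ]
    by (simp add: has_vector_derivative_def scaleR_add_right linear_scale[OF T.d\<phi>_linear[OF pV[OF tJ]]])
  moreover have X_eq: "X s c' = T.d\<phi> (pq c s) (X s c)" if "s \<in> ?J" for s
    using tangent_transform[OF field_tangent[OF X sJ(3)[OF that]] sJ(1,2)[OF that]]
    by (simp add: T.d\<phi>_def pq_def)
  ultimately have "((\<lambda>s. X s c') has_vector_derivative
      T.dd\<phi> (pq c t) (vel t c) (X t c) + T.d\<phi> (pq c t) (?x' c)) (at t within ?J)"
    using has_vector_derivative_transform[OF tJ, of "\<lambda>s. X s c'" "\<lambda>s. T.d\<phi> (pq c s) (X s c)"] by simp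
  moreover have "((\<lambda>s. X s c') has_vector_derivative ?x' c') (at t within ?J)"
    using der[OF c'] by (simp add: aJ)
  ultimately have x': "?x' c' = T.dd\<phi> (pq c t) (vel t c) (X t c) + T.d\<phi> (pq c t) (?x' c)"
    using has_vector_derivative_within_unique[OF dJ tJ] by blast
  have vel: "vel t c' = T.d\<phi> (pq c t) (vel t c)"
    using tangent_transform[OF velocity_tangent[OF t] c c'] by (simp add: T.d\<phi>_def pq_def)
  have "cov X t c' = T.d\<phi> (pq c t) (cov X t c)"
    using c c' T.christoffel_transform[OF pV[OF tJ], of "vel t c" "X t c"]
    by (simp add: cov_deriv_along_def x' vel X_eq[OF tJ]
        linear_add[OF T.d\<phi>_linear[OF pV[OF tJ]], unfolded pq_def] pq_def transition_map algebra_simps)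
  then show "cov X t c' = frechet_derivative (transition c c') (at (chart_map c (q t))) (cov X t c)"
    by (simp add: T.d\<phi>_def pq_def)
qed

lemma cov_field:
  assumes X: "field X" shows "field (cov X)"
proof (rule fieldI[OF cov_tangent[OF X]])
  fix c assume c: "c \<in> A"
  interpret C: coordinate_curve_hessian "chart_image c" "local_metric c" "christoffel c" "S c" "pq c"
    "\<lambda>t. hess c (pq c t)" by (rule coordinate_curve_chart[OF c])
  show "smooth_on (S c) (\<lambda>t. cov X t c)"
    using C.D_smooth[OF field_smooth[OF X c]] cov_chart[OF c]
      smooth_on_cong[OF C.S, of "\<lambda>t. cov X t c" "C.D (\<lambda>t. X t c)"] by simp
qed

lemma curvature_field:
  assumes "field X" "field Y" "field Z" shows "field (\<lambda>t. curvature (q t) (X t) (Y t) (Z t))"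
proof (rule fieldI)
  show "curvature (q t) (X t) (Y t) (Z t) \<in> tangent_space (q t)" if "t \<in> {0..T}" for t
    by (intro curvature_tangent field_tangent assms that)
  fix c assume c: "c \<in> A"
  interpret C: coordinate_curve_hessian "chart_image c" "local_metric c" "christoffel c" "S c" "pq c"
    "\<lambda>t. hess c (pq c t)" by (rule coordinate_curve_chart[OF c])
  show "smooth_on (S c) (\<lambda>t. curvature (q t) (X t) (Y t) (Z t) c)"
    using C.R_along_smooth[OF assms[THEN field_smooth[OF _ c]]]
      smooth_on_cong[OF C.S, of "\<lambda>t. curvature (q t) (X t) (Y t) (Z t) c"
        "\<lambda>t. C.R (pq c t) (X t c) (Y t c) (Z t c)"] curvature_chart_curve[OF c] by simp
qed

lemma add_field:
  assumes "field X" "field Y" shows "field (\<lambda>t c. X t c + Y t c)"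
proof (rule fieldI)
  show "(\<lambda>c. X t c + Y t c) \<in> tangent_space (q t)" if "t \<in> {0..T}" for t
    by (intro tangent_add field_tangent assms that)
  show "smooth_on (S c) (\<lambda>t. X t c + Y t c)" if c: "c \<in> A" for c
    by (intro smooth_on_add[OF derivative_domain_time_set[OF open_chart_dom[OF c]]] field_smooth assms c)
qed

definition accel_var_field where "accel_var_field X = (\<lambda>t c. cov (cov X) t c + curvature (q t) (X t) (vel t) (vel t) c)"
definition jerk_var_field where "jerk_var_field X = (\<lambda>t c. cov (accel_var_field X) t c + curvature (q t) (X t) (vel t) (cov vel t) c)"

text \<open>The boundary form of two fields, now defined by tangent vectors and so for the whole curve at
  once.\<close>

definition field_boundary_form where "field_boundary_form X Z t = g (q t) (jerk_var_field X t) (Z t) - g (q t) (accel_var_field X t) (cov Z t)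
  + g (q t) (curvature (q t) (cov vel t) (vel t) (X t)) (Z t) / 2"

lemma accel_var_field_field: "field X \<Longrightarrow> field (accel_var_field X)"
  unfolding accel_var_field_def by (rule add_field[OF cov_field[OF cov_field] curvature_field[OF _ velocity_field velocity_field]])

lemma jerk_var_field_field: "field X \<Longrightarrow> field (jerk_var_field X)"
  unfolding jerk_var_field_def
  by (rule add_field[OF cov_field[OF accel_var_field_field] curvature_field[OF _ velocity_field cov_field[OF velocity_field]]])

lemma field_boundary_form_chart:
  assumes X: "field X" and Z: "field Z" and c: "c \<in> A" and t: "t \<in> S c"
  shows "field_boundary_form X Z t = coordinate_curve.boundary_form (local_metric c) (christoffel c) (S c) (pq c) (\<lambda>t. X t c) (\<lambda>t. Z t c) t"
proof -
  interpret C: coordinate_curve_hessian "chart_image c" "local_metric c" "christoffel c" "S c" "pq c"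
    "\<lambda>t. hess c (pq c t)" by (rule coordinate_curve_chart[OF c])
  have tT: "t \<in> {0..T}" using t by (simp add: time_set_def)
  note ch = S_charts[OF c t]
  have g: "g (q t) (Y t) (Y' t) = local_metric c (pq c t) (Y t c) (Y' t c)" if "field Y" "field Y'" for Y Y'
    using local_metric_eq[OF field_tangent[OF that(1) tT] field_tangent[OF that(2) tT] ch] by (simp add: pq_def)
  have R: "curvature (q t) u v w c = C.R (pq c t) (u c) (v c) (w c)" if "t \<in> S c" for t u v w
    by (rule curvature_chart_curve[OF c that])
  have d1: "cov Y t c = C.D (\<lambda>t. Y t c) t" if "t \<in> S c" for t Y by (rule cov_chart[OF c that])
  have d2: "cov (cov Y) t c = C.D (C.D (\<lambda>t. Y t c)) t" if "t \<in> S c" for t Y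
    by (rule cov_cov_chart[OF c that]) (rule d1)
  have v0: "vel t c = C.y t" if "t \<in> S c" for t by (rule velocity_chart[OF c that])
  have v1: "cov vel t c = C.y1 t" if "t \<in> S c" for t by (rule cov_cov_chart[OF c that]) (rule v0)
  have U: "accel_var_field X t c = C.accel_var (\<lambda>t. X t c) t" if "t \<in> S c" for t
    by (simp add: accel_var_field_def C.accel_var_def R[OF that] d2[OF that] v0[OF that])
  have "cov (accel_var_field X) t c = C.D (C.accel_var (\<lambda>t. X t c)) t"
    by (rule cov_cov_chart[OF c t]) (rule U)
  then have W: "jerk_var_field X t c = C.jerk_var (\<lambda>t. X t c) t"
    by (simp add: jerk_var_field_def C.jerk_var_def R[OF t] v0[OF t] v1[OF t])
  show ?thesis
    using g[OF jerk_var_field_field[OF X] Z] g[OF accel_var_field_field[OF X] cov_field[OF Z]]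
      g[OF curvature_field[OF cov_field[OF velocity_field] velocity_field X] Z]
    by (simp add: field_boundary_form_def C.boundary_form_def W U[OF t] d1[OF t, of Z] R[OF t] v0[OF t] v1[OF t])
qed

lemma field_boundary_form_double_zero:
  assumes X: "field X" and Z: "field Z" and t: "t \<in> {0..T}"
    and zero: "Z t = (\<lambda>c. 0)" "cov Z t = (\<lambda>c. 0)"
  shows "field_boundary_form X Z t = 0"
proof -
  obtain c where c: "c \<in> A" and tS: "t \<in> S c" using chart_of_time[OF t] by blast
  interpret C: coordinate_curve_hessian "chart_image c" "local_metric c" "christoffel c" "S c" "pq c"
    "\<lambda>t. hess c (pq c t)" by (rule coordinate_curve_chart[OF c])
  have "C.D (\<lambda>t. Z t c) t = 0" using cov_chart[OF c tS, of Z] zero(2) by simp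
  then show ?thesis
    using field_boundary_form_chart[OF X Z c tS] zero(1)
    by (simp add: C.boundary_form_def bilinear_rzero[OF C.m_bilinear] C.p_in_U[OF tS])
qed

lemma jacobi_field: "modified_bi_jacobi_field V T q X \<Longrightarrow> field X"
  by (simp add: modified_bi_jacobi_field_def)

text \<open>The derivative of the difference is zero near each time by \<open>concomitant_constant\<close> in a chart there,
  and the difference does not depend on the chart.\<close>

lemma field_boundary_form_symmetric:
  assumes X: "modified_bi_jacobi_field V T q X" and Z: "modified_bi_jacobi_field V T q Z"
    and \<tau>: "\<tau> \<in> {0..T}" "field_boundary_form X Z \<tau> = field_boundary_form Z X \<tau>" and t: "t \<in> {0..T}"
  shows "field_boundary_form X Z t = field_boundary_form Z X t"
proof -
  let ?B = "\<lambda>t. field_boundary_form X Z t - field_boundary_form Z X t"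
  have "(?B has_derivative (\<lambda>h. 0)) (at t within {0..T})" if t: "t \<in> {0..T}" for t
  proof -
    obtain c where c: "c \<in> A" "t \<in> S c" using chart_of_time[OF t] by blast
    interpret C: coordinate_curve_hessian "chart_image c" "local_metric c" "christoffel c" "S c" "pq c"
      "\<lambda>t. hess c (pq c t)" by (rule coordinate_curve_chart[OF c(1)])
    have "(?B has_vector_derivative 0) (at t within S c)"
      using C.concomitant_constant[OF field_solution[OF X c(1)] field_solution[OF Z c(1)] c(2)]
      by (rule has_vector_derivative_transform[OF c(2), rotated])
        (simp add: field_boundary_form_chart[OF jacobi_field[OF X] jacobi_field[OF Z] c(1)]
          field_boundary_form_chart[OF jacobi_field[OF Z] jacobi_field[OF X] c(1)])
    then show ?thesis by (simp add: has_vector_derivative_def at_S[OF c])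
  qed
  then obtain k where k: "\<And>t. t \<in> {0..T} \<Longrightarrow> ?B t = k"
    using has_derivative_zero_constant[of "{0..T}" ?B] by auto
  show ?thesis using k[OF \<tau>(1)] k[OF t] \<tau>(2) by simp
qed

lemma zero_coordinate:
  assumes X: "field X" and c: "c \<in> A" and t: "t \<in> S c" and zero: "X t c = 0"
  shows "X t = (\<lambda>c. 0)"
proof
  fix c'
  have tT: "t \<in> {0..T}" using t by (simp add: time_set_def)
  note ch = S_charts[OF c t]
  show "X t c' = 0"
  proof (cases "c' \<in> charts_at (q t)")
    case True
    show ?thesis
      using tangent_transform[OF field_tangent[OF X tT] ch True] zero
        linear_0[OF has_derivative_linear[OF transition_has_derivative[OF ch True]]] by simp
  next
    case False
    then show ?thesis by (rule tangent_outside[OF field_tangent[OF X tT]])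
  qed
qed

lemma chart_interval:
  assumes t: "t \<in> {0..T}"
  shows "\<exists>c\<in>A. \<exists>r>0. {0..T} \<inter> {t - r..t + r} \<subseteq> S c"
proof -
  obtain c where c: "c \<in> A" "t \<in> S c" using chart_of_time[OF t] by blast
  obtain r where r: "r > 0" "{0..T} \<inter> ball t r \<subseteq> S c" using time_set_nhd[OF open_chart_dom[OF c(1)] c(2)] by blast
  have "{t - r / 2..t + r / 2} \<subseteq> ball t r" using r(1) by (auto simp: dist_real_def)
  then have "{0..T} \<inter> {t - r / 2..t + r / 2} \<subseteq> S c" using r(2) by blast
  then show ?thesis using c(1) r(1) by (intro bexI[of _ c] exI[of _ "r / 2"]) auto
qed

definition vanishes_near where
  "vanishes_near X t \<longleftrightarrow> (\<exists>e>0. \<forall>s\<in>{0..T}. \<bar>s - t\<bar> < e \<longrightarrow> X s = (\<lambda>c. 0))"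

text \<open>By uniqueness in a chart, whether \<open>X\<close> vanishes near a time is locally constant, and \<open>[0, T]\<close> is
  connected.\<close>

lemma vanishing_propagates:
  assumes X: "modified_bi_jacobi_field V T q X" and s: "s \<in> {0..T}" "vanishes_near X s" and t: "t \<in> {0..T}"
  shows "X t = (\<lambda>c. 0)"
proof -
  have "eventually (\<lambda>r. vanishes_near X t = vanishes_near X r) (at t within {0..T})" if t: "t \<in> {0..T}" for t
  proof -
    obtain c r where c: "c \<in> A" and r: "r > 0" "{0..T} \<inter> {t - r..t + r} \<subseteq> S c"
      using chart_interval[OF t] by blast
    interpret C: coordinate_curve_hessian "chart_image c" "local_metric c" "christoffel c" "S c" "pq c"
      "\<lambda>t. hess c (pq c t)" by (rule coordinate_curve_chart[OF c])
    define a b where "a = max 0 (t - r)" and "b = min T (t + r)"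
    have ab: "{a..b} = {0..T} \<inter> {t - r..t + r}" by (auto simp: a_def b_def)
    have all: "X w = (\<lambda>c. 0)" if s: "s \<in> {a..b}" "vanishes_near X s" and w: "w \<in> {a..b}" for s w
    proof -
      obtain e where e: "e > 0" "\<And>v. v \<in> {0..T} \<Longrightarrow> \<bar>v - s\<bar> < e \<Longrightarrow> X v = (\<lambda>c. 0)"
        using s(2) unfolding vanishes_near_def by blast
      have "X w c = 0"
      proof (rule C.solution_zero[OF field_solution[OF X c], where a = a and b = b and c = "s - e" and d = "s + e" and s = s])
        show "{a..b} \<subseteq> S c" unfolding ab by (rule r(2))
        show "X v c = 0" if "v \<in> S c \<inter> {s - e<..<s + e}" for v
          using e(2)[of v] that by (simp add: time_set_def abs_less_iff)
      qed (use s(1) w e(1) in auto)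
      then show ?thesis using zero_coordinate[OF jacobi_field[OF X] c] w r(2) unfolding ab by blast
    qed
    have "vanishes_near X t = vanishes_near X w" if w: "w \<in> {0..T}" "dist w t < r" for w
    proof -
      have tw: "t \<in> {a..b}" "w \<in> {a..b}"
        unfolding ab using t w r(1) by (auto simp: dist_real_def)
      have "vanishes_near X v" if s: "s \<in> {a..b}" "vanishes_near X s" and v: "dist v t < r" for s v
        unfolding vanishes_near_def
      proof (intro exI conjI ballI impI)
        show "0 < r - dist v t" using v by simp
        fix u assume u: "u \<in> {0..T}" "\<bar>u - v\<bar> < r - dist v t"
        then have "u \<in> {a..b}" unfolding ab by (auto simp: dist_real_def)
        then show "X u = (\<lambda>c. 0)" by (rule all[OF s])
      qed
      from this[OF tw(1), of w] this[OF tw(2), of t] w(2) r(1) show ?thesis by auto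
    qed
    then show ?thesis unfolding eventually_at using r(1) by blast
  qed
  then have "vanishes_near X t = vanishes_near X s"
    using connected_local_const[of "{0..T}" t s "vanishes_near X"] t s(1) by auto
  then show ?thesis using s(2) t unfolding vanishes_near_def by auto
qed

lemma finite_biconjugate:
  assumes \<tau>: "\<tau> \<in> {0..T}"
  shows "finite {t \<in> {0..T}. biconjugate V T q \<tau> t}" (is "finite ?B")
proof (rule ccontr)
  assume inf: "infinite ?B"
  have "\<forall>t\<in>?B. \<exists>X. modified_bi_jacobi_field V T q X \<and> (\<exists>s\<in>{0..T}. X s \<noteq> (\<lambda>c. 0)) \<and>
       X \<tau> = (\<lambda>c. 0) \<and> X t = (\<lambda>c. 0) \<and> cov X \<tau> = (\<lambda>c. 0) \<and> cov X t = (\<lambda>c. 0)"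
  proof
    fix t assume "t \<in> ?B"
    then have "biconjugate V T q \<tau> t" by simp
    then show "\<exists>X. modified_bi_jacobi_field V T q X \<and> (\<exists>s\<in>{0..T}. X s \<noteq> (\<lambda>c. 0)) \<and>
       X \<tau> = (\<lambda>c. 0) \<and> X t = (\<lambda>c. 0) \<and> cov X \<tau> = (\<lambda>c. 0) \<and> cov X t = (\<lambda>c. 0)"
      unfolding biconjugate_def by (elim conjE)
  qed
  from bchoice[OF this] obtain X where chosen: "\<forall>t\<in>?B. modified_bi_jacobi_field V T q (X t) \<and>
       (\<exists>s\<in>{0..T}. X t s \<noteq> (\<lambda>c. 0)) \<and>
       X t \<tau> = (\<lambda>c. 0) \<and> X t t = (\<lambda>c. 0) \<and> cov (X t) \<tau> = (\<lambda>c. 0) \<and> cov (X t) t = (\<lambda>c. 0)"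
    by (elim exE)
  have X: "modified_bi_jacobi_field V T q (X t)" "\<exists>s\<in>{0..T}. X t s \<noteq> (\<lambda>c. 0)"
    "X t \<tau> = (\<lambda>c. 0)" "X t t = (\<lambda>c. 0)" "cov (X t) \<tau> = (\<lambda>c. 0)" "cov (X t) t = (\<lambda>c. 0)"
    if t: "t \<in> ?B" for t
    using bspec[OF chosen t] by - (elim conjE, assumption)+
  obtain t0 where t0: "t0 \<in> {0..T}" "t0 islimpt ?B"
    using Heine_Borel_imp_Bolzano_Weierstrass[OF compact_Icc inf, of 0 T] by blast
  obtain c r where c: "c \<in> A" and r: "r > 0" "{0..T} \<inter> {t0 - r..t0 + r} \<subseteq> S c"
    using chart_interval[OF t0(1)] by blast
  interpret C: coordinate_curve_hessian "chart_image c" "local_metric c" "christoffel c" "S c" "pq c"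
    "\<lambda>t. hess c (pq c t)" by (rule coordinate_curve_chart[OF c])
  define a b where "a = max 0 (t0 - r)" and "b = min T (t0 + r)"
  have ab: "{a..b} \<subseteq> S c" "a < b" using r t0(1) T by (auto simp: a_def b_def)
  show False
  proof (rule C.some_field_vanishes[OF ab])
    fix \<delta> assume \<delta>: "\<delta> > 0" and local: "\<And>l d K Y. \<lbrakk>a \<le> l; l < d; d \<le> b; d - l < \<delta>;
      finite K; K \<subseteq> {l<..d}; DIM('e \<times> 'e) < card K;
      \<And>k. k \<in> K \<Longrightarrow> C.solution (Y k); \<And>k. k \<in> K \<Longrightarrow> Y k k = 0; \<And>k. k \<in> K \<Longrightarrow> C.D (Y k) k = 0;
      \<And>j k. j \<in> K \<Longrightarrow> k \<in> K \<Longrightarrow> C.boundary_form (Y j) (Y k) l = C.boundary_form (Y k) (Y j) l\<rbrakk>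
    \<Longrightarrow> \<exists>k\<in>K. \<forall>t\<in>{a..b}. Y k t = 0"
    define e where "e = min r (\<delta> / 3)"
    have e: "e > 0" "e \<le> r" "2 * e < \<delta>" using r(1) \<delta> by (auto simp: e_def)
    define l d where "l = max 0 (t0 - e)" and "d = min T (t0 + e)"
    have ld: "a \<le> l" "l < d" "d \<le> b" "d - l < \<delta>"
      using e t0(1) T by (auto simp: a_def b_def l_def d_def)
    \<comment> \<open>The left end \<open>l\<close> is removed: a field with its double zero there would be cut off at once.\<close>
    have "infinite (?B \<inter> ball t0 e)" using t0(2) e(1) by (simp add: islimpt_eq_infinite_ball)
    then have "infinite (?B \<inter> ball t0 e - {l})" by simp
    then obtain K where K: "finite K" "card K = Suc (DIM('e \<times> 'e))" "K \<subseteq> ?B \<inter> ball t0 e - {l}"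
      using infinite_arbitrarily_large by blast
    have KB: "k \<in> ?B" if "k \<in> K" for k using that K(3) by blast
    have Kld: "K \<subseteq> {l<..d}"
    proof
      fix k assume "k \<in> K"
      then have "k \<in> {0..T}" "dist t0 k < e" "k \<noteq> l" using K(3) by auto
      then show "k \<in> {l<..d}" by (auto simp: l_def d_def dist_real_def)
    qed
    then have KS: "k \<in> S c" if "k \<in> K" for k using that ab(1) ld by force
    have lS: "l \<in> S c" using ab(1) ld by auto
    have lT: "l \<in> {0..T}" using lS by (simp add: time_set_def)
    have "\<exists>k\<in>K. \<forall>t\<in>{a..b}. X k t c = 0"
    proof (rule local[OF ld K(1) Kld, of "\<lambda>k t. X k t c"])
      show "DIM('e \<times> 'e) < card K" by (simp only: K(2) lessI)
      fix k assume k: "k \<in> K"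
      show "C.solution (\<lambda>t. X k t c)" by (rule field_solution[OF X(1)[OF KB[OF k]] c])
      show "X k k c = 0" using X(4)[OF KB[OF k]] by simp
      show "C.D (\<lambda>t. X k t c) k = 0"
        using cov_chart[OF c KS[OF k], of "X k"] X(6)[OF KB[OF k]] by simp
    next
      show "C.boundary_form (\<lambda>t. X j t c) (\<lambda>t. X k t c) l = C.boundary_form (\<lambda>t. X k t c) (\<lambda>t. X j t c) l"
        if j: "j \<in> K" and k: "k \<in> K" for j k
      proof -
        note Xj = X(1)[OF KB[OF j]] and Xk = X(1)[OF KB[OF k]]
        have zero: "field_boundary_form (X i) (X j) \<tau> = 0" if ij: "i \<in> K" "j \<in> K" for i j
          by (rule field_boundary_form_double_zero[OF jacobi_field[OF X(1)[OF KB[OF ij(1)]]]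
                jacobi_field[OF X(1)[OF KB[OF ij(2)]]] \<tau> X(3,5)[OF KB[OF ij(2)]]])
        have "field_boundary_form (X j) (X k) l = field_boundary_form (X k) (X j) l"
          by (rule field_boundary_form_symmetric[OF Xj Xk \<tau> _ lT]) (simp add: zero j k)
        then show ?thesis
          by (simp add: field_boundary_form_chart[OF jacobi_field[OF Xj] jacobi_field[OF Xk] c lS]
            field_boundary_form_chart[OF jacobi_field[OF Xk] jacobi_field[OF Xj] c lS])
      qed
    qed
    then obtain k where k: "k \<in> K" "\<And>t. t \<in> {a..b} \<Longrightarrow> X k t c = 0" by blast
    note Xk = X(1)[OF KB[OF k(1)]]
    have vanish: "X k t = (\<lambda>c. 0)" if "t \<in> {a..b}" for t
      by (rule zero_coordinate[OF jacobi_field[OF Xk] c _ k(2)[OF that]]) (use that ab(1) in blast)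
    have "vanishes_near (X k) t0"
      unfolding vanishes_near_def
    proof (intro exI conjI ballI impI)
      show "0 < r" by (rule r(1))
      show "X k s = (\<lambda>c. 0)" if "s \<in> {0..T}" "\<bar>s - t0\<bar> < r" for s
        by (rule vanish) (use that in \<open>auto simp: a_def b_def\<close>)
    qed
    then show False using vanishing_propagates[OF Xk t0(1)] X(2)[OF KB[OF k(1)]] by blast
  qed
qed

end

theorem corollary2:
  fixes A :: "('q::{t2_space, second_countable_topology}, 'e::euclidean_space) chart set"
    and g :: "'q \<Rightarrow> ('q, 'e) tvec \<Rightarrow> ('q, 'e) tvec \<Rightarrow> real"
    and V :: "'q \<Rightarrow> real" and T :: real and q :: "real \<Rightarrow> 'q" and \<tau> :: real
  assumes "riemannian_manifold A g"
    and "riemannian_manifold.geodesically_complete A g"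
    and "connected (UNIV :: 'q set)"
    and "smooth_manifold.smooth_function A V"
    and "\<And>p. V p \<ge> 0"
    and "T > 0"
    and "riemannian_manifold.modified_cubic_polynomial A g V T q"
    and "\<tau> \<in> {0..T}"
  shows "finite {t \<in> {0..T}. riemannian_manifold.biconjugate A g V T q \<tau> t}"
proof -
  interpret riemannian_manifold A g by (rule assms(1))
  have "smooth_curve {0..T} q"
    using assms(7) by (simp add: modified_cubic_polynomial_def Let_def)
  then interpret riemannian_curve A g T q V
    by unfold_locales (rule assms(6) assms(4) | assumption)+
  show ?thesis by (rule finite_biconjugate[OF assms(8)])
qed

end
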